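(* Let $\mathscr{P}_\bullet$ be an irreducible subfactor planar algebra and let $0<p,q\le\infty$ satisfy $1/p+1/q\ge 1$ and $1/p\ge 1/2$. Then $C_{p,q}=\delta^{2/q-1}$. Moreover, for $x\in\mathscr{P}_{2,\pm}$ the following statements are equivalent: (1) $\|\mathfrak{F}_s(x)\|_q=\delta^{2/q-1}\|x\|_p$ for some $p>0$, $q>0$ with $1/p+1/q>1$ and $1/p>1/2$; (2) $\|\mathfrak{F}_s(x)\|_q=\delta^{2/q-1}\|x\|_p$ for any $p>0$, $q>0$ with $1/p+1/q\ge 1$ and $1/p\ge 1/2$; (3) $x$ is a multiple of a trace-one projection.
   Context: Let $\mathscr{P}_\bullet=\{\mathscr{P}_{n,\pm}\}_{n\ge 0}$ be a subfactor planar algebra in the sense of Jones, with $\delta$ the square root of the Jones index (the value of a closed loop). It is irreducible if $\mathscr{P}_{1,\pm}$ is one-dimensional. Each $\mathscr{P}_{n,\pm}$ is a finite-dimensional C$^*$-algebra and $tr_2$ denotes the unnormalized Markov trace on $\mathscr{P}_{2,\pm}$, so $tr_2(1)=\delta^2$. The string Fourier transform $\mathfrak{F}_s:\mathscr{P}_{2,\pm}\to\mathscr{P}_{2,\mp}$ is the clockwise 1-click rotation. For $x\in\mathscr{P}_{2,\pm}$, $|x|=(x^*x)^{1/2}$, $\|x\|_p=(tr_2(|x|^p))^{1/p}$ for $0<p<\infty$, and $\|x\|_\infty$ is the operator norm. Convention: exponents may equal $\infty$, with $1/\infty=0$. For $0<p,q\le\infty$, $C_{p,q}=\sup_{\|x\|_p=1}\|\mathfrak{F}_s(x)\|_q$,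 the supremum being over $x\in\mathscr{P}_{2,\pm}$. A projection $f\in\mathscr{P}_{2,\pm}$ is a trace-one projection if $tr_2(f)=1$. "Multiple" means scalar multiple. In (2), "for any" means "for all". *)

theory Defs
  imports "HOL-Analysis.Analysis"
begin

section \<open>Shaded planar tangles\<close>

text \<open>
  A planar tangle is encoded by a generic (Morse) drawing of it. The output disc is a large
  rectangle whose marked boundary interval consists of its left, bottom and right sides, so all
  \<open>2 n\<close> boundary points lie on its top side. Every input disc is drawn in the same position: its
  marked interval is at the left, bottom and right and all its strings leave upwards. Reading
  boundary points from left to right is thus reading them clockwise from the marked interval, for
  the output disc and for the input discs alike. The drawing is read from bottom to top
  as a list of elementary layers. The strings present at a given height are numbered
  \<open>0, 1, \<dots>\<close> from the left, and a layer at position \<open>i\<close> has exactly \<open>i\<close> strings to its left: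

  \<^item> \<open>Cup i\<close> is a local minimum of a string; it creates the strings \<open>i\<close> and \<open>i + 1\<close>;
  \<^item> \<open>Cap i\<close> is a local maximum of a string; it joins the strings \<open>i\<close> and \<open>i + 1\<close>;
  \<^item> \<open>Disc k n i\<close> is the input disc with name \<open>k\<close> and \<open>2 n\<close> boundary points; its
    strings become the strings \<open>i, \<dots>, i + 2 n - 1\<close>.

  Such a list determines a set of disjoint arcs, closed loops and discs in the rectangle, and
  every planar tangle is isotopic to one drawn in this way.
\<close>

datatype layer = Cup nat | Cap nat | Disc nat nat nat

primrec pos :: "layer \<Rightarrow> nat" where
  "pos (Cup i) = i"
| "pos (Cap i) = i"
| "pos (Disc k n i) = i"

primrec ins :: "layer \<Rightarrow> nat" where
  "ins (Cup i) = 0"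
| "ins (Cap i) = 2"
| "ins (Disc k n i) = 0"

primrec outs :: "layer \<Rightarrow> nat" where
  "outs (Cup i) = 2"
| "outs (Cap i) = 0"
| "outs (Disc k n i) = 2 * n"

primrec move_to :: "nat \<Rightarrow> layer \<Rightarrow> layer" where
  "move_to j (Cup i) = Cup j"
| "move_to j (Cap i) = Cap j"
| "move_to j (Disc k n i) = Disc k n j"

definition shift :: "nat \<Rightarrow> layer \<Rightarrow> layer" where
  "shift m l = move_to (m + pos l) l"

text \<open>\<open>runs N T M\<close>: starting from \<open>N\<close> strings at the bottom, the layers of \<open>T\<close> can be drawn on top of
  each other and \<open>M\<close> strings come out at the top.\<close>

fun runs :: "nat \<Rightarrow> layer list \<Rightarrow> nat \<Rightarrow> bool" where
  "runs N [] M \<longleftrightarrow> N = M"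
| "runs N (l # T) M \<longleftrightarrow> pos l + ins l \<le> N \<and> runs (N - ins l + outs l) T M"

definition disc_names :: "layer list \<Rightarrow> nat list" where
  "disc_names T = concat (map (\<lambda>l. case l of Disc k n i \<Rightarrow> [k] | _ \<Rightarrow> []) T)"

text \<open>Tangles whose output disc has \<open>2 n\<close> boundary points.\<close>

definition tangle :: "nat \<Rightarrow> layer list \<Rightarrow> bool" where
  "tangle n T \<longleftrightarrow> runs 0 T (2 * n) \<and> distinct (disc_names T)"

text \<open>
  Shadings are the two checkerboard colourings of the regions; \<open>Pos\<close> means that the region at the
  marked interval is unshaded, \<open>Neg\<close> that it is shaded. If the output disc of a tangle has sign \<open>s\<close>,
  then a disc at position \<open>i\<close> is separated from the leftmost region by \<open>i\<close> strings and hence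
  has sign \<open>sign_at s i\<close>.
\<close>

datatype sign = Pos | Neg

primrec opp :: "sign \<Rightarrow> sign" where
  "opp Pos = Neg"
| "opp Neg = Pos"

definition sign_at :: "sign \<Rightarrow> nat \<Rightarrow> sign" where
  "sign_at s i = (if even i then s else opp s)"

subsection \<open>Isotopy\<close>

text \<open>
  Two drawings are isotopic if and only if they are related by the following moves,
  the elementary events in a generic isotopy:
  two layers next to each other exchange their heights (the layer \<open>l\<close> lies to the left of the
  other one); a maximum and a minimum of the same string cancel; an input disc makes a full
  turn about itself. In the last move each of the \<open>2 n\<close> strings leaving the disc winds once around
  it: it passes over the disc to the right, below it, and up on the left.
\<close>

inductive local_move :: "layer list \<Rightarrow> layer list \<Rightarrow> bool" where
  exchange: "local_move [l, shift (pos l + outs l) l'] [shift (pos l + ins l) l', l]"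
| zigzag_right: "local_move [Cup i, Cap (i + 1)] []"
| zigzag_left: "local_move [Cup (i + 1), Cap i] []"
| full_turn: "local_move [Disc k n i]
    (map Cup [i..<i + 2 * n] @ [Disc k n (i + 2 * n)] @ map Cap (rev [i + 2 * n..<i + 4 * n]))"

inductive isotopic :: "nat \<Rightarrow> layer list \<Rightarrow> layer list \<Rightarrow> bool" for n where
  refl: "tangle n T \<Longrightarrow> isotopic n T T"
| sym: "isotopic n T T' \<Longrightarrow> isotopic n T' T"
| trans: "isotopic n T T' \<Longrightarrow> isotopic n T' T'' \<Longrightarrow> isotopic n T T''"
| move: "local_move M M' \<Longrightarrow> tangle n (U @ M @ V) \<Longrightarrow> tangle n (U @ M' @ V)
    \<Longrightarrow> isotopic n (U @ M @ V) (U @ M' @ V)"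

subsection \<open>Composition and reflection\<close>

text \<open>\<open>plug k S T\<close> is the composite in which the input disc \<open>k\<close> of \<open>T\<close> is replaced by the tangle \<open>S\<close>.\<close>

definition plug :: "nat \<Rightarrow> layer list \<Rightarrow> layer list \<Rightarrow> layer list" where
  "plug k S T = concat (map (\<lambda>l. case l of
      Disc k' n i \<Rightarrow> if k' = k then map (shift i) S else [l]
    | _ \<Rightarrow> [l]) T)"

text \<open>\<open>reflect N T\<close> is the mirror image in a vertical line of a drawing starting with \<open>N\<close> strings.
  It maps the marked intervals of the output disc and of all input discs to themselves.\<close>

fun reflect :: "nat \<Rightarrow> layer list \<Rightarrow> layer list" where
  "reflect N [] = []"
| "reflect N (l # T) = move_to (N - pos l - ins l) l # reflect (N - ins l + outs l) T"

section \<open>Planar algebras\<close>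

text \<open>
  The spaces \<open>box A n s\<close> (the \<open>n\<close>-box spaces of sign \<open>s\<close>) are subspaces of an ambient complex vector
  space, which plays no role; they are not required to be independent. \<open>act A s T f\<close> is the action
  of the tangle \<open>T\<close>, with output disc of sign \<open>s\<close>, on the labelling \<open>f\<close> of its input discs.
\<close>

record 'a planar_data =
  smul :: "complex \<Rightarrow> 'a \<Rightarrow> 'a"
  box :: "nat \<Rightarrow> sign \<Rightarrow> 'a set"
  act :: "sign \<Rightarrow> layer list \<Rightarrow> (nat \<Rightarrow> 'a) \<Rightarrow> 'a"
  adj :: "nat \<Rightarrow> sign \<Rightarrow> 'a \<Rightarrow> 'a"

definition labelling :: "('a, 'm) planar_data_scheme \<Rightarrow> sign \<Rightarrow> layer list \<Rightarrow> (nat \<Rightarrow> 'a) \<Rightarrow> bool" where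
  "labelling A s T f \<longleftrightarrow> (\<forall>k n i. Disc k n i \<in> set T \<longrightarrow> f k \<in> box A n (sign_at s i))"

text \<open>\<open>act_plug\<close> is naturality. Together with \<open>act_id\<close> it also yields the invariance under renaming
  of input discs. The condition on names in \<open>act_plug\<close> only says that the discs of the two
  tangles are distinguishable.\<close>

locale planar_algebra =
  fixes A :: "('a::ab_group_add, 'm) planar_data_scheme"
  assumes vector_space: "vector_space (smul A)"
    and subspace_box: "module.subspace (smul A) (box A n s)"
    and act_closed: "tangle n T \<Longrightarrow> labelling A s T f \<Longrightarrow> act A s T f \<in> box A n s"
    and act_cong: "tangle n T \<Longrightarrow> labelling A s T f \<Longrightarrow> (\<And>k. k \<in> set (disc_names T) \<Longrightarrow> f k = g k)
      \<Longrightarrow> act A s T f = act A s T g"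
    and act_add: "tangle m T \<Longrightarrow> labelling A s T f \<Longrightarrow> Disc k n i \<in> set T
      \<Longrightarrow> x \<in> box A n (sign_at s i) \<Longrightarrow> y \<in> box A n (sign_at s i)
      \<Longrightarrow> act A s T (f(k := x + y)) = act A s T (f(k := x)) + act A s T (f(k := y))"
    and act_smul: "tangle m T \<Longrightarrow> labelling A s T f \<Longrightarrow> Disc k n i \<in> set T
      \<Longrightarrow> x \<in> box A n (sign_at s i)
      \<Longrightarrow> act A s T (f(k := smul A c x)) = smul A c (act A s T (f(k := x)))"
    and act_isotopic: "isotopic n T T' \<Longrightarrow> labelling A s T f \<Longrightarrow> act A s T f = act A s T' f"
    and act_id: "x \<in> box A n s \<Longrightarrow> act A s [Disc k n 0] (\<lambda>_. x) = x"
    and act_plug: "tangle m T \<Longrightarrow> Disc k n i \<in> set T \<Longrightarrow> tangle n S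
      \<Longrightarrow> set (disc_names S) \<inter> (set (disc_names T) - {k}) = {}
      \<Longrightarrow> labelling A s (plug k S T) f
      \<Longrightarrow> act A s (plug k S T) f = act A s T (f(k := act A (sign_at s i) S f))"

text \<open>In the next locale \<open>act_adj\<close> says that the action of tangles intertwines the \<open>*\<close>-operation with
  the reflection of tangles.\<close>

locale planar_star_algebra = planar_algebra +
  assumes adj_closed: "x \<in> box A n s \<Longrightarrow> adj A n s x \<in> box A n s"
    and adj_adj: "x \<in> box A n s \<Longrightarrow> adj A n s (adj A n s x) = x"
    and adj_add: "x \<in> box A n s \<Longrightarrow> y \<in> box A n s
      \<Longrightarrow> adj A n s (x + y) = adj A n s x + adj A n s y"
    and adj_smul: "x \<in> box A n s \<Longrightarrow> adj A n s (smul A c x) = smul A (cnj c) (adj A n s x)"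
    and act_adj: "tangle m T \<Longrightarrow> labelling A s T f
      \<Longrightarrow> (\<And>k n i. Disc k n i \<in> set T \<Longrightarrow> g k = adj A n (sign_at s i) (f k))
      \<Longrightarrow> act A s (reflect 0 T) g = adj A m s (act A s T f)"

subsection \<open>The algebra structure and the traces\<close>

text \<open>
  In the usual picture of an element of the \<open>n\<close>-box space, with \<open>n\<close> strings at the top, \<open>n\<close> strings at
  the bottom and the marked interval at the left, the strings \<open>0, \<dots>, n - 1\<close> are the top ones
  from left to right and \<open>n, \<dots>, 2 n - 1\<close> are the bottom ones from right to left. So
  \<open>mult A n s x y\<close> is the vertical composite with \<open>x\<close> on top of \<open>y\<close>, \<open>one A n s\<close> consists of \<open>n\<close> vertical
  strings, and \<open>tr A n s\<close> joins each top string to the bottom string below it, on the right.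
\<close>

definition mult :: "('a, 'm) planar_data_scheme \<Rightarrow> nat \<Rightarrow> sign \<Rightarrow> 'a \<Rightarrow> 'a \<Rightarrow> 'a" where
  "mult A n s x y = act A s ([Disc 0 n 0, Disc 1 n (2 * n)] @ map Cap (rev [n..<2 * n]))
     (\<lambda>k. if k = 0 then x else y)"

definition one :: "('a::zero, 'm) planar_data_scheme \<Rightarrow> nat \<Rightarrow> sign \<Rightarrow> 'a" where
  "one A n s = act A s (map Cup [0..<n]) (\<lambda>_. 0)"

text \<open>The scalar represented by an element of a one-dimensional \<open>0\<close>-box space;
  \<open>one A 0 s\<close> is the value of the empty tangle.\<close>

definition scalar :: "('a::zero, 'm) planar_data_scheme \<Rightarrow> sign \<Rightarrow> 'a \<Rightarrow> complex" where
  "scalar A s x = (THE c. x = smul A c (one A 0 s))"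

definition tr :: "('a::zero, 'm) planar_data_scheme \<Rightarrow> nat \<Rightarrow> sign \<Rightarrow> 'a \<Rightarrow> complex" where
  "tr A n s x = scalar A s (act A s (Disc 0 n 0 # map Cap (rev [0..<n])) (\<lambda>_. x))"

text \<open>The closure of a \<open>1\<close>-box on its left; this encloses the region at its marked interval, so the outer
  region has the opposite sign.\<close>

definition left_tr1 :: "('a::zero, 'm) planar_data_scheme \<Rightarrow> sign \<Rightarrow> 'a \<Rightarrow> complex" where
  "left_tr1 A s x =
     scalar A (opp s) (act A (opp s) [Cup 0, Disc 0 1 1, Cap 0, Cap 0] (\<lambda>_. x))"

definition loop_value :: "('a::zero, 'm) planar_data_scheme \<Rightarrow> complex" where
  "loop_value A = scalar A Pos (act A Pos [Cup 0, Cap 0] (\<lambda>_. 0))"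

text \<open>Sphericality for the \<open>1\<close>-box spaces implies the invariance of all closed tangles under isotopies
  of the sphere. Positivity says that \<open>(x, y) \<mapsto> tr (y\<^sup>* x)\<close> is an inner product on every
  box space.\<close>

locale subfactor_planar_algebra = planar_star_algebra +
  assumes finite_dim: "\<exists>B. finite B \<and> box A n s \<subseteq> module.span (smul A) B"
    and dim_0: "vector_space.dim (smul A) (box A 0 s) = 1"
    and spherical: "x \<in> box A 1 s \<Longrightarrow> tr A 1 s x = left_tr1 A s x"
    and positive: "x \<in> box A n s \<Longrightarrow> x \<noteq> 0
      \<Longrightarrow> tr A n s (mult A n s (adj A n s x) x) \<in> \<real> \<and>
          Re (tr A n s (mult A n s (adj A n s x) x)) > 0"

locale irreducible_subfactor_planar_algebra = subfactor_planar_algebra +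
  assumes dim_1: "vector_space.dim (smul A) (box A 1 s) = 1"

definition delta :: "('a::zero, 'm) planar_data_scheme \<Rightarrow> real" where
  "delta A = Re (loop_value A)"

section \<open>Norms\<close>

definition is_projection :: "('a, 'm) planar_data_scheme \<Rightarrow> nat \<Rightarrow> sign \<Rightarrow> 'a \<Rightarrow> bool" where
  "is_projection A n s e \<longleftrightarrow> e \<in> box A n s \<and> adj A n s e = e \<and> mult A n s e e = e"

text \<open>Functional calculus for a self-adjoint element \<open>a\<close> of a finite-dimensional C*-algebra, by
  its spectral decomposition \<open>a = (\<Sum>t\<in>L. t e\<^sub>t)\<close>. Some of the projections
  may vanish; this does not affect the value.\<close>

definition spectral_decomp ::
  "('a::ab_group_add, 'm) planar_data_scheme \<Rightarrow> nat \<Rightarrow> sign \<Rightarrow> 'a \<Rightarrow> real set \<Rightarrow> (real \<Rightarrow> 'a) \<Rightarrow> bool" where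
  "spectral_decomp A n s a L e \<longleftrightarrow> finite L \<and> (\<forall>t\<in>L. is_projection A n s (e t)) \<and>
     (\<forall>t\<in>L. \<forall>u\<in>L. t \<noteq> u \<longrightarrow> mult A n s (e t) (e u) = 0) \<and>
     (\<Sum>t\<in>L. e t) = one A n s \<and> a = (\<Sum>t\<in>L. smul A (of_real t) (e t))"

definition func_calc ::
  "('a::ab_group_add, 'm) planar_data_scheme \<Rightarrow> nat \<Rightarrow> sign \<Rightarrow> (real \<Rightarrow> real) \<Rightarrow> 'a \<Rightarrow> 'a" where
  "func_calc A n s h a =
     (THE b. \<exists>L e. spectral_decomp A n s a L e \<and> b = (\<Sum>t\<in>L. smul A (of_real (h t)) (e t)))"

definition abs_val :: "('a::ab_group_add, 'm) planar_data_scheme \<Rightarrow> nat \<Rightarrow> sign \<Rightarrow> 'a \<Rightarrow> 'a" where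
  "abs_val A n s x = func_calc A n s sqrt (mult A n s (adj A n s x) x)"

text \<open>The operator norm is that of left multiplication on the Hilbert space given by the trace, where the
  algebra acts faithfully; so it is the C*-norm.\<close>

definition tr_norm :: "('a::ab_group_add, 'm) planar_data_scheme \<Rightarrow> nat \<Rightarrow> sign \<Rightarrow> 'a \<Rightarrow> real" where
  "tr_norm A n s y = sqrt (Re (tr A n s (mult A n s (adj A n s y) y)))"

definition op_norm :: "('a::ab_group_add, 'm) planar_data_scheme \<Rightarrow> nat \<Rightarrow> sign \<Rightarrow> 'a \<Rightarrow> real" where
  "op_norm A n s x = (SUP y\<in>{y \<in> box A n s. tr_norm A n s y \<le> 1}. tr_norm A n s (mult A n s x y))"

text \<open>\<open>pnorm A n s p x\<close> is meant for \<open>0 < p \<le> \<infinity>\<close>.\<close>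

definition pnorm ::
  "('a::ab_group_add, 'm) planar_data_scheme \<Rightarrow> nat \<Rightarrow> sign \<Rightarrow> ereal \<Rightarrow> 'a \<Rightarrow> real" where
  "pnorm A n s p x = (if p = \<infinity> then op_norm A n s x
     else (Re (tr A n s (func_calc A n s (\<lambda>t. t powr real_of_ereal p) (abs_val A n s x))))
            powr (1 / real_of_ereal p))"

section \<open>The string Fourier transform\<close>

text \<open>The clockwise one-click rotation: string \<open>j\<close> of \<open>x\<close> becomes boundary point \<open>j + 1\<close> modulo \<open>4\<close>,
  the last string passing over the disc to the right, below it, and up on the left.\<close>

definition fourier :: "('a, 'm) planar_data_scheme \<Rightarrow> sign \<Rightarrow> 'a \<Rightarrow> 'a" where
  "fourier A s x = act A (opp s) [Cup 0, Disc 0 2 1, Cap 4] (\<lambda>_. x)"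

text \<open>The supremum is taken in the extended reals, so no boundedness is presupposed.\<close>

definition fourier_const ::
  "('a::ab_group_add, 'm) planar_data_scheme \<Rightarrow> sign \<Rightarrow> ereal \<Rightarrow> ereal \<Rightarrow> ereal" where
  "fourier_const A s p q =
     (SUP x\<in>{x \<in> box A 2 s. pnorm A 2 s p x = 1}. ereal (pnorm A 2 (opp s) q (fourier A s x)))"

text \<open>In the extended reals \<open>2 / \<infinity> = 0\<close>, as required by the convention on exponents.\<close>

definition fourier_extremal ::
  "('a::ab_group_add, 'm) planar_data_scheme \<Rightarrow> sign \<Rightarrow> ereal \<Rightarrow> ereal \<Rightarrow> 'a \<Rightarrow> bool" where
  "fourier_extremal A s p q x \<longleftrightarrow>
     pnorm A 2 (opp s) q (fourier A s x) = delta A powr real_of_ereal (2 / q - 1) * pnorm A 2 s p x"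

definition multiple_of_trace_one_projection ::
  "('a::zero, 'm) planar_data_scheme \<Rightarrow> sign \<Rightarrow> 'a \<Rightarrow> bool" where
  "multiple_of_trace_one_projection A s x \<longleftrightarrow>
     (\<exists>c f. is_projection A 2 s f \<and> tr A 2 s f = 1 \<and> x = smul A c f)"

end

theory Submission
  imports Defs "HOL-Complex_Analysis.Complex_Analysis"
    "HOL-Computational_Algebra.Fundamental_Theorem_Algebra"
begin

text \<open>
  Write \<open>\<FF>\<close> for the string Fourier transform, \<open>\<tau>\<close> for the trace and \<open>\<parallel>x\<parallel>\<close> for the \<open>2\<close>-norm. All
  inequalities come from two diagrammatic facts. The first is Plancherel's theorem \<open>\<parallel>\<FF>(x)\<parallel> = \<parallel>x\<parallel>\<close>,
  which is sphericality (\<open>fourier_pairing\<close>). The second is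
  \<open>\<bar>\<tau>((c d)\<^sup>* \<FF>(a b))\<bar> \<le> \<parallel>a\<parallel> \<parallel>b\<parallel> \<parallel>c\<parallel> \<parallel>d\<parallel> / \<delta>\<close>, the Cauchy-Schwarz inequality for a closed diagram
  cut into two \<open>3\<close>-boxes; irreducibility evaluates the norms of the halves, because it makes
  \<open>1\<close>-boxes scalars (\<open>fourier_product_bound\<close>). Together with factorizations \<open>x = a b\<close> it gives
  \<open>\<parallel>\<FF>(x)\<parallel>\<^sub>\<infinity> \<le> \<parallel>x\<parallel>\<^sub>1 / \<delta>\<close>.

  A consequence is that every nonzero projection \<open>f\<close> of the \<open>2\<close>-box space has trace at least \<open>1\<close>
  (\<open>projection_norm_ge_one\<close>). Hence \<open>\<parallel>x\<parallel>\<^sub>r \<le> \<parallel>x\<parallel>\<^sub>p\<close> for \<open>p \<le> r\<close>, and equality for some \<open>p < r\<close> means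
  that \<open>x\<^sup>* x\<close> is a multiple of a projection of trace one (\<open>pnorm_antimono\<close>). So for given \<open>q\<close> it
  suffices to bound \<open>\<parallel>\<FF>(x)\<parallel>\<^sub>q\<close> for the largest admissible \<open>p\<close>. If \<open>q \<le> 2\<close>, this is \<open>p = 2\<close>, and
  Plancherel's theorem and the Hoelder inequality suffice. If \<open>q > 2\<close>, it is the dual exponent; the
  bound is the one above for \<open>q = \<infinity>\<close>, and otherwise the Hausdorff-Young inequality, which follows by
  interpolation with the three lines theorem.

  If equality holds for exponents in the interior of the region, then \<open>p\<close> can be enlarged, so
  \<open>x\<^sup>* x\<close> is a multiple of a projection \<open>f\<close> of trace one, and \<open>f\<close> is minimal. For such \<open>x\<close> the
  transform \<open>\<FF>(x)\<close> is a multiple of a unitary, since its operator norm and its \<open>2\<close>-norm attain the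
  extreme ratio. By polarization \<open>\<FF>(f)\<^sup>* \<FF>(z) = 0\<close> if \<open>z\<close> lies in the left ideal of \<open>f\<close> and is
  orthogonal to \<open>f\<close>; as \<open>\<FF>(f)\<close> is invertible, \<open>z = 0\<close>. So this ideal consists of the multiples of
  \<open>f\<close> (\<open>trace_one_left_ideal\<close>), and \<open>x\<close> is one of them. Conversely, for \<open>x = f\<close> all norms can be
  computed; the Jones projection is an example of such an \<open>f\<close>, so the constant is attained.

  Identities between diagrams are proved by exhibiting isotopies as lists of elementary moves, which
  are checked by evaluation. The spectral theorem and the \<open>p\<close>-norms are treated in a
  finite-dimensional \<open>*\<close>-algebra with faithful trace.
\<close>

section \<open>Shifting, reflecting and plugging drawings\<close>

lemma pos_move_to [simp]: "pos (move_to j l) = j"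
  and ins_move_to [simp]: "ins (move_to j l) = ins l"
  and outs_move_to [simp]: "outs (move_to j l) = outs l"
  and move_to_move_to [simp]: "move_to j (move_to k l) = move_to j l"
  and move_to_pos [simp]: "move_to (pos l) l = l"
  by (cases l; simp)+

lemma pos_shift [simp]: "pos (shift m l) = m + pos l"
  and ins_shift [simp]: "ins (shift m l) = ins l"
  and outs_shift [simp]: "outs (shift m l) = outs l"
  by (simp_all add: shift_def)

lemma shift_simps [simp]: "shift m (Cup i) = Cup (m + i)" "shift m (Cap i) = Cap (m + i)"
  "shift m (Disc k n i) = Disc k n (m + i)"
  by (simp_all add: shift_def)

lemma disc_names_simps [simp]: "disc_names [] = []" "disc_names (Cup i # T) = disc_names T"
  "disc_names (Cap i # T) = disc_names T" "disc_names (Disc k n i # T) = k # disc_names T"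
  "disc_names (S @ T) = disc_names S @ disc_names T"
  by (simp_all add: disc_names_def)

lemma set_disc_names: "k \<in> set (disc_names T) \<longleftrightarrow> (\<exists>n i. Disc k n i \<in> set T)"
proof (induction T)
  case (Cons l T) then show ?case by (cases l) auto
qed simp

lemma disc_names_cong_map: "(\<And>l. l \<in> set T \<Longrightarrow> \<exists>j. g l = move_to j l)
    \<Longrightarrow> disc_names (map g T) = disc_names T"
proof (induction T)
  case (Cons l T)
  then obtain j where "g l = move_to j l" by auto
  with Cons show ?case by (cases l) auto
qed simp

lemma disc_names_shift [simp]: "disc_names (map (shift m) T) = disc_names T"
  by (rule disc_names_cong_map) (auto simp: shift_def)

lemma disc_names_reflect [simp]: "disc_names (reflect N T) = disc_names T"
proof (induction T arbitrary: N)
  case (Cons l T) then show ?case by (cases l) auto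
qed simp

lemma disc_names_Caps [simp]: "disc_names (map Cap is) = []"
  by (induction "is") auto

lemma runs_append: "runs N (S @ T) M \<longleftrightarrow> (\<exists>K. runs N S K \<and> runs K T M)"
  by (induction S arbitrary: N) auto

lemma runs_shift: "runs N S M \<Longrightarrow> runs (a + N + b) (map (shift a) S) (a + M + b)"
proof (induction S arbitrary: N)
  case (Cons l S)
  then have 1: "pos l + ins l \<le> N" "runs (N - ins l + outs l) S M" by auto
  have "a + N + b - ins l + outs l = a + (N - ins l + outs l) + b" using 1(1) by simp
  with Cons.IH[OF 1(2)] 1(1) show ?case by simp
qed simp

lemma runs_reflect: "runs N T M \<Longrightarrow> runs N (reflect N T) M"
  by (induction T arbitrary: N) auto

lemma tangle_reflect: "tangle n T \<Longrightarrow> tangle n (reflect 0 T)"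
  by (simp add: tangle_def runs_reflect)

lemma plug_simps [simp]: "plug k S [] = []" "plug k S (Cup i # T) = Cup i # plug k S T"
  "plug k S (Cap i # T) = Cap i # plug k S T"
  "plug k S (Disc k' n i # T) = (if k' = k then map (shift i) S else [Disc k' n i]) @ plug k S T"
  by (simp_all add: plug_def)

lemma plug_append [simp]: "plug k S (T @ U) = plug k S T @ plug k S U"
  by (simp add: plug_def)

lemma plug_Caps [simp]: "plug k S (map Cap is) = map Cap is"
  by (induction "is") auto

lemma plug_fresh: "k \<notin> set (disc_names T) \<Longrightarrow> plug k S T = T"
proof (induction T)
  case (Cons l T) then show ?case by (cases l) auto
qed simp

lemma runs_plug:
  assumes "runs N T M" "runs 0 S (2 * n)" "\<And>n' i. n' \<noteq> n \<Longrightarrow> Disc k n' i \<notin> set T"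
  shows "runs N (plug k S T) M"
  using assms(1,3)
proof (induction T arbitrary: N)
  case (Cons l T)
  have runs: "pos l + ins l \<le> N" "runs (N - ins l + outs l) (plug k S T) M"
    using Cons by auto
  show ?case
  proof (cases "\<exists>n' i. l = Disc k n' i")
    case True
    then obtain i where l: "l = Disc k n i" using Cons.prems(2) by (metis list.set_intros(1))
    have i: "i \<le> N" using runs(1) l by simp
    have "runs (i + 0 + (N - i)) (map (shift i) S) (i + 2 * n + (N - i))"
      by (rule runs_shift) (rule assms)
    then have "runs N (map (shift i) S) (N + 2 * n)" using i by (simp add: algebra_simps)
    then show ?thesis using runs(2) l by (auto simp: runs_append)
  next
    case False
    then have "plug k S (l # T) = l # plug k S T" by (cases l) auto
    then show ?thesis using runs by simp
  qed
qed simp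

lemma disc_names_plug:
  assumes "distinct (disc_names T)" "distinct (disc_names S)"
    "set (disc_names S) \<inter> (set (disc_names T) - {k}) = {}"
  shows "distinct (disc_names (plug k S T)) \<and>
     set (disc_names (plug k S T)) \<subseteq> (set (disc_names T) - {k}) \<union> set (disc_names S)"
  using assms(1,3)
proof (induction T)
  case (Cons l T)
  show ?case
  proof (cases l)
    case (Disc k' n i)
    have d: "k' \<notin> set (disc_names T)" "distinct (disc_names T)" using Cons.prems(1) Disc by auto
    show ?thesis
    proof (cases "k' = k")
      case True
      then have "plug k S T = T" using d(1) by (intro plug_fresh) simp
      moreover have "set (disc_names S) \<inter> set (disc_names T) = {}"
          using Cons.prems(2) Disc True d(1) by auto
      ultimately show ?thesis using Disc True d assms(2) by auto
    next
      case False
      have k': "k' \<notin> set (disc_names S)" and "set (disc_names S) \<inter> (set (disc_names T) - {k}) = {}"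
        using Cons.prems(2) Disc False by auto
      from Cons.IH[OF d(2) this(2)] show ?thesis using k' d(1) Disc False by auto
    qed
  qed (use Cons in auto)
qed simp

lemma disc_unique: "distinct (disc_names T) \<Longrightarrow> Disc k n i \<in> set T \<Longrightarrow> Disc k n' i' \<in> set T \<Longrightarrow> n' = n
    \<and> i' = i"
proof (induction T)
  case (Cons l T)
  show ?case
  proof (cases "k \<in> set (disc_names T)")
    case True
    then have "l \<noteq> Disc k n i" "l \<noteq> Disc k n' i'" using Cons.prems(1) by auto
    moreover have "distinct (disc_names T)" using Cons.prems(1) by (cases l) auto
    ultimately show ?thesis using Cons.IH Cons.prems(2,3) by auto
  next
    case False
    then have "Disc k n i \<notin> set T" "Disc k n' i' \<notin> set T" unfolding set_disc_names by blast+
    then show ?thesis using Cons.prems(2,3) by auto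
  qed
qed simp

lemma tangle_plug:
  assumes "tangle m T" "Disc k n i \<in> set T" "tangle n S"
    "set (disc_names S) \<inter> (set (disc_names T) - {k}) = {}"
  shows "tangle m (plug k S T)"
proof -
  have "Disc k n' i' \<notin> set T" if "n' \<noteq> n" for n' i'
    using disc_unique[of T k n i n' i'] assms(1,2) that by (auto simp: tangle_def)
  then have "runs 0 (plug k S T) (2 * m)"
    using assms(1,3) by (intro runs_plug[of 0 T "2 * m" S n k]) (simp_all add: tangle_def)
  then show ?thesis using assms(1,3,4) disc_names_plug[of T S k] by (simp add: tangle_def)
qed

lemma sign_at_simps [simp]: "sign_at s 0 = s" "sign_at s (Suc 0)
    = opp s" "sign_at s (numeral (num.Bit0 w)) = s"
  "sign_at s (numeral (num.Bit1 w)) = opp s" "sign_at s (2 * i) = s" "opp (opp s) = s"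
  by (cases s; simp add: sign_at_def)+

lemma sign_at_add: "sign_at (sign_at s i) j = sign_at s (i + j)"
  by (cases s) (auto simp: sign_at_def)

section \<open>Isotopy certificates\<close>

text \<open>
  A certificate for an isotopy is a list of elementary events, each with the index of the layer at
  which it happens. \<open>ExR\<close> lowers the upper one of two neighbouring layers past a layer to its left,
  \<open>ExL\<close> past a layer to its right. Both directions are needed because an exchange at equal positions
  is ambiguous: a cap followed by a cup can be separated in two ways. An event that does not apply
  leaves the drawing unchanged.
\<close>

datatype event = ExR | ExL | Zig | Turn

fun event_here :: "event \<Rightarrow> layer list \<Rightarrow> layer list" where
  "event_here ExR (l # l' # T) =
     (if pos l + outs l \<le> pos l' then move_to (pos l' - outs l + ins l) l' # l # T else l # l' # T)"
| "event_here ExL (l' # l # T) =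
     (if pos l + ins l \<le> pos l' then l # move_to (pos l' - ins l + outs l) l' # T else l' # l # T)"
| "event_here Zig (Cup i # Cap j # T) = (if j = i + 1 \<or> i = j + 1 then T else Cup i # Cap j # T)"
| "event_here Turn (Disc k n i # T) =
     map Cup [i..<i + 2 * n] @ [Disc k n (i + 2 * n)] @ map Cap (rev [i + 2 * n..<i + 4 * n]) @ T"
| "event_here _ T = T"

fun event_at :: "nat \<Rightarrow> event \<Rightarrow> layer list \<Rightarrow> layer list" where
  "event_at j e T = take j T @ event_here e (drop j T)"

fun perform :: "nat \<Rightarrow> (nat \<times> event) list \<Rightarrow> layer list \<Rightarrow> layer list option" where
  "perform n [] T = Some T"
| "perform n ((j, e) # es) T =
     (let T' = event_at j e T in if tangle n T' then perform n es T' else None)"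

lemma event_here_local_move:
  "event_here e T = T \<or> (\<exists>M M' V. T = M @ V \<and> event_here e T = M' @ V
      \<and> (local_move M M' \<or> local_move M' M))"
proof (cases "(e, T)" rule: event_here.cases)
  case (1 l l' T')
  show ?thesis
  proof (cases "pos l + outs l \<le> pos l'")
    case True
    let ?l = "move_to (pos l' - (pos l + outs l)) l'"
    have "local_move [l, shift (pos l + outs l) ?l] [shift (pos l + ins l) ?l, l]" by (rule exchange)
    moreover have "shift (pos l + outs l) ?l = l'" using True by (simp add: shift_def)
    moreover have "shift (pos l + ins l) ?l = move_to (pos l' - outs l + ins l) l'"
      using True by (simp add: shift_def) (metis add_diff_cancel_right diff_add_inverse2
          diff_diff_add le_add_diff_inverse2 add.commute add.assoc)
    ultimately have "local_move [l, l'] [move_to (pos l' - outs l + ins l) l', l]" by simp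
    moreover have "T = [l, l'] @ T'" "event_here e T = [move_to (pos l' - outs l + ins l) l', l] @ T'"
      using 1 True by auto
    ultimately show ?thesis by blast
  qed (use 1 in auto)
next
  case (2 l' l T')
  show ?thesis
  proof (cases "pos l + ins l \<le> pos l'")
    case True
    let ?l = "move_to (pos l' - (pos l + ins l)) l'"
    have "local_move [l, shift (pos l + outs l) ?l] [shift (pos l + ins l) ?l, l]" by (rule exchange)
    moreover have "shift (pos l + ins l) ?l = l'" using True by (simp add: shift_def)
    moreover have "pos l + outs l + (pos l' - (pos l + ins l)) = pos l' - ins l + outs l" using True
        by simp
    then have "shift (pos l + outs l) ?l = move_to (pos l' - ins l + outs l) l'"
      by (simp only: shift_def pos_move_to move_to_move_to)
    ultimately have "local_move [l, move_to (pos l' - ins l + outs l) l'] [l', l]" by simp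
    moreover have "T = [l', l] @ T'" "event_here e T = [l, move_to (pos l' - ins l + outs l) l'] @ T'"
      using 2 True by auto
    ultimately show ?thesis by blast
  qed (use 2 in auto)
next
  case (3 i j T')
  have "event_here e T = T \<or> (local_move [Cup i, Cap j] [] \<and> event_here e T = T')"
    using 3 zigzag_right zigzag_left by auto
  moreover have "T = [Cup i, Cap j] @ T'" using 3 by simp
  ultimately show ?thesis by (metis append_Nil)
next
  case (4 k n i T')
  then show ?thesis using full_turn[of k n i]
      by (metis append.assoc append_Cons append_Nil event_here.simps(4) prod.inject)
qed auto

text \<open>
  Whether the new drawing is again a tangle is tested during the evaluation, so no event has to be
  shown to preserve tangles in general.
\<close>

lemma isotopic_event_at:
  assumes "tangle n T" "tangle n (event_at j e T)"
  shows "isotopic n T (event_at j e T)"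
proof (cases "event_here e (drop j T) = drop j T")
  case True
  then show ?thesis using assms by (simp add: isotopic.refl)
next
  case False
  then obtain M M' V where *: "drop j T = M @ V" "event_here e (drop j T) = M' @ V"
    "local_move M M' \<or> local_move M' M"
    using event_here_local_move[of e "drop j T"] by blast
  then have T: "T = take j T @ M @ V" and E: "event_at j e T = take j T @ M' @ V"
    by (metis append_take_drop_id, simp)
  show ?thesis using *(3)
    by (metis T E assms isotopic.move isotopic.sym)
qed

lemma perform_isotopic: "perform n es T = Some T' \<Longrightarrow> tangle n T \<Longrightarrow> isotopic n T T'"
proof (induction n es T rule: perform.induct)
  case (2 n j e es T)
  then show ?case
    by (auto simp: Let_def simp del: event_at.simps split: if_splits intro: isotopic.trans
        isotopic_event_at)
qed (simp add: isotopic.refl)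

text \<open>
  Running certificates from both ends to a common drawing makes it unnecessary to have events that
  create zigzags or undo full turns: these are the events \<open>Zig\<close> and \<open>Turn\<close> at the other end.
\<close>

definition same_after :: "nat \<Rightarrow> (nat \<times> event) list \<Rightarrow> (nat \<times> event) list \<Rightarrow> layer list \<Rightarrow> layer list \<Rightarrow>
    bool" where
  "same_after n es es' T T' \<longleftrightarrow> tangle n T \<and> tangle n T' \<and> perform n es T \<noteq> None
      \<and> perform n es T = perform n es' T'"

lemma isotopic_same_after: "same_after n es es' T T' \<Longrightarrow> isotopic n T T'"
  unfolding same_after_def using perform_isotopic isotopic.sym isotopic.trans by (metis not_None_eq)

section \<open>Values of labelled tangles\<close>

lemma in_plug:
  "Disc k' n' i' \<in> set (plug k S T) \<Longrightarrow> (k' \<noteq> k \<and> Disc k' n' i' \<in> set T) \<or>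
     (\<exists>n i j. Disc k n i \<in> set T \<and> Disc k' n' j \<in> set S \<and> i' = i + j)"
proof (induction T)
  case (Cons l T)
  have *: "Disc k' n' i' \<in> shift m ` set S \<Longrightarrow> \<exists>j. Disc k' n' j \<in> set S \<and> i' = m + j" for m
  proof -
    assume "Disc k' n' i' \<in> shift m ` set S"
    then obtain l' where "l' \<in> set S" "Disc k' n' i' = shift m l'" by auto
    then show ?thesis by (intro exI[of _ "pos l'"]) (cases l'; simp)
  qed
  show ?case
  proof (cases l)
    case (Disc k2 n2 i2)
    show ?thesis
    proof (cases "Disc k' n' i' \<in> set (plug k S T)")
      case True
      then show ?thesis using Cons.IH by auto
    next
      case False
      then have "if k2 = k then Disc k' n' i' \<in> shift i2 ` set S else Disc k' n' i' = Disc k2 n2 i2"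
        using Cons.prems Disc by (auto split: if_splits)
      then show ?thesis using Disc *[of i2] by (auto split: if_splits)
    qed
  qed (use Cons in auto)
qed simp

lemma in_plug_other: "k' \<noteq> k \<Longrightarrow> Disc k' n' i' \<in> set T \<Longrightarrow> Disc k' n' i' \<in> set (plug k S T)"
proof (induction T)
  case (Cons l T) then show ?case by (cases l) auto
qed simp

lemma runs_caps: "runs (N + 2 * n + r) (map Cap (rev [N..<N + n])) (N + r)"
proof (induction n arbitrary: r)
  case (Suc n) then show ?case using Suc[of r] by simp
qed simp

lemma runs_cups: "runs (2 * m) (map Cup [m..<m + n]) (2 * (m + n))"
proof (induction n)
  case (Suc n) then show ?case by (auto simp: runs_append)
qed simp

lemma disc_names_Cups [simp]: "disc_names (map Cup is) = []"
  by (induction "is") auto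

lemma tangle_cups: "tangle n (map Cup [0..<n])"
  using runs_cups[of 0 n] by (simp add: tangle_def)

lemma labelling_cups [simp]: "labelling A s (map Cup is) f"
  by (auto simp: labelling_def)

context planar_algebra
begin

sublocale V: vector_space "smul A"
  by (rule vector_space)

text \<open>
  Every identity between planar expressions is proved in the same way: both sides are written as the
  value of one tangle on one labelling (lemmas \<open>rep_mult\<close>, \<open>rep_one\<close>, \<open>rep_fourier\<close>, \<open>rep_adj\<close> and
  \<open>rep_plug\<close>), and the two tangles are isotopic. The labelling is kept fixed throughout, so that
  composing expressions only concatenates drawings.
\<close>

definition rep :: "sign \<Rightarrow> nat \<Rightarrow> layer list \<Rightarrow> (nat \<Rightarrow> 'a) \<Rightarrow> 'a \<Rightarrow> bool" where
  "rep s n T f x \<longleftrightarrow> tangle n T \<and> labelling A s T f \<and> x = act A s T f"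

lemma rep_box: "rep s n T f x \<Longrightarrow> x \<in> box A n s"
  unfolding rep_def using act_closed by blast

lemma rep_cong:
  assumes "rep s n T f x" "\<And>k. k \<in> set (disc_names T) \<Longrightarrow> f k = g k"
  shows "rep s n T g x"
  using assms act_cong[of n T s f g] unfolding rep_def labelling_def by (metis set_disc_names)

lemma rep_disc: "x \<in> box A n s \<Longrightarrow> f k = x \<Longrightarrow> rep s n [Disc k n 0] f x"
  by (rule rep_cong[of _ _ _ "\<lambda>_. x"]) (auto simp: rep_def tangle_def labelling_def act_id)

lemma rep_isotopic: "rep s n T f x \<Longrightarrow> rep s n T' f y \<Longrightarrow> isotopic n T T' \<Longrightarrow> x = y"
  unfolding rep_def using act_isotopic by blast

lemma labelling_plug:
  assumes "labelling A s T (f(k := y))" "labelling A (sign_at s i) S f"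
    "tangle m T" "Disc k n i \<in> set T"
  shows "labelling A s (plug k S T) f"
  unfolding labelling_def
proof (intro allI impI)
  fix k' n' i'
  assume "Disc k' n' i' \<in> set (plug k S T)"
  then consider "k' \<noteq> k" "Disc k' n' i' \<in> set T"
    | n0 i0 j where "Disc k n0 i0 \<in> set T" "Disc k' n' j \<in> set S" "i' = i0 + j"
    using in_plug by blast
  then show "f k' \<in> box A n' (sign_at s i')"
  proof cases
    case 1
    then show ?thesis using assms(1) unfolding labelling_def by force
  next
    case 2
    then have "i0 = i" using disc_unique assms(3,4) unfolding tangle_def by blast
    then show ?thesis using 2 assms(2) unfolding labelling_def by (simp add: sign_at_add)
  qed
qed

lemma rep_plug:
  assumes "rep s m T (f(k := y)) z" "Disc k n i \<in> set T" "rep (sign_at s i) n S f y"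
    "set (disc_names S) \<inter> (set (disc_names T) - {k}) = {}"
  shows "rep s m (plug k S T) f z"
  using assms act_plug[of m T k n i S s f] tangle_plug[of m T k n i S] labelling_plug[of s T f k y i
      S m n]
  unfolding rep_def by simp

lemma rep_unary:
  assumes "rep s m U (\<lambda>_. y) z" "Disc 0 n i \<in> set U" "disc_names U = [0]" "rep (sign_at s i) n S f y"
  shows "rep s m (plug 0 S U) f z"
proof (rule rep_plug[OF _ assms(2,4)])
  show "rep s m U (f(0 := y)) z" using assms(1,3) by (auto intro: rep_cong)
qed (use assms(3) in auto)

lemma rep_rename:
  assumes "rep s m T f z" "Disc k n i \<in> set T" "f k = f k'" "k' \<notin> set (disc_names T)"
  shows "rep s m (plug k [Disc k' n 0] T) f z"
proof (rule rep_plug[OF _ assms(2)])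
  show "rep s m T (f(k := f k')) z" using assms(1,3) by (metis fun_upd_triv)
  have "f k' \<in> box A n (sign_at s i)" using assms(1,2)
      by (auto simp: rep_def labelling_def assms(3)[symmetric])
  then show "rep (sign_at s i) n [Disc k' n 0] f (f k')" by (simp add: rep_disc)
qed (use assms(4) in auto)

text \<open>
  The multiplication tangle calls its discs \<open>0\<close> and \<open>1\<close>, and the two tangles to be multiplied may
  use these names as well. The discs are therefore renamed to fresh names first.
\<close>

lemma rep_mult:
  assumes S: "rep s n S f x" and T: "rep s n T f y"
    and disj: "set (disc_names S) \<inter> set (disc_names T) = {}"
  shows "rep s n (S @ map (shift (2 * n)) T @ map Cap (rev [n..<2 * n])) f (mult A n s x y)"
proof -
  define M where "M i j = [Disc i n 0, Disc j n (2 * n)] @ map Cap (rev [n..<2 * n])" for i j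
  have tangle: "tangle n (M i j)" if "i \<noteq> j" for i j
    using that runs_caps[of n n n] by (simp add: tangle_def M_def runs_append mult_2 add.assoc del:
        rev_map)
  have "\<exists>a. a \<notin> set (disc_names S) \<union> set (disc_names T) \<union> {0, 1}"
    by (rule ex_new_if_finite) simp_all
  then obtain a where a: "a \<notin> set (disc_names S) \<union> set (disc_names T) \<union> {0, 1}" ..
  have "\<exists>b. b \<notin> set (disc_names S) \<union> set (disc_names T) \<union> {0, 1, a}"
    by (rule ex_new_if_finite) simp_all
  then obtain b where b: "b \<notin> set (disc_names S) \<union> set (disc_names T) \<union> {0, 1, a}" ..
  define g where "g = f(0 := x, 1 := y, a := x, b := y)"
  have names: "disc_names (M i j) = [i, j]" for i j by (simp add: M_def del: rev_map)
  have discs: "Disc i n 0 \<in> set (M i j)" "Disc j n (2 * n) \<in> set (M i j)" for i j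
    by (simp_all add: M_def)
  have g: "g 0 = x" "g 1 = y" "g a = x" "g b = y" using a b by (simp_all add: g_def)
  have "rep s n (M 0 1) (\<lambda>k. if k = 0 then x else y) (mult A n s x y)"
    using tangle rep_box[OF S] rep_box[OF T] by (auto simp: rep_def mult_def M_def labelling_def)
  then have "rep s n (M 0 1) g (mult A n s x y)"
    by (rule rep_cong) (use g in \<open>auto simp: names\<close>)
  then have "rep s n (plug 0 [Disc a n 0] (M 0 1)) g (mult A n s x y)"
    using a g by (intro rep_rename[OF _ discs(1)]) (auto simp: names)
  moreover have "plug 0 [Disc a n 0] (M 0 1) = M a 1" by (simp add: M_def del: rev_map)
  ultimately have "rep s n (M a 1) g (mult A n s x y)" by simp
  then have "rep s n (plug 1 [Disc b n 0] (M a 1)) g (mult A n s x y)"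
    using a b g by (intro rep_rename[OF _ discs(2)]) (auto simp: names)
  moreover have "plug 1 [Disc b n 0] (M a 1) = M a b" using a by (simp add: M_def del: rev_map)
  ultimately have "rep s n (M a b) g (mult A n s x y)" by simp
  then have "rep s n (M a b) (f(a := x, b := y)) (mult A n s x y)"
    by (rule rep_cong) (use a b in \<open>auto simp: names g_def\<close>)
  moreover have "rep (sign_at s (2 * n)) n T (f(a := x)) y"
    using T by (auto intro!: rep_cong[OF T] simp: sign_at_def) (use a in auto)
  ultimately have "rep s n (plug b T (M a b)) (f(a := x)) (mult A n s x y)"
    using a b by (intro rep_plug[OF _ discs(2)]) (auto simp: names)
  moreover have plug: "plug b T (M a b) = Disc a n 0 # map (shift (2 * n)) T @ map Cap (rev [n..<2 *
      n])"
    using b by (simp add: M_def del: rev_map)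
  ultimately have "rep s n (plug a S (plug b T (M a b))) f (mult A n s x y)"
    using disj S by (intro rep_plug[of s n "plug b T (M a b)" f a x _ n 0]) (auto simp del: rev_map)
  moreover have "plug a S (map (shift (2 * n)) T) = map (shift (2 * n)) T"
    using a by (intro plug_fresh) auto
  moreover have "map (shift 0) S = S" by (intro map_idI) (simp add: shift_def)
  ultimately show ?thesis by (simp add: plug del: rev_map)
qed

lemma rep_one: "rep s n (map Cup [0..<n]) f (one A n s)"
proof -
  have "rep s n (map Cup [0..<n]) (\<lambda>_. 0) (one A n s)" by (simp add: rep_def one_def tangle_cups)
  then show ?thesis by (rule rep_cong) simp
qed

lemma rep_fourier:
  assumes "rep s 2 S f x"
  shows "rep (opp s) 2 (Cup 0 # map (shift 1) S @ [Cap 4]) f (fourier A s x)"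
proof -
  have "rep (opp s) 2 [Cup 0, Disc 0 2 1, Cap 4] (\<lambda>_. x) (fourier A s x)"
    using rep_box[OF assms] by (simp add: rep_def fourier_def tangle_def labelling_def)
  then have "rep (opp s) 2 (plug 0 S [Cup 0, Disc 0 2 1, Cap 4]) f (fourier A s x)"
    by (rule rep_unary) (use assms in auto)
  then show ?thesis by simp
qed

text \<open>
  A disc labelled by a multiple of the identity may be replaced by parallel strings, at the cost of
  a scalar. This is how closed loops are evaluated (\<open>n = 0\<close>) and how irreducibility enters the
  diagrams (\<open>n = 1\<close>).
\<close>

lemma rep_one_multiple:
  assumes "rep s m (plug k (map Cup [0..<n]) T) f z" "tangle m T" "Disc k n i \<in> set T"
    "k \<notin> set (disc_names (plug k (map Cup [0..<n]) T))"
  shows "rep s m T (f(k := smul A c (one A n (sign_at s i)))) (smul A c z)"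
proof -
  let ?u = "one A n (sign_at s i)"
  have u: "rep (sign_at s i) n (map Cup [0..<n]) f ?u" by (rule rep_one)
  have box: "smul A c ?u \<in> box A n (sign_at s i)" for c
    using rep_box[OF u] subspace_box by (rule V.subspace_scale[rotated])
  have T: "labelling A s T (f(k := smul A c ?u))" for c
    unfolding labelling_def
  proof (intro allI impI)
    fix k' n' i' assume d: "Disc k' n' i' \<in> set T"
    show "(f(k := smul A c ?u)) k' \<in> box A n' (sign_at s i')"
    proof (cases "k' = k")
      case True
      then show ?thesis using d assms(2,3) disc_unique[of T k n i n' i'] box by (simp add: tangle_def)
    next
      case False
      then have "Disc k' n' i' \<in> set (plug k (map Cup [0..<n]) T)"
        using d by (rule in_plug_other)
      then show ?thesis using assms(1) False by (simp add: rep_def labelling_def)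
    qed
  qed
  have "z = act A s T (f(k := act A (sign_at s i) (map Cup [0..<n]) f))"
    using assms(1) act_plug[OF assms(2,3) tangle_cups] by (simp add: rep_def)
  then have z: "z = act A s T (f(k := ?u))" using u by (simp add: rep_def)
  have one: "smul A 1 ?u = ?u" by simp
  have "act A s T ((f(k := ?u))(k := smul A c ?u)) = smul A c (act A s T ((f(k := ?u))(k := ?u)))"
    using act_smul[OF assms(2) _ assms(3)] T[of 1] box[of 1] by (simp only: one)
  then show ?thesis using z T assms(2) by (simp add: rep_def)
qed

end

context planar_star_algebra
begin

text \<open>
  Reflection in a vertical line replaces \<open>i\<close> strings on the left of a disc by \<open>N - i\<close> strings. As
  \<open>N\<close> is even at every height, the sign of the disc does not change.
\<close>

lemma labelling_reflect:
  assumes "labelling A s T f" "\<And>k n i. Disc k n i \<in> set T \<Longrightarrow> g k = adj A n (sign_at s i) (f k)"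
    "runs N T M" "even N"
  shows "labelling A s (reflect N T) g"
  using assms
proof (induction T arbitrary: N)
  case (Cons l T)
  have IH: "labelling A s (reflect (N - ins l + outs l) T) g"
  proof (rule Cons.IH)
    show "even (N - ins l + outs l)" using Cons.prems(3,4) by (cases l) auto
    show "labelling A s T f" using Cons.prems(1) by (simp add: labelling_def)
    show "runs (N - ins l + outs l) T M" using Cons.prems(3) by (simp only: runs.simps)
    show "g k = adj A n (sign_at s i) (f k)" if "Disc k n i \<in> set T" for k n i
      by (rule Cons.prems(2)) (simp add: that)
  qed
  show ?case
  proof (cases l)
    case (Disc k n i)
    have "f k \<in> box A n (sign_at s i)" using Cons.prems(1) Disc by (simp add: labelling_def)
    moreover have "g k = adj A n (sign_at s i) (f k)" by (rule Cons.prems(2)) (simp add: Disc)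
    moreover have "sign_at s (N - i) = sign_at s i" using Cons.prems(3,4) Disc
        by (simp add: sign_at_def)
    ultimately have "g k \<in> box A n (sign_at s (N - i))" using adj_closed by simp
    then show ?thesis using IH Disc by (simp add: labelling_def)
  qed (use IH in \<open>simp_all add: labelling_def\<close>)
qed (simp add: labelling_def)

lemma rep_adj:
  assumes "rep s n T f x" "\<And>k n i. Disc k n i \<in> set T \<Longrightarrow> g k = adj A n (sign_at s i) (f k)"
  shows "rep s n (reflect 0 T) g (adj A n s x)"
proof -
  have T: "tangle n T" "labelling A s T f" "x = act A s T f" using assms(1) by (simp_all add: rep_def)
  have "labelling A s (reflect 0 T) g"
    by (rule labelling_reflect[OF T(2) assms(2), of 0 "2 * n"]) (use T(1) in \<open>simp_all add: tangle_def\<close>)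
  moreover have "act A s (reflect 0 T) g = adj A n s (act A s T f)"
    by (rule act_adj[OF T(1,2) assms(2)])
  ultimately show ?thesis using T by (simp add: rep_def tangle_reflect)
qed

end

section \<open>The isotopies\<close>

text \<open>
  The drawings below are those that the composition of values produces; each lemma is an isotopy of
  plane diagrams that is evident from a picture.
\<close>

lemma isotopic_mult_assoc:
  "isotopic 2
     [Disc 0 2 0, Disc 1 2 4, Cap 3, Cap 2, Disc 2 2 4, Cap 3, Cap 2]
     [Disc 0 2 0, Disc 1 2 4, Disc 2 2 8, Cap 7, Cap 6, Cap 3, Cap 2]"
  by (rule isotopic_same_after[where es = "[(3, ExR), (4, ExR), (5, ExR)]"
      and es' = "[(4, ExL), (3, ExL), (2, ExL)]"]) code_simp

lemma isotopic_one_mult: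
  "isotopic 2
     [Cup 0, Cup 1, Disc 0 2 4, Cap 3, Cap 2]
     [Disc 0 2 0]"
  by (rule isotopic_same_after[where es = "[(1, ExR), (2, ExR), (3, Zig), (0, ExR), (1, Zig)]"
      and es' = "[]"]) code_simp

lemma isotopic_mult_one:
  "isotopic 2
     [Disc 0 2 0, Cup 4, Cup 5, Cap 3, Cap 2]
     [Disc 0 2 0]"
  by (rule isotopic_same_after[where es = "[(2, ExL), (1, Zig), (1, Zig)]"
      and es' = "[]"]) code_simp

lemma isotopic_reflect_mult2:
  "isotopic 2
     [Disc 0 2 0, Disc 1 2 0, Cap 3, Cap 2]
     [Disc 1 2 0, Disc 0 2 4, Cap 3, Cap 2]"
  by (rule isotopic_same_after[where es = "[(0, ExL)]"
      and es' = "[]"]) code_simp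

lemma isotopic_reflect_mult3:
  "isotopic 3
     [Disc 0 3 0, Disc 1 3 0, Cap 5, Cap 4, Cap 3]
     [Disc 1 3 0, Disc 0 3 6, Cap 5, Cap 4, Cap 3]"
  by (rule isotopic_same_after[where es = "[(0, ExL)]"
      and es' = "[]"]) code_simp

text \<open>
  In the trace of a product two discs are joined by a band of four strings. Moving one of them along
  the band to the other side makes it turn once about itself.
\<close>

lemma isotopic_trace_comm:
  "isotopic 0
     [Disc 0 2 0, Disc 1 2 4, Cap 3, Cap 2, Cap 1, Cap 0]
     [Disc 1 2 0, Disc 0 2 4, Cap 3, Cap 2, Cap 1, Cap 0]"
  by (rule isotopic_same_after[where es = "[(0, ExR)]"
      and es' = "[(1, Turn), (9, ExL), (8, ExL), (7, ExL), (6, ExL), (5, ExL), (4, ExL), (3, ExL), (2,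
        ExL), (1, Zig), (8, ExL), (7, ExL), (6, ExL), (5, ExL), (4, ExL), (3, ExL), (2, ExL), (1,
        Zig), (7, ExL), (6, ExL), (5, ExL), (4, ExL), (3, ExL), (2, ExL), (1, Zig), (6, ExL), (5,
        ExL), (4, ExL), (3, ExL), (2, ExL), (1, Zig)]"]) code_simp

lemma isotopic_jones_square:
  "isotopic 2
     [Cup 0, Cup 2, Cup 4, Cup 6, Cap 3, Cap 2]
     [Cup 0, Cup 2, Cup 4, Cap 4]"
  by (rule isotopic_same_after[where es = "[(2, ExR), (3, Zig), (2, ExL), (2, ExL)]"
      and es' = "[(1, ExR)]"]) code_simp

lemma isotopic_trace_jones:
  "isotopic 0
     [Cup 0, Cup 2, Cap 1, Cap 0]
     [Cup 0, Cap 0]"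
  by (rule isotopic_same_after[where es = "[(1, Zig)]"
      and es' = "[]"]) code_simp

lemma isotopic_left_loop:
  "isotopic 0
     [Cup 0, Cup 1, Cap 0, Cap 0]
     [Cup 0, Cap 0]"
  by (rule isotopic_same_after[where es = "[(1, Zig)]"
      and es' = "[]"]) code_simp

text \<open>
  Of the four strings that join the two rotated discs, three are nested above the discs as they are
  without the rotation, and the fourth passes below both discs. This is the left closure of the
  \<open>1\<close>-box formed by the first three.
\<close>

lemma isotopic_left_closure:
  "isotopic 0
     [Cup 0, Disc 0 2 1, Disc 1 2 5, Cap 4, Cap 3, Cap 2, Cap 0, Cap 0]
     [Cup 0, Disc 0 2 1, Cap 0, Cup 4, Disc 1 2 5, Cap 8, Cap 3, Cap 2, Cap 1, Cap 0]"
  by (rule isotopic_same_after[where es = "[(5, ExL), (4, ExL), (3, ExL), (2, ExL)]"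
      and es' = "[(5, ExL), (4, ExL), (3, Zig), (4, ExL), (5, ExL), (6, ExL)]"]) code_simp

text \<open>
  The pairing of \<open>\<FF>(a b)\<close> with \<open>c d\<close>, where the discs \<open>0, 1, 2, 3\<close> carry \<open>a, b, c\<^sup>*, d\<^sup>*\<close>, is cut in
  two: six strings join the pair \<open>b, c\<^sup>*\<close> to the pair \<open>a, d\<^sup>*\<close>, and one string joins the two discs
  within each pair. Rotating \<open>a\<close> by half a turn brings its strings into the order of the cut.
\<close>

lemma isotopic_pairing:
  "isotopic 0
     [Disc 3 2 0, Disc 2 2 4, Cap 3, Cap 2, Cup 4, Disc 0 2 5, Disc 1 2 9, Cap 8, Cap 7, Cap 8,
     Cap 3, Cap 2, Cap 1, Cap 0]
     [Disc 3 2 0, Cup 1, Cup 2, Disc 0 2 3, Cap 6, Cap 5, Cap 4, Disc 2 2 6, Disc 1 2 9, Cap 12,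
     Cap 5, Cap 4, Cap 3, Cap 2, Cap 1, Cap 0]"
  by (rule isotopic_same_after[where es = "[(5, Turn), (17, ExL), (16, ExL), (15, ExL), (14, ExL),
      (13, ExL), (12, ExL), (11, ExL),
        (10, ExL), (9, ExL), (8, ExL), (7, ExL), (6, ExL), (5, ExL), (4, Zig), (16, ExL), (15,
        ExL), (14, ExL), (13, ExL), (12, ExL), (11, ExL), (10, ExL), (9, ExL), (8, ExL), (7,
        ExL), (6, ExL), (5, ExL), (4, Zig), (15, ExL), (14, ExL), (13, ExL), (12, ExL), (11,
        ExL), (10, ExL), (9, ExL), (8, ExL), (7, ExL), (6, ExL), (5, ExL), (4, Zig), (3, ExL),
        (2, ExL), (4, ExL), (5, ExL), (6, ExL), (7, ExL), (8, ExL), (10, ExR), (9, ExR), (13,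
        ExR), (12, ExR), (11, ExR), (10, ExR)]"
      and es' = "[(6, ExR), (5, ExR), (4, ExR), (3, ExR), (2, ExR), (1, ExR), (9, ExL), (8, ExL), (7,
        ExR), (6, ExR), (5, ExR), (4, ExR), (3, ExR)]"]) code_simp

text \<open>
  The norm of the half that contains \<open>b\<close> and \<open>c\<^sup>*\<close>: three strings join \<open>b\<close> (disc \<open>1\<close>) to its
  reflection (disc \<open>5\<close>), so these two discs form a \<open>1\<close>-box, which is inserted into the trace of the
  other two discs.
\<close>

lemma isotopic_norm_upper:
  "isotopic 0
     [Disc 4 2 0, Disc 5 2 1, Cap 0, Disc 2 2 6, Disc 1 2 9, Cap 12, Cap 5, Cap 4, Cap 3, Cap 2,
     Cap 1, Cap 0]
     [Disc 4 2 0, Disc 2 2 4, Cap 3, Cap 2, Cap 1, Disc 5 2 1, Disc 1 2 5, Cap 4, Cap 3, Cap 2,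
     Cap 0, Cap 0]"
  by (rule isotopic_same_after[where es = "[(2, ExR), (1, ExR), (3, ExR), (5, ExL), (4, ExR), (3,
      ExL), (2, ExR), (6, ExL), (5,
        ExR), (4, ExL), (3, ExR)]"
      and es' = "[(4, ExL), (5, ExR), (9, ExL), (8, ExL), (7, ExL), (6, ExL), (10, ExR), (9, ExR), (8,
        ExR), (7, ExR)]"]) code_simp

text \<open>
  The same for the half that contains the rotated \<open>a\<close> (disc \<open>0\<close>) and \<open>d\<^sup>*\<close> (disc \<open>3\<close>). Here the
  reflection of \<open>a\<close> has to pass to the other side of \<open>a\<close>, which costs a full turn.
\<close>

lemma isotopic_norm_lower:
  "isotopic 0
     [Disc 3 2 0, Disc 0 2 1, Cap 4, Disc 4 2 6, Disc 5 2 9, Cap 8, Cap 5, Cap 4, Cap 3, Cap 2,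
     Cap 1, Cap 0]
     [Disc 3 2 0, Disc 4 2 4, Cap 3, Cap 2, Disc 5 2 1, Disc 0 2 5, Cap 4, Cap 3, Cap 2, Cap 2,
     Cap 1, Cap 0]"
  by (rule isotopic_same_after[where es = "[(4, Turn), (12, ExL), (11, ExL), (10, ExL), (9, ExL),
      (8, ExL), (7, ExL), (6, ExL), (5,
        ExL), (4, Zig), (11, ExL), (10, ExL), (9, ExL), (8, ExL), (7, ExL), (6, ExL), (5, ExL),
        (4, ExL), (12, ExL), (11, ExL), (10, ExL), (9, ExL), (8, ExL), (7, ExL), (6, ExL), (5,
        ExL), (13, ExL), (12, ExL), (11, ExL), (10, ExL), (9, ExL), (8, ExL), (7, ExL), (6, Zig),
        (12, ExL), (11, ExL), (10, ExL), (9, ExL), (8, ExL), (7, ExL), (6, Zig), (11, ExL), (10,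
        ExL), (9, ExL), (8, ExL), (7, ExL), (6, Zig), (2, ExR), (1, ExR), (3, ExR), (2, ExR), (4,
        ExR), (3, ExR)]"
      and es' = "[(4, ExR), (8, ExR), (7, ExR), (6, ExR), (5, ExR)]"]) code_simp

lemma isotopic_one_mult1:
  "isotopic 1
     [Cup 0, Disc 0 1 2, Cap 1]
     [Disc 0 1 0]"
  by (rule isotopic_same_after[where es = "[(0, ExR), (1, Zig)]"
      and es' = "[]"]) code_simp

lemma isotopic_reflect_jones:
  "isotopic 2
     [Cup 0, Cup 0]
     [Cup 0, Cup 2]"
  by (rule isotopic_same_after[where es = "[(0, ExL)]"
      and es' = "[]"]) code_simp

lemma isotopic_norm_upper_rest:
  "isotopic 0
     [Disc 4 2 0, Disc 2 2 4, Cap 3, Cap 2, Cap 1, Cup 1, Cap 0, Cap 0]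
     [Disc 4 2 0, Disc 2 2 4, Cap 3, Cap 2, Cap 1, Cap 0]"
  by (rule isotopic_same_after[where es = "[(5, Zig)]"
      and es' = "[]"]) code_simp

lemma isotopic_norm_lower_rest:
  "isotopic 0
     [Disc 3 2 0, Disc 4 2 4, Cap 3, Cap 2, Cup 1, Cap 2, Cap 1, Cap 0]
     [Disc 3 2 0, Disc 4 2 4, Cap 3, Cap 2, Cap 1, Cap 0]"
  by (rule isotopic_same_after[where es = "[(4, Zig)]"
      and es' = "[]"]) code_simp

section \<open>The algebra structure of the box spaces\<close>

context planar_algebra
begin

lemma rep_unique: "rep s n T f x \<Longrightarrow> rep s n T f y \<Longrightarrow> x = y"
  by (simp add: rep_def)

lemma rep_label: "rep s m T f z \<Longrightarrow> Disc k n i \<in> set T \<Longrightarrow> f k \<in> box A n (sign_at s i)"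
  by (simp add: rep_def labelling_def)

lemma labelling_upd:
  assumes "labelling A s T (f(k := x))" "\<And>n i. Disc k n i \<in> set T \<Longrightarrow> y \<in> box A n (sign_at s i)"
  shows "labelling A s T (f(k := y))"
  unfolding labelling_def
proof (intro allI impI)
  fix k' n i assume d: "Disc k' n i \<in> set T"
  show "(f(k := y)) k' \<in> box A n (sign_at s i)"
  proof (cases "k' = k")
    case True then show ?thesis using assms(2) d by simp
  next
    case False
    moreover have "(f(k := x)) k' \<in> box A n (sign_at s i)" using assms(1) d unfolding labelling_def
        by blast
    ultimately show ?thesis by simp
  qed
qed

lemma rep_add:
  assumes "rep s m T (f(k := x)) u" "rep s m T (f(k := y)) v" "Disc k n i \<in> set T"
  shows "rep s m T (f(k := x + y)) (u + v)"
proof -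
  have xy: "x \<in> box A n (sign_at s i)" "y \<in> box A n (sign_at s i)"
    using rep_label[OF assms(1,3)] rep_label[OF assms(2,3)] by simp_all
  have T: "tangle m T" using assms(1) by (simp add: rep_def)
  have "labelling A s T (f(k := x + y))"
  proof (rule labelling_upd[of s T f k x])
    show "x + y \<in> box A n' (sign_at s i')" if "Disc k n' i' \<in> set T" for n' i'
      using rep_label[OF assms(1) that] rep_label[OF assms(2) that] V.subspace_add[OF subspace_box]
          by simp
  qed (use assms(1) in \<open>simp add: rep_def\<close>)
  moreover have "act A s T ((f(k := x))(k := x + y))
      = act A s T ((f(k := x))(k := x)) + act A s T ((f(k := x))(k := y))"
    using assms(1) by (intro act_add[OF T _ assms(3) xy]) (simp add: rep_def)
  ultimately show ?thesis using assms T by (simp add: rep_def)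
qed

lemma rep_smul:
  assumes "rep s m T (f(k := x)) u" "Disc k n i \<in> set T"
  shows "rep s m T (f(k := smul A c x)) (smul A c u)"
proof -
  have x: "x \<in> box A n (sign_at s i)"
    using rep_label[OF assms] by simp
  have T: "tangle m T" using assms(1) by (simp add: rep_def)
  have "labelling A s T (f(k := smul A c x))"
  proof (rule labelling_upd[of s T f k x])
    show "smul A c x \<in> box A n' (sign_at s i')" if "Disc k n' i' \<in> set T" for n' i'
      using rep_label[OF assms(1) that] V.subspace_scale[OF subspace_box] by simp
  qed (use assms(1) in \<open>simp add: rep_def\<close>)
  moreover have "act A s T ((f(k := x))(k := smul A c x)) = smul A c (act A s T ((f(k := x))(k := x)))"
    using assms(1) by (intro act_smul[OF T _ assms(2) x]) (simp add: rep_def)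
  ultimately show ?thesis using assms T by (simp add: rep_def)
qed

lemma rep_linear:
  assumes R: "\<And>w. w \<in> box A n (sign_at s i) \<Longrightarrow> rep s m T (f(k := w)) (h w)" and d: "Disc k n i \<in> set T"
    and x: "x \<in> box A n (sign_at s i)"
  shows "y \<in> box A n (sign_at s i) \<Longrightarrow> h (x + y) = h x + h y" and "h (smul A c x) = smul A c (h x)"
proof -
  show "h (smul A c x) = smul A c (h x)"
    by (rule rep_unique[OF R[OF V.subspace_scale[OF subspace_box x]] rep_smul[OF R[OF x] d]])
  assume y: "y \<in> box A n (sign_at s i)"
  show "h (x + y) = h x + h y"
    by (rule rep_unique[OF R[OF V.subspace_add[OF subspace_box x y]] rep_add[OF R[OF x] R[OF y] d]])
qed

abbreviation mult_tangle :: "nat \<Rightarrow> layer list" where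
  "mult_tangle n \<equiv> [Disc 0 n 0, Disc 1 n (2 * n)] @ map Cap (rev [n..<2 * n])"

lemma rep_mult_tangle:
  assumes "x \<in> box A n s" "y \<in> box A n s" "f 0 = x" "f 1 = y"
  shows "rep s n (mult_tangle n) f (mult A n s x y)"
proof -
  have "map (shift (2 * n)) [Disc 1 n 0] = [Disc 1 n (2 * n)]" by simp
  moreover have "rep s n [Disc 0 n 0] f x" "rep s n [Disc 1 n 0] f y"
    using assms by (auto intro: rep_disc)
  ultimately show ?thesis using rep_mult[of s n "[Disc 0 n 0]" f x "[Disc 1 n 0]" y]
      by (simp del: rev_map)
qed

lemma mult_closed: "x \<in> box A n s \<Longrightarrow> y \<in> box A n s \<Longrightarrow> mult A n s x y \<in> box A n s"
  using rep_box rep_mult_tangle[of x n s y "\<lambda>k. if k = 0 then x else y"] by simp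

lemma mult_add_left: "x \<in> box A n s \<Longrightarrow> y \<in> box A n s \<Longrightarrow> z \<in> box A n s
    \<Longrightarrow> mult A n s (x + y) z = mult A n s x z + mult A n s y z"
  and mult_smul_left: "x \<in> box A n s \<Longrightarrow> z \<in> box A n s
    \<Longrightarrow> mult A n s (smul A c x) z = smul A c (mult A n s x z)"
proof -
  have R: "rep s n (mult_tangle n) ((\<lambda>_. z)(0 := w)) (mult A n s w z)"
    if "z \<in> box A n s" "w \<in> box A n (sign_at s (0))" for w
    using that by (intro rep_mult_tangle) auto
  have d: "Disc 0 n (0) \<in> set (mult_tangle n)" by simp
  note lin = rep_linear[of n s "0" n "mult_tangle n" "\<lambda>_. z" 0 "\<lambda>w. mult A n s w z", OF R d]
  show "mult A n s (x + y) z = mult A n s x z + mult A n s y z"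
    if "x \<in> box A n s" "y \<in> box A n s" "z \<in> box A n s"
    by (rule lin(1)) (use that in simp_all)
  show "mult A n s (smul A c x) z = smul A c (mult A n s x z)" if "x \<in> box A n s" "z \<in> box A n s"
    by (rule lin(2)) (use that in simp_all)
qed

lemma mult_add_right: "x \<in> box A n s \<Longrightarrow> y \<in> box A n s \<Longrightarrow> z \<in> box A n s
    \<Longrightarrow> mult A n s z (x + y) = mult A n s z x + mult A n s z y"
  and mult_smul_right: "x \<in> box A n s \<Longrightarrow> z \<in> box A n s
    \<Longrightarrow> mult A n s z (smul A c x) = smul A c (mult A n s z x)"
proof -
  have R: "rep s n (mult_tangle n) ((\<lambda>_. z)(1 := w)) (mult A n s z w)"
    if "z \<in> box A n s" "w \<in> box A n (sign_at s (2 * n))" for w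
    using that by (intro rep_mult_tangle) auto
  have d: "Disc 1 n (2 * n) \<in> set (mult_tangle n)" by simp
  note lin = rep_linear[of n s "2 * n" n "mult_tangle n" "\<lambda>_. z" 1 "\<lambda>w. mult A n s z w", OF R d]
  show "mult A n s z (x + y) = mult A n s z x + mult A n s z y"
    if "x \<in> box A n s" "y \<in> box A n s" "z \<in> box A n s"
    by (rule lin(1)) (use that in simp_all)
  show "mult A n s z (smul A c x) = smul A c (mult A n s z x)" if "x \<in> box A n s" "z \<in> box A n s"
    by (rule lin(2)) (use that in simp_all)
qed

lemma rep_fourier_tangle:
  assumes "x \<in> box A 2 s" "f 0 = x"
  shows "rep (opp s) 2 [Cup 0, Disc 0 2 1, Cap 4] f (fourier A s x)"
  using rep_fourier[OF rep_disc[of x 2 s f 0]] assms by simp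

lemma fourier_closed: "x \<in> box A 2 s \<Longrightarrow> fourier A s x \<in> box A 2 (opp s)"
  using rep_box rep_fourier_tangle[of x s "\<lambda>_. x"] by simp

lemma fourier_add: "x \<in> box A 2 s \<Longrightarrow> y \<in> box A 2 s \<Longrightarrow> fourier A s (x + y) = fourier A s x + fourier A s y"
  and fourier_smul: "x \<in> box A 2 s \<Longrightarrow> fourier A s (smul A c x) = smul A c (fourier A s x)"
proof -
  let ?T = "[Cup 0, Disc 0 2 1, Cap 4]"
  have R: "rep (opp s) 2 ?T ((\<lambda>_. 0)(0 := w)) (fourier A s w)" if "w \<in> box A 2 (sign_at (opp s) 1)"
      for w
    using that by (intro rep_fourier_tangle) simp_all
  note lin = rep_linear[of 2 "opp s" 1 2 ?T "\<lambda>_. 0" 0 "fourier A s", OF R]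
  show "fourier A s (x + y) = fourier A s x + fourier A s y" if "x \<in> box A 2 s" "y \<in> box A 2 s"
    by (rule lin(1)) (use that in simp_all)
  show "fourier A s (smul A c x) = smul A c (fourier A s x)" if "x \<in> box A 2 s"
    by (rule lin(2)) (use that in simp_all)
qed

lemma mult_assoc:
  assumes "x \<in> box A 2 s" "y \<in> box A 2 s" "z \<in> box A 2 s"
  shows "mult A 2 s (mult A 2 s x y) z = mult A 2 s x (mult A 2 s y z)"
proof -
  define f :: "nat \<Rightarrow> 'a" where "f = (\<lambda>_. 0)(0 := x, 1 := y, 2 := z)"
  have R: "rep s 2 [Disc 0 2 0] f x" "rep s 2 [Disc 1 2 0] f y" "rep s 2 [Disc 2 2 0] f z"
    using assms by (auto simp: f_def intro: rep_disc)
  have "rep s 2 [Disc 0 2 0, Disc 1 2 4, Cap 3, Cap 2, Disc 2 2 4, Cap 3, Cap 2] f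
      (mult A 2 s (mult A 2 s x y) z)"
    using rep_mult[OF rep_mult[OF R(1,2)] R(3)] by (simp add: upt_rec)
  moreover have "rep s 2 [Disc 0 2 0, Disc 1 2 4, Disc 2 2 8, Cap 7, Cap 6, Cap 3, Cap 2] f
      (mult A 2 s x (mult A 2 s y z))"
    using rep_mult[OF R(1) rep_mult[OF R(2,3)]] by (simp add: upt_rec)
  ultimately show ?thesis using isotopic_mult_assoc by (rule rep_isotopic)
qed

lemma one_closed: "one A n s \<in> box A n s"
  using rep_one[of s n "\<lambda>_. 0"] rep_box by blast

lemma mult_one_left2:
  assumes "x \<in> box A 2 s"
  shows "mult A 2 s (one A 2 s) x = x"
proof -
  have R: "rep s 2 [Disc 0 2 0] (\<lambda>_. x) x" by (rule rep_disc) (use assms in auto)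
  have "rep s 2 [Cup 0, Cup 1, Disc 0 2 4, Cap 3, Cap 2] (\<lambda>_. x) (mult A 2 s (one A 2 s) x)"
    using rep_mult[OF rep_one R] by (simp add: upt_rec)
  then show ?thesis using R isotopic_one_mult by (rule rep_isotopic)
qed

lemma mult_one_right2:
  assumes "x \<in> box A 2 s"
  shows "mult A 2 s x (one A 2 s) = x"
proof -
  have R: "rep s 2 [Disc 0 2 0] (\<lambda>_. x) x" by (rule rep_disc) (use assms in auto)
  have "rep s 2 [Disc 0 2 0, Cup 4, Cup 5, Cap 3, Cap 2] (\<lambda>_. x) (mult A 2 s x (one A 2 s))"
    using rep_mult[OF R rep_one] by (simp add: upt_rec)
  then show ?thesis using R isotopic_mult_one by (rule rep_isotopic)
qed

lemma mult_one_left1: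
  assumes "x \<in> box A 1 s"
  shows "mult A 1 s (one A 1 s) x = x"
proof -
  have R: "rep s 1 [Disc 0 1 0] (\<lambda>_. x) x" by (rule rep_disc) (use assms in auto)
  have "rep s 1 [Cup 0, Disc 0 1 2, Cap 1] (\<lambda>_. x) (mult A 1 s (one A 1 s) x)"
    using rep_mult[OF rep_one R] by (simp add: upt_rec)
  then show ?thesis using R isotopic_one_mult1 by (rule rep_isotopic)
qed

lemma mult_one_left0:
  assumes "x \<in> box A 0 s"
  shows "mult A 0 s (one A 0 s) x = x"
proof -
  have R: "rep s 0 [Disc 0 0 0] (\<lambda>_. x) x" by (rule rep_disc) (use assms in auto)
  have "rep s 0 [Disc 0 0 0] (\<lambda>_. x) (mult A 0 s (one A 0 s) x)"
    using rep_mult[OF rep_one R] by simp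
  then show ?thesis using R by (rule rep_unique)
qed

lemma zero_closed: "0 \<in> box A n s"
  by (rule V.subspace_0[OF subspace_box])

lemma mult_zero_left: "x \<in> box A n s \<Longrightarrow> mult A n s 0 x = 0"
  using mult_smul_left[of 0 n s x 0] zero_closed by simp

text \<open>
  A one-dimensional unital box space consists of the multiples of its unit: the unit cannot vanish
  because it acts as the identity.
\<close>

lemma dim_one_box:
  assumes dim: "V.dim (box A n s) = 1" and unit: "\<And>x. x \<in> box A n s \<Longrightarrow> mult A n s (one A n s) x = x"
  shows "one A n s \<noteq> 0" and "x \<in> box A n s \<Longrightarrow> \<exists>c. x = smul A c (one A n s)"
proof -
  obtain B where B: "B \<subseteq> box A n s" "V.independent B" "box A n s \<subseteq> V.span B" "card B
      = V.dim (box A n s)"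
    by (rule V.basis_exists)
  then obtain v where v: "B = {v}" using dim by (auto simp: card_1_singleton_iff)
  then have v0: "v \<in> box A n s" "v \<noteq> 0" using B(1,2) V.dependent_zero[of B] by auto
  show 1: "one A n s \<noteq> 0" using unit[OF v0(1)] mult_zero_left[OF v0(1)] v0(2) by auto
  have span: "\<exists>c. x = smul A c v" if "x \<in> box A n s" for x
    using that B(3) by (auto simp: v V.span_singleton)
  from span[OF one_closed] obtain d where d: "one A n s = smul A d v" ..
  then have d0: "d \<noteq> 0" using 1 by auto
  assume "x \<in> box A n s"
  from span[OF this] obtain c where "x = smul A c v" ..
  then have "x = smul A (c / d) (one A n s)" using d d0 by simp
  then show "\<exists>c. x = smul A c (one A n s)" ..
qed

end

context planar_star_algebra
begin

lemma adj_mult2: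
  assumes "x \<in> box A 2 s" "y \<in> box A 2 s"
  shows "adj A 2 s (mult A 2 s x y) = mult A 2 s (adj A 2 s y) (adj A 2 s x)"
proof -
  define f :: "nat \<Rightarrow> 'a" where "f = (\<lambda>_. 0)(0 := x, 1 := y)"
  define g :: "nat \<Rightarrow> 'a" where "g = (\<lambda>_. 0)(0 := adj A 2 s x, 1 := adj A 2 s y)"
  have R: "rep s 2 [Disc 0 2 0] f x" "rep s 2 [Disc 1 2 0] f y"
      "rep s 2 [Disc 0 2 0] g (adj A 2 s x)" "rep s 2 [Disc 1 2 0] g (adj A 2 s y)"
    using assms by (auto simp: f_def g_def adj_closed intro: rep_disc)
  have "rep s 2 (reflect 0 [Disc 0 2 0, Disc 1 2 4, Cap 3, Cap 2]) g (adj A 2 s (mult A 2 s x y))"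
    using rep_mult[OF R(1,2)] by (intro rep_adj[of _ _ _ f]) (auto simp: upt_rec f_def g_def)
  then have "rep s 2 [Disc 0 2 0, Disc 1 2 0, Cap 3, Cap 2] g (adj A 2 s (mult A 2 s x y))" by simp
  moreover have "rep s 2 [Disc 1 2 0, Disc 0 2 4, Cap 3, Cap 2] g (mult A 2 s (adj A 2 s y) (adj A 2
      s x))"
    using rep_mult[OF R(4,3)] by (simp add: upt_rec)
  ultimately show ?thesis using isotopic_reflect_mult2 by (rule rep_isotopic)
qed

lemma adj_mult3:
  assumes "x \<in> box A 3 s" "y \<in> box A 3 s"
  shows "adj A 3 s (mult A 3 s x y) = mult A 3 s (adj A 3 s y) (adj A 3 s x)"
proof -
  define f :: "nat \<Rightarrow> 'a" where "f = (\<lambda>_. 0)(0 := x, 1 := y)"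
  define g :: "nat \<Rightarrow> 'a" where "g = (\<lambda>_. 0)(0 := adj A 3 s x, 1 := adj A 3 s y)"
  have R: "rep s 3 [Disc 0 3 0] f x" "rep s 3 [Disc 1 3 0] f y"
      "rep s 3 [Disc 0 3 0] g (adj A 3 s x)" "rep s 3 [Disc 1 3 0] g (adj A 3 s y)"
    using assms by (auto simp: f_def g_def adj_closed intro: rep_disc)
  have "rep s 3 (reflect 0 [Disc 0 3 0, Disc 1 3 6, Cap 5, Cap 4, Cap 3]) g (adj A 3 s (mult A 3 s x
      y))"
    using rep_mult[OF R(1,2)] by (intro rep_adj[of _ _ _ f]) (auto simp: upt_rec f_def g_def)
  then have "rep s 3 [Disc 0 3 0, Disc 1 3 0, Cap 5, Cap 4, Cap 3] g (adj A 3 s (mult A 3 s x y))"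
      by simp
  moreover have "rep s 3 [Disc 1 3 0, Disc 0 3 6, Cap 5, Cap 4, Cap 3] g (mult A 3 s (adj A 3 s y)
      (adj A 3 s x))"
    using rep_mult[OF R(4,3)] by (simp add: upt_rec)
  ultimately show ?thesis using isotopic_reflect_mult3 by (rule rep_isotopic)
qed

lemma adj_one0: "adj A 0 s (one A 0 s) = one A 0 s"
proof -
  have R: "rep s 0 [] (\<lambda>_. 0) (one A 0 s)" using rep_one[of s 0] by simp
  have "rep s 0 [] (\<lambda>_. 0) (adj A 0 s (one A 0 s))"
    using rep_adj[OF R, of "\<lambda>_. 0"] by simp
  then show ?thesis using R by (rule rep_unique)
qed

lemma adj_one1: "adj A 1 s (one A 1 s) = one A 1 s"
proof -
  have R: "rep s 1 [Cup 0] (\<lambda>_. 0) (one A 1 s)" using rep_one[of s 1] by simp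
  have "rep s 1 [Cup 0] (\<lambda>_. 0) (adj A 1 s (one A 1 s))"
    using rep_adj[OF R, of "\<lambda>_. 0"] by simp
  then show ?thesis using R by (rule rep_unique)
qed

end

context subfactor_planar_algebra
begin

lemmas one0_nonzero = dim_one_box(1)[OF dim_0 mult_one_left0]
  and box0_span = dim_one_box(2)[OF dim_0 mult_one_left0]

lemma smul_one0_eq_iff: "smul A c (one A 0 s) = smul A d (one A 0 s) \<longleftrightarrow> c = d"
  using one0_nonzero by simp

lemma scalar_smul: "scalar A s (smul A c (one A 0 s)) = c"
  unfolding scalar_def by (rule the_equality) (auto simp: one0_nonzero)

lemma smul_scalar: "x \<in> box A 0 s \<Longrightarrow> smul A (scalar A s x) (one A 0 s) = x"
  using box0_span scalar_smul by metis

definition closed_value :: "sign \<Rightarrow> layer list \<Rightarrow> (nat \<Rightarrow> 'a) \<Rightarrow> complex \<Rightarrow> bool" where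
  "closed_value s T f c \<longleftrightarrow> rep s 0 T f (smul A c (one A 0 s))"

lemma closed_value_isotopic:
  "closed_value s T f c \<Longrightarrow> closed_value s T' f d \<Longrightarrow> isotopic 0 T T' \<Longrightarrow> c = d"
  unfolding closed_value_def using rep_isotopic smul_one0_eq_iff by blast

lemma closed_value_unique: "closed_value s T f c \<Longrightarrow> closed_value s T f d \<Longrightarrow> c = d"
  unfolding closed_value_def using rep_unique smul_one0_eq_iff by blast

lemma closed_value_scalar: "rep s 0 T f x \<Longrightarrow> closed_value s T f (scalar A s x)"
  unfolding closed_value_def using smul_scalar rep_box by metis

lemma closed_value_tr:
  assumes "rep s n S f x"
  shows "closed_value s (S @ map Cap (rev [0..<n])) f (tr A n s x)"
proof -
  let ?T = "Disc 0 n 0 # map Cap (rev [0..<n])"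
  have "tangle 0 ?T" using runs_caps[of 0 n 0] by (simp add: tangle_def del: rev_map)
  then have "rep s 0 ?T (\<lambda>_. x) (act A s ?T (\<lambda>_. x))"
    using rep_box[OF assms] by (auto simp: rep_def labelling_def)
  then have "rep s 0 (plug 0 S ?T) f (act A s ?T (\<lambda>_. x))"
    by (rule rep_unary) (use assms in \<open>auto simp del: rev_map\<close>)
  moreover have "map (shift 0) S = S" by (intro map_idI) (simp add: shift_def)
  ultimately have "rep s 0 (S @ map Cap (rev [0..<n])) f (act A s ?T (\<lambda>_. x))" by (simp del: rev_map)
  then show ?thesis unfolding tr_def by (rule closed_value_scalar)
qed

lemma closed_value_left_tr1:
  assumes "rep s 1 S f x"
  shows "closed_value (opp s) (Cup 0 # map (shift 1) S @ [Cap 0, Cap 0]) f (left_tr1 A s x)"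
proof -
  let ?T = "[Cup 0, Disc 0 1 1, Cap 0, Cap 0]"
  have "rep (opp s) 0 ?T (\<lambda>_. x) (act A (opp s) ?T (\<lambda>_. x))"
    using rep_box[OF assms] by (auto simp: rep_def labelling_def tangle_def)
  then have "rep (opp s) 0 (plug 0 S ?T) f (act A (opp s) ?T (\<lambda>_. x))"
    by (rule rep_unary) (use assms in auto)
  then have "rep (opp s) 0 (Cup 0 # map (shift 1) S @ [Cap 0, Cap 0]) f (act A (opp s) ?T (\<lambda>_. x))"
      by simp
  then show ?thesis unfolding left_tr1_def by (rule closed_value_scalar)
qed

lemma closed_value_tr_disc: "x \<in> box A n s \<Longrightarrow> f 0 = x
    \<Longrightarrow> closed_value s (Disc 0 n 0 # map Cap (rev [0..<n])) f (tr A n s x)"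
  using closed_value_tr[OF rep_disc[of x n s f 0]] by simp

lemma tr_add: "x \<in> box A n s \<Longrightarrow> y \<in> box A n s \<Longrightarrow> tr A n s (x + y) = tr A n s x + tr A n s y"
  and tr_smul: "x \<in> box A n s \<Longrightarrow> tr A n s (smul A c x) = c * tr A n s x"
proof -
  let ?T = "Disc 0 n 0 # map Cap (rev [0..<n])" and ?h = "\<lambda>w. smul A (tr A n s w) (one A 0 s)"
  have R: "rep s 0 ?T ((\<lambda>_. 0)(0 := w)) (?h w)" if "w \<in> box A n (sign_at s 0)" for w
    using closed_value_tr_disc[of w n s] that by (simp add: closed_value_def del: rev_map)
  have d: "Disc 0 n 0 \<in> set ?T" by simp
  note lin = rep_linear[of n s 0 0 ?T "\<lambda>_. 0" 0 ?h, OF R d]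
  show "tr A n s (x + y) = tr A n s x + tr A n s y" if "x \<in> box A n s" "y \<in> box A n s"
    using lin(1)[of x y] that smul_one0_eq_iff[of "tr A n s (x + y)" s]
    by (simp only: sign_at_simps V.scale_left_distrib[symmetric])
  show "tr A n s (smul A c x) = c * tr A n s x" if "x \<in> box A n s"
    using lin(2)[of x c] that smul_one0_eq_iff[of "tr A n s (smul A c x)" s]
    by (simp only: sign_at_simps V.scale_scale)
qed

lemma tr_comm:
  assumes "x \<in> box A 2 s" "y \<in> box A 2 s"
  shows "tr A 2 s (mult A 2 s x y) = tr A 2 s (mult A 2 s y x)"
proof -
  define f :: "nat \<Rightarrow> 'a" where "f = (\<lambda>_. 0)(0 := x, 1 := y)"
  have R: "rep s 2 [Disc 0 2 0] f x" "rep s 2 [Disc 1 2 0] f y"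
    using assms by (auto simp: f_def intro: rep_disc)
  have "closed_value s [Disc 0 2 0, Disc 1 2 4, Cap 3, Cap 2, Cap 1, Cap 0] f (tr A 2 s (mult A 2 s
      x y))"
    using closed_value_tr[OF rep_mult[OF R]] by (simp add: upt_rec)
  moreover have "closed_value s [Disc 1 2 0, Disc 0 2 4, Cap 3, Cap 2, Cap 1, Cap 0] f (tr A 2 s
      (mult A 2 s y x))"
    using closed_value_tr[OF rep_mult[OF R(2,1)]] by (simp add: upt_rec)
  ultimately show ?thesis using isotopic_trace_comm by (rule closed_value_isotopic)
qed

lemma closed_value_adj:
  assumes "closed_value s T f c" "\<And>k n i. Disc k n i \<in> set T \<Longrightarrow> g k = adj A n (sign_at s i) (f k)"
  shows "closed_value s (reflect 0 T) g (cnj c)"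
proof -
  have "rep s 0 (reflect 0 T) g (adj A 0 s (smul A c (one A 0 s)))"
    using assms by (intro rep_adj) (auto simp: closed_value_def)
  then show ?thesis using adj_smul[OF one_closed, of 0 s c] by (simp add: closed_value_def adj_one0)
qed

lemma tr_adj:
  assumes "x \<in> box A n s" "n \<in> {2, 3}"
  shows "tr A n s (adj A n s x) = cnj (tr A n s x)"
proof -
  let ?T = "Disc 0 n 0 # map Cap (rev [0..<n])"
  have "closed_value s (reflect 0 ?T) (\<lambda>_. adj A n s x) (cnj (tr A n s x))"
    by (rule closed_value_adj[OF closed_value_tr_disc[OF assms(1), of "\<lambda>_. x"]]) auto
  moreover have "reflect 0 ?T = ?T" using assms(2) by (auto simp: numeral_2_eq_2 numeral_3_eq_3)
  ultimately have "closed_value s ?T (\<lambda>_. adj A n s x) (cnj (tr A n s x))" by simp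
  moreover have "closed_value s ?T (\<lambda>_. adj A n s x) (tr A n s (adj A n s x))"
    using closed_value_tr_disc[OF adj_closed[OF assms(1)], of "\<lambda>_. adj A n s x"] by simp
  ultimately show ?thesis by (rule closed_value_unique[symmetric])
qed

end

section \<open>Diagrammatic inequalities\<close>

lemma interval3: "[0..<3] = [0, 1, 2]" "[3..<6] = [3, 4, 5]"
  by (simp_all add: numeral_eq_Suc)

context subfactor_planar_algebra
begin

lemma tr_zero [simp]: "tr A n s 0 = 0"
  using tr_smul[of 0 n s 0] zero_closed by simp

lemma trace_form_conj:
  assumes "x \<in> box A n s" "y \<in> box A n s" "n \<in> {2, 3}"
  shows "tr A n s (mult A n s (adj A n s y) x) = cnj (tr A n s (mult A n s (adj A n s x) y))"
proof -
  have "adj A n s (mult A n s (adj A n s x) y) = mult A n s (adj A n s y) x"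
    using assms adj_mult2[of "adj A n s x" s y] adj_mult3[of "adj A n s x" s y] adj_closed adj_adj
        by auto
  then show ?thesis using tr_adj[OF mult_closed[OF adj_closed[OF assms(1)] assms(2)] assms(3)] by simp
qed

lemma trace_form_nonneg:
  assumes "x \<in> box A n s"
  shows "0 \<le> Re (tr A n s (mult A n s (adj A n s x) x))"
    and "tr A n s (mult A n s (adj A n s x) x) = of_real (Re (tr A n s (mult A n s (adj A n s x) x)))"
proof -
  have "tr A n s (mult A n s (adj A n s x) x) \<in> \<real> \<and> 0 \<le> Re (tr A n s (mult A n s (adj A n s x) x))"
  proof (cases "x = 0")
    case True
    have "mult A n s (adj A n s x) x = 0"
      using True mult_smul_right[of x n s "adj A n s x" 0] assms adj_closed by simp
    then show ?thesis by simp
  qed (use positive[OF assms] in auto)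
  then show "0 \<le> Re (tr A n s (mult A n s (adj A n s x) x))"
    and "tr A n s (mult A n s (adj A n s x) x) = of_real (Re (tr A n s (mult A n s (adj A n s x) x)))"
    by (auto simp: of_real_Re)
qed

lemma tr_norm_sq: "x \<in> box A n s \<Longrightarrow> (tr_norm A n s x)\<^sup>2 = Re (tr A n s (mult A n s (adj A n s x) x))"
  unfolding tr_norm_def by (simp add: trace_form_nonneg(1))

lemma tr_form_self: "x \<in> box A n s \<Longrightarrow> tr A n s (mult A n s (adj A n s x) x)
    = of_real ((tr_norm A n s x)\<^sup>2)"
  using trace_form_nonneg(2) tr_norm_sq by metis

lemma tr_norm_nonneg [simp]: "x \<in> box A n s \<Longrightarrow> 0 \<le> tr_norm A n s x"
  unfolding tr_norm_def by (simp add: trace_form_nonneg(1))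

text \<open>
  Plancherel's theorem leads to pairings of \<open>2\<close>-boxes, and cutting a pairing as in
  \<open>isotopic_pairing\<close> leads to pairings of \<open>3\<close>-boxes.
\<close>

lemma trace_Cauchy_Schwarz:
  assumes x: "x \<in> box A n s" and y: "y \<in> box A n s" and n: "n \<in> {2, 3}"
  shows "cmod (tr A n s (mult A n s (adj A n s y) x)) \<le> tr_norm A n s x * tr_norm A n s y"
proof -
  define H where "H u v = tr A n s (mult A n s (adj A n s v) u)" for u v
  define a where "a = H x y"
  have cl: "smul A c y \<in> box A n s" "smul A c x \<in> box A n s" "adj A n s x \<in> box A n s" "adj A n s y
      \<in> box A n s" for c
    using x y by (auto intro: V.subspace_scale[OF subspace_box] adj_closed)
  have H: "H y x = cnj a" unfolding a_def H_def by (rule trace_form_conj[OF y x n])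
  have HH: "H u u = of_real ((tr_norm A n s u)\<^sup>2)" if "u \<in> box A n s" for u
    unfolding H_def by (rule tr_form_self[OF that])
  have expand: "0 \<le> (tr_norm A n s x)\<^sup>2 + 2 * Re (cnj c * a) + (cmod c)\<^sup>2 * (tr_norm A n s y)\<^sup>2" for c
  proof -
    let ?z = "x + smul A c y"
    have z: "?z \<in> box A n s" using x cl V.subspace_add[OF subspace_box] by blast
    have "adj A n s ?z = adj A n s x + smul A (cnj c) (adj A n s y)"
      using x y cl by (simp add: adj_add adj_smul)
    then have "mult A n s (adj A n s ?z) ?z = mult A n s (adj A n s x) x
        + smul A c (mult A n s (adj A n s x) y)
        + (smul A (cnj c) (mult A n s (adj A n s y) x)
            + smul A (c * cnj c) (mult A n s (adj A n s y) y))"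
      using x y cl V.subspace_scale[OF subspace_box] V.subspace_add[OF subspace_box]
      by (simp add: mult_add_left mult_add_right mult_smul_left mult_smul_right V.scale_right_distrib)
    then have "H ?z ?z = H x x + c * H y x + (cnj c * H x y + c * cnj c * H y y)"
      using x y cl unfolding H_def
      by (simp add: tr_add tr_smul mult_closed V.subspace_scale[OF subspace_box] V.subspace_add[OF
          subspace_box])
    also have "\<dots> = of_real ((tr_norm A n s x)\<^sup>2) + (c * cnj a + cnj c * a)
        + of_real ((cmod c)\<^sup>2 * (tr_norm A n s y)\<^sup>2)"
      using HH[OF x] HH[OF y] complex_norm_square[of c]
          by (simp only: H a_def[symmetric] of_real_mult mult.commute add.assoc)
    also have "c * cnj a + cnj c * a = of_real (2 * Re (cnj c * a))"
      by (simp add: complex_eq_iff)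
    finally have "Re (H ?z ?z) = (tr_norm A n s x)\<^sup>2 + 2 * Re (cnj c * a)
        + (cmod c)\<^sup>2 * (tr_norm A n s y)\<^sup>2"
      by simp
    then show ?thesis using trace_form_nonneg(1)[OF z] unfolding H_def by simp
  qed
  define N where "N = (tr_norm A n s y)\<^sup>2"
  have "(cmod a)\<^sup>2 \<le> (tr_norm A n s x)\<^sup>2 * N"
  proof (cases "y = 0")
    case True
    then have "a = 0" using adj_smul[OF y, of 0] mult_zero_left[OF x] unfolding a_def H_def by simp
    then show ?thesis by (simp add: N_def)
  next
    case False
    then have N: "N > 0" using positive[OF y] by (simp add: N_def tr_norm_sq[OF y])
    \<comment> \<open>The value of \<open>c\<close> that minimizes the norm of \<open>x + c y\<close>.\<close>
    have "0 \<le> (tr_norm A n s x)\<^sup>2 + 2 * Re (cnj (- a / of_real N) * a) + (cmod (- a / of_real N))\<^sup>2 * N"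
      using expand[of "- a / of_real N"] by (simp only: N_def)
    also have "Re (cnj (- a / of_real N) * a) = - ((cmod a)\<^sup>2 / N)"
      by (simp add: cmod_power2) (simp add: power2_eq_square add_divide_distrib)
    also have "(cmod (- a / of_real N))\<^sup>2 * N = (cmod a)\<^sup>2 / N"
      using N by (simp add: norm_divide power_divide power2_eq_square)
    finally have "(cmod a)\<^sup>2 / N \<le> (tr_norm A n s x)\<^sup>2" by simp
    then show ?thesis using N by (simp add: divide_le_eq)
  qed
  then have "(cmod a)\<^sup>2 \<le> (tr_norm A n s x * tr_norm A n s y)\<^sup>2" by (simp add: N_def power_mult_distrib)
  then show ?thesis unfolding a_def H_def by (rule power2_le_imp_le) (use x y in simp)
qed

text \<open>
  Plancherel's theorem is sphericality: the pairing of the rotated elements is the left closure of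
  the \<open>1\<close>-box whose right closure is the original pairing.
\<close>

lemma fourier_pairing:
  assumes x: "x \<in> box A 2 s" and y: "y \<in> box A 2 s"
  shows "tr A 2 (opp s) (mult A 2 (opp s) (adj A 2 (opp s) (fourier A s y)) (fourier A s x))
    = tr A 2 s (mult A 2 s (adj A 2 s y) x)"
proof -
  define g :: "nat \<Rightarrow> 'a" where "g = (\<lambda>_. 0)(0 := y)"
  define f :: "nat \<Rightarrow> 'a" where "f = (\<lambda>_. 0)(0 := adj A 2 s y, 1 := x)"
  have R: "rep s 2 [Disc 0 2 0] f (adj A 2 s y)" "rep s 2 [Disc 1 2 0] f x" "rep s 2 [Disc 0 2 0] g y"
    using x y by (auto simp: f_def g_def adj_closed intro: rep_disc)
  have "rep (opp s) 2 (reflect 0 [Cup 0, Disc 0 2 1, Cap 4]) f (adj A 2 (opp s) (fourier A s y))"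
    using rep_fourier[OF R(3)] by (intro rep_adj[of _ _ _ g]) (auto simp: f_def g_def)
  then have "rep (opp s) 2 [Cup 0, Disc 0 2 1, Cap 0] f (adj A 2 (opp s) (fourier A s y))" by simp
  then have "closed_value (opp s) [Cup 0, Disc 0 2 1, Cap 0, Cup 4, Disc 1 2 5, Cap 8, Cap 3, Cap 2,
      Cap 1, Cap 0] f
      (tr A 2 (opp s) (mult A 2 (opp s) (adj A 2 (opp s) (fourier A s y)) (fourier A s x)))"
    using closed_value_tr[OF rep_mult[OF _ rep_fourier[OF R(2)]]] by (fastforce simp: upt_rec)
  moreover define z where "z = act A s [Disc 0 2 0, Disc 1 2 4, Cap 3, Cap 2, Cap 1] f"
  then have z: "rep s 1 [Disc 0 2 0, Disc 1 2 4, Cap 3, Cap 2, Cap 1] f z"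
    using x y by (auto simp: rep_def f_def tangle_def labelling_def adj_closed)
  then have "closed_value (opp s) [Cup 0, Disc 0 2 1, Disc 1 2 5, Cap 4, Cap 3, Cap 2, Cap 0, Cap 0]
      f (left_tr1 A s z)"
    using closed_value_left_tr1[OF z] by (simp del: One_nat_def)
  ultimately have "left_tr1 A s z = tr A 2 (opp s) (mult A 2 (opp s) (adj A 2 (opp s) (fourier A s
      y)) (fourier A s x))"
    using isotopic_left_closure closed_value_isotopic by blast
  moreover have "left_tr1 A s z = tr A 1 s z" using spherical[OF rep_box[OF z]] by simp
  moreover have "closed_value s [Disc 0 2 0, Disc 1 2 4, Cap 3, Cap 2, Cap 1, Cap 0] f (tr A 1 s z)"
    using closed_value_tr[OF z] by simp
  moreover have "closed_value s [Disc 0 2 0, Disc 1 2 4, Cap 3, Cap 2, Cap 1, Cap 0] f (tr A 2 s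
      (mult A 2 s (adj A 2 s y) x))"
    using closed_value_tr[OF rep_mult[OF R(1,2)]] by (simp add: upt_rec)
  ultimately show ?thesis using closed_value_unique by metis
qed

end

context irreducible_subfactor_planar_algebra
begin

lemmas one1_nonzero = dim_one_box(1)[OF dim_1 mult_one_left1]
  and box1_span = dim_one_box(2)[OF dim_1 mult_one_left1]

text \<open>
  The loops of the two shadings are the left and the right closure of one string, so sphericality
  identifies their values; positivity of the trace of that string makes the common value positive.
\<close>

lemma loop_closed_value: "closed_value s [Cup 0, Cap 0] f (of_real (delta A))"
  and delta_pos: "delta A > 0"
  and tr_one1: "tr A 1 s (one A 1 s) = of_real (delta A)"
proof -
  have R: "rep s 1 [Cup 0] f (one A 1 s)" for s f using rep_one[of s 1 f] by simp
  have T: "closed_value s [Cup 0, Cap 0] f (tr A 1 s (one A 1 s))" for s f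
    using closed_value_tr[OF R] by simp
  have L: "closed_value (opp s) [Cup 0, Cup 1, Cap 0, Cap 0] f (left_tr1 A s (one A 1 s))" for s f
    using closed_value_left_tr1[OF R] by simp
  have opp: "tr A 1 (opp s) (one A 1 (opp s)) = tr A 1 s (one A 1 s)" for s
    using closed_value_isotopic[OF L T isotopic_left_loop] spherical[OF one_closed] by metis
  have "rep Pos 0 [Cup 0, Cap 0] (\<lambda>_. 0) (act A Pos [Cup 0, Cap 0] (\<lambda>_. 0))"
    by (simp add: rep_def tangle_def labelling_def)
  then have "closed_value Pos [Cup 0, Cap 0] (\<lambda>_. 0) (loop_value A)"
    unfolding loop_value_def by (rule closed_value_scalar)
  then have "loop_value A = tr A 1 Pos (one A 1 Pos)" using T closed_value_unique by blast
  then have loop: "loop_value A = tr A 1 s (one A 1 s)" for s using opp[of Pos] by (cases s) simp_all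
  have "tr A 1 s (one A 1 s) \<in> \<real> \<and> Re (tr A 1 s (one A 1 s)) > 0" for s
    using positive[OF one_closed one1_nonzero, of s] unfolding adj_one1 mult_one_left1[OF one_closed] .
  then have real: "loop_value A = of_real (delta A)" and pos: "delta A > 0"
    unfolding delta_def loop[of s] by (auto simp: of_real_Re)
  show "delta A > 0" by (rule pos)
  show "tr A 1 s (one A 1 s) = of_real (delta A)" using real loop by simp
  then show "closed_value s [Cup 0, Cap 0] f (of_real (delta A))" using T by metis
qed

lemma box1_eq: "x \<in> box A 1 s \<Longrightarrow> x = smul A (tr A 1 s x / of_real (delta A)) (one A 1 s)"
  using box1_span[where x = x and s = s] tr_smul[OF one_closed] tr_one1 delta_pos by force

lemma closed_value_one_multiple:
  assumes "closed_value s (plug k (map Cup [0..<n]) T) f c" "tangle 0 T" "Disc k n i \<in> set T"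
    "k \<notin> set (disc_names (plug k (map Cup [0..<n]) T))"
  shows "closed_value s T (f(k := smul A d (one A n (sign_at s i)))) (d * c)"
  using rep_one_multiple[OF _ assms(2-4)] assms(1) unfolding closed_value_def by fastforce

lemma tr_one2: "tr A 2 s (one A 2 s) = of_real ((delta A)\<^sup>2)"
proof -
  let ?T = "[Cup 0, Disc 0 0 1, Cap 0]" and ?f = "\<lambda>_. 0"
  \<comment> \<open>The inner one of the two nested loops is a \<open>0\<close>-box inside the outer one.\<close>
  have "closed_value s ?T (?f(0 := smul A (of_real (delta A)) (one A 0 (sign_at s 1)))) (of_real
      (delta A) * of_real (delta A))"
    using loop_closed_value by (intro closed_value_one_multiple) (auto simp: tangle_def)
  then have "closed_value s (plug 0 [Cup 0, Cap 0] ?T) ?f (of_real (delta A) * of_real (delta A))"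
    using loop_closed_value[of "opp s" ?f] unfolding closed_value_def
    by (intro rep_plug[where n = 0 and i = 1]) auto
  moreover have "closed_value s [Cup 0, Cup 1, Cap 1, Cap 0] ?f (tr A 2 s (one A 2 s))"
    using closed_value_tr[OF rep_one[of s 2 ?f]] by (simp add: upt_rec)
  ultimately show ?thesis using closed_value_unique by (fastforce simp: power2_eq_square)
qed

text \<open>
  The Jones projection: the tangle that joins the two top strings and the two bottom strings,
  divided by \<open>\<delta>\<close>. The square of the tangle contains one closed loop, and its trace is one closed
  loop.
\<close>

lemma ex_trace_one_projection: "\<exists>e. is_projection A 2 s e \<and> tr A 2 s e = 1"
proof -
  let ?T = "[Cup 0, Cup 2]" and ?f = "\<lambda>_. 0" and ?d = "of_real (delta A) :: complex"
  define E where "E = act A s ?T ?f"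
  have E: "rep s 2 ?T ?f E" by (simp add: rep_def E_def tangle_def labelling_def)
  have "rep s 2 (reflect 0 ?T) ?f (adj A 2 s E)" using rep_adj[OF E, of ?f] by simp
  then have "rep s 2 [Cup 0, Cup 0] ?f (adj A 2 s E)" by simp
  then have adj: "adj A 2 s E = E" using E isotopic_reflect_jones by (rule rep_isotopic)
  have "closed_value s [Cup 0, Cup 2, Cap 1, Cap 0] ?f (tr A 2 s E)"
    using closed_value_tr[OF E] by (simp add: upt_rec)
  then have tr: "tr A 2 s E = ?d" using loop_closed_value isotopic_trace_jones
      by (rule closed_value_isotopic)
  let ?L = "[Cup 0, Cup 2, Disc 0 0 4]"
  have "rep s 2 ?L (?f(0 := smul A ?d (one A 0 (sign_at s 4)))) (smul A ?d E)"
    using E by (intro rep_one_multiple) (auto simp: tangle_def)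
  then have "rep s 2 (plug 0 [Cup 0, Cap 0] ?L) ?f (smul A ?d E)"
    using loop_closed_value[of s ?f] unfolding closed_value_def
    by (intro rep_plug[where n = 0 and i = 4]) auto
  then have "rep s 2 [Cup 0, Cup 2, Cup 4, Cap 4] ?f (smul A ?d E)" by simp
  moreover have "rep s 2 [Cup 0, Cup 2, Cup 4, Cup 6, Cap 3, Cap 2] ?f (mult A 2 s E E)"
    using rep_mult[OF E E] by (simp add: upt_rec)
  ultimately have sq: "mult A 2 s E E = smul A ?d E" using isotopic_jones_square rep_isotopic by metis
  have box: "E \<in> box A 2 s" by (rule rep_box[OF E])
  let ?e = "smul A (1 / ?d) E"
  have "?e \<in> box A 2 s" using box V.subspace_scale[OF subspace_box] by blast
  moreover have "adj A 2 s ?e = ?e" using adj_smul[OF box, of "1 / ?d"] adj by simp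
  moreover have "mult A 2 s ?e ?e = ?e"
    using box sq delta_pos by (simp add: mult_smul_left mult_smul_right V.subspace_scale[OF
        subspace_box])
  moreover have "tr A 2 s ?e = 1" using tr_smul[OF box, of "1 / ?d"] tr delta_pos by simp
  ultimately show ?thesis unfolding is_projection_def by blast
qed

text \<open>
  Joining three of the four strings of two discs leaves a \<open>1\<close>-box, which is a scalar by
  irreducibility; closing it identifies the scalar.
\<close>

lemma one_box_factor:
  assumes "b \<in> box A 2 s" "B \<in> box A 2 s" "f i = B" "f j = b" "i \<noteq> j"
  shows "rep s 1 [Disc i 2 0, Disc j 2 4, Cap 3, Cap 2, Cap 1] f
     (smul A (tr A 2 s (mult A 2 s B b) / of_real (delta A)) (one A 1 s))"
proof -
  have R: "rep s 2 [Disc i 2 0] f B" "rep s 2 [Disc j 2 0] f b" using assms by (auto intro: rep_disc)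
  define z where "z = act A s [Disc i 2 0, Disc j 2 4, Cap 3, Cap 2, Cap 1] f"
  have z: "rep s 1 [Disc i 2 0, Disc j 2 4, Cap 3, Cap 2, Cap 1] f z"
    using assms by (auto simp: rep_def z_def tangle_def labelling_def)
  have "closed_value s [Disc i 2 0, Disc j 2 4, Cap 3, Cap 2, Cap 1, Cap 0] f (tr A 1 s z)"
    using closed_value_tr[OF z] by simp
  moreover have "closed_value s [Disc i 2 0, Disc j 2 4, Cap 3, Cap 2, Cap 1, Cap 0] f (tr A 2 s
      (mult A 2 s B b))"
    using closed_value_tr[OF rep_mult[OF R]] assms(5) by (simp add: upt_rec)
  ultimately have "tr A 1 s z = tr A 2 s (mult A 2 s B b)" by (rule closed_value_unique)
  then show ?thesis using z box1_eq[OF rep_box[OF z]] by simp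
qed

lemma closed_value_transfer:
  "closed_value s T' f c \<Longrightarrow> isotopic 0 T T' \<Longrightarrow> tangle 0 T \<Longrightarrow> labelling A s T f \<Longrightarrow> closed_value s T f c"
  unfolding closed_value_def rep_def using act_isotopic by auto

lemma tr_norm_adj: "x \<in> box A 2 s \<Longrightarrow> tr_norm A 2 s (adj A 2 s x) = tr_norm A 2 s x"
  using tr_comm[of x s "adj A 2 s x"] by (simp add: tr_norm_def adj_closed adj_adj)

lemma tr_norm_fourier: "x \<in> box A 2 s \<Longrightarrow> tr_norm A 2 (opp s) (fourier A s x) = tr_norm A 2 s x"
  using fourier_pairing[of x s x] by (simp add: tr_norm_def)

text \<open>
  With \<open>one_box_factor\<close> the \<open>1\<close>-box formed by \<open>b\<close> and its adjoint is pulled out as the scalar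
  \<open>\<parallel>b\<parallel>\<^sup>2 / \<delta>\<close>, and what remains is the trace of \<open>c\<^sup>* c\<close>.
\<close>

lemma upper_half_norm:
  assumes b: "b \<in> box A 2 s" and c: "c \<in> box A 2 (opp s)" and f: "f 1 = b" "f 2 = c"
    and u: "rep (opp s) 3 [Disc 2 2 0, Disc 1 2 3, Cap 6] f u"
  shows "(tr_norm A 3 (opp s) u)\<^sup>2 = (tr_norm A 2 s b)\<^sup>2 * (tr_norm A 2 (opp s) c)\<^sup>2 / delta A"
proof -
  let ?t = "opp s" and ?d = "tr A 2 s (mult A 2 s (adj A 2 s b) b) / of_real (delta A)"
  let ?W = "[Disc 4 2 0, Disc 2 2 4, Cap 3, Cap 2, Cap 1, Disc 9 1 1, Cap 0, Cap 0]"
  define h :: "nat \<Rightarrow> 'a" where "h = (\<lambda>_. 0)(1 := b, 2 := c, 4 := c, 5 := b)"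
  define g :: "nat \<Rightarrow> 'a" where "g = (\<lambda>_. 0)(1 := b, 2 := c, 4 := adj A 2 ?t c, 5 := adj A 2 s b)"
  have "rep ?t 3 [Disc 2 2 0, Disc 1 2 3, Cap 6] h u"
    by (rule rep_cong[OF u]) (use f in \<open>auto simp: h_def\<close>)
  then have "rep ?t 3 (plug 2 [Disc 4 2 0] [Disc 2 2 0, Disc 1 2 3, Cap 6]) h u"
    by (rule rep_rename) (auto simp: h_def)
  then have "rep ?t 3 (plug 1 [Disc 5 2 0] [Disc 4 2 0, Disc 1 2 3, Cap 6]) h u"
    by (intro rep_rename) (auto simp: h_def)
  then have h: "rep ?t 3 [Disc 4 2 0, Disc 5 2 3, Cap 6] h u" by simp
  have "rep ?t 3 (reflect 0 [Disc 4 2 0, Disc 5 2 3, Cap 6]) g (adj A 3 ?t u)"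
    by (rule rep_adj[OF h]) (auto simp: g_def h_def)
  then have u': "rep ?t 3 [Disc 4 2 0, Disc 5 2 1, Cap 0] g (adj A 3 ?t u)" by simp
  have "rep ?t 3 [Disc 2 2 0, Disc 1 2 3, Cap 6] g u"
    by (rule rep_cong[OF u]) (use f in \<open>auto simp: g_def\<close>)
  from closed_value_tr[OF rep_mult[OF u' this]]
  have 1: "closed_value ?t [Disc 4 2 0, Disc 5 2 1, Cap 0, Disc 2 2 6, Disc 1 2 9, Cap 12, Cap 5,
      Cap 4, Cap 3, Cap 2, Cap 1, Cap 0]
      g (tr A 3 ?t (mult A 3 ?t (adj A 3 ?t u) u))" by (simp add: interval3)
  have R: "rep ?t 2 [Disc 4 2 0] g (adj A 2 ?t c)" "rep ?t 2 [Disc 2 2 0] g c"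
    using c by (auto simp: g_def adj_closed intro: rep_disc)
  have "closed_value ?t [Disc 4 2 0, Disc 2 2 4, Cap 3, Cap 2, Cap 1, Cap 0] g (tr A 2 ?t (mult A 2
      ?t (adj A 2 ?t c) c))"
    using closed_value_tr[OF rep_mult[OF R]] by (simp add: upt_rec)
  then have "closed_value ?t [Disc 4 2 0, Disc 2 2 4, Cap 3, Cap 2, Cap 1, Cup 1, Cap 0, Cap 0] g
      (tr A 2 ?t (mult A 2 ?t (adj A 2 ?t c) c))"
    by (rule closed_value_transfer[OF _ isotopic_norm_upper_rest]) (use c in \<open>auto simp: tangle_def
        labelling_def g_def adj_closed\<close>)
  then have "closed_value ?t ?W (g(9 := smul A ?d (one A 1 (sign_at ?t 1)))) (?d * tr A 2 ?t (mult A
      2 ?t (adj A 2 ?t c) c))"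
    by (intro closed_value_one_multiple) (auto simp: tangle_def)
  moreover have "rep s 1 [Disc 5 2 0, Disc 1 2 4, Cap 3, Cap 2, Cap 1] g (smul A ?d (one A 1 s))"
    using b by (intro one_box_factor) (auto simp: g_def adj_closed)
  ultimately have "closed_value ?t (plug 9 [Disc 5 2 0, Disc 1 2 4, Cap 3, Cap 2, Cap 1] ?W) g (?d *
      tr A 2 ?t (mult A 2 ?t (adj A 2 ?t c) c))"
    unfolding closed_value_def by (intro rep_plug[where n = 1 and i = 1]) auto
  then have "closed_value ?t [Disc 4 2 0, Disc 2 2 4, Cap 3, Cap 2, Cap 1, Disc 5 2 1, Disc 1 2 5,
      Cap 4, Cap 3, Cap 2, Cap 0, Cap 0]
     g (?d * tr A 2 ?t (mult A 2 ?t (adj A 2 ?t c) c))" by (simp del: One_nat_def)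
  from closed_value_isotopic[OF 1 this isotopic_norm_upper]
  have "of_real ((tr_norm A 3 ?t u)\<^sup>2) = (of_real ((tr_norm A 2 s b)\<^sup>2 * (tr_norm A 2 ?t c)\<^sup>2 /
      delta A) :: complex)"
    using tr_form_self[OF rep_box[OF u]] tr_form_self[OF b] tr_form_self[OF c] by simp
  then show ?thesis using of_real_eq_iff by blast
qed

lemma lower_half_norm:
  assumes a: "a \<in> box A 2 s" and d: "d \<in> box A 2 (opp s)" and f: "f 0 = a" "f 3 = d"
    and v: "rep (opp s) 3 [Disc 3 2 0, Disc 0 2 1, Cap 4] f v"
  shows "(tr_norm A 3 (opp s) (adj A 3 (opp s) v))\<^sup>2
      = (tr_norm A 2 s a)\<^sup>2 * (tr_norm A 2 (opp s) d)\<^sup>2 / delta A"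
proof -
  let ?t = "opp s" and ?e = "tr A 2 s (mult A 2 s (adj A 2 s a) a) / of_real (delta A)"
  let ?W = "[Disc 3 2 0, Disc 4 2 4, Cap 3, Cap 2, Disc 9 1 1, Cap 2, Cap 1, Cap 0]"
  let ?c = "tr A 2 ?t (mult A 2 ?t d (adj A 2 ?t d))"
  define h :: "nat \<Rightarrow> 'a" where "h = (\<lambda>_. 0)(0 := a, 3 := d, 4 := d, 5 := a)"
  define g :: "nat \<Rightarrow> 'a" where "g = (\<lambda>_. 0)(0 := a, 3 := d, 4 := adj A 2 ?t d, 5 := adj A 2 s a)"
  have "rep ?t 3 [Disc 3 2 0, Disc 0 2 1, Cap 4] h v"
    by (rule rep_cong[OF v]) (use f in \<open>auto simp: h_def\<close>)
  then have "rep ?t 3 (plug 3 [Disc 4 2 0] [Disc 3 2 0, Disc 0 2 1, Cap 4]) h v"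
    by (rule rep_rename) (auto simp: h_def)
  then have "rep ?t 3 (plug 0 [Disc 5 2 0] [Disc 4 2 0, Disc 0 2 1, Cap 4]) h v"
    by (intro rep_rename) (auto simp: h_def)
  then have h: "rep ?t 3 [Disc 4 2 0, Disc 5 2 1, Cap 4] h v" by simp
  have "rep ?t 3 (reflect 0 [Disc 4 2 0, Disc 5 2 1, Cap 4]) g (adj A 3 ?t v)"
    by (rule rep_adj[OF h]) (auto simp: g_def h_def)
  then have v': "rep ?t 3 [Disc 4 2 0, Disc 5 2 3, Cap 2] g (adj A 3 ?t v)" by simp
  have "rep ?t 3 [Disc 3 2 0, Disc 0 2 1, Cap 4] g v"
    by (rule rep_cong[OF v]) (use f in \<open>auto simp: g_def\<close>)
  from closed_value_tr[OF rep_mult[OF this v']]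
  have 1: "closed_value ?t [Disc 3 2 0, Disc 0 2 1, Cap 4, Disc 4 2 6, Disc 5 2 9, Cap 8, Cap 5, Cap
      4, Cap 3, Cap 2, Cap 1, Cap 0]
      g (tr A 3 ?t (mult A 3 ?t v (adj A 3 ?t v)))" by (simp add: interval3)
  have R: "rep ?t 2 [Disc 4 2 0] g (adj A 2 ?t d)" "rep ?t 2 [Disc 3 2 0] g d"
    using d by (auto simp: g_def adj_closed intro: rep_disc)
  have "closed_value ?t [Disc 3 2 0, Disc 4 2 4, Cap 3, Cap 2, Cap 1, Cap 0] g ?c"
    using closed_value_tr[OF rep_mult[OF R(2,1)]] by (simp add: upt_rec)
  then have "closed_value ?t [Disc 3 2 0, Disc 4 2 4, Cap 3, Cap 2, Cup 1, Cap 2, Cap 1, Cap 0] g ?c"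
    by (rule closed_value_transfer[OF _ isotopic_norm_lower_rest]) (use d in \<open>auto simp: tangle_def
        labelling_def g_def adj_closed\<close>)
  then have "closed_value ?t ?W (g(9 := smul A ?e (one A 1 (sign_at ?t 1)))) (?e * ?c)"
    by (intro closed_value_one_multiple) (auto simp: tangle_def)
  moreover have "rep s 1 [Disc 5 2 0, Disc 0 2 4, Cap 3, Cap 2, Cap 1] g (smul A ?e (one A 1 s))"
    using a by (intro one_box_factor) (auto simp: g_def adj_closed)
  ultimately have "closed_value ?t (plug 9 [Disc 5 2 0, Disc 0 2 4, Cap 3, Cap 2, Cap 1] ?W) g (?e *
      ?c)"
    unfolding closed_value_def by (intro rep_plug[where n = 1 and i = 1]) auto
  then have "closed_value ?t [Disc 3 2 0, Disc 4 2 4, Cap 3, Cap 2, Disc 5 2 1, Disc 0 2 5, Cap 4,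
      Cap 3, Cap 2, Cap 2, Cap 1, Cap 0]
     g (?e * ?c)" by (simp del: One_nat_def)
  from closed_value_isotopic[OF 1 this isotopic_norm_lower]
  have "tr A 3 ?t (mult A 3 ?t v (adj A 3 ?t v)) = ?e * ?c" .
  moreover have "tr A 3 ?t (mult A 3 ?t v (adj A 3 ?t v)) = of_real ((tr_norm A 3 ?t (adj A 3 ?t v))\<^sup>2)"
    using tr_form_self[OF adj_closed[OF rep_box[OF v]]] adj_adj[OF rep_box[OF v]] by simp
  moreover have "?c = of_real ((tr_norm A 2 ?t d)\<^sup>2)"
    using tr_form_self[OF d] tr_comm[OF d adj_closed[OF d]] by simp
  ultimately have "of_real ((tr_norm A 3 ?t (adj A 3 ?t v))\<^sup>2)
      = (of_real ((tr_norm A 2 s a)\<^sup>2 * (tr_norm A 2 ?t d)\<^sup>2 / delta A) :: complex)"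
    using tr_form_self[OF a] by simp
  then show ?thesis using of_real_eq_iff by blast
qed

text \<open>
  The only inequality about the Fourier transform itself that is taken from the diagrams; it
  contains \<open>\<parallel>\<FF>(x)\<parallel>\<^sub>\<infinity> \<le> \<parallel>x\<parallel>\<^sub>1 / \<delta>\<close>. The pairing of \<open>\<FF>(a b)\<close> with \<open>c d\<close> is cut into two \<open>3\<close>-boxes in
  such a way that \<open>a, d\<close> lie on one side and \<open>b, c\<close> on the other. By irreducibility the norms of the
  halves are \<open>\<parallel>a\<parallel> \<parallel>d\<parallel> / \<surd>\<delta>\<close> and \<open>\<parallel>b\<parallel> \<parallel>c\<parallel> / \<surd>\<delta>\<close>, and the Cauchy-Schwarz inequality gives the bound.
\<close>

lemma fourier_product_bound:
  assumes a: "a \<in> box A 2 s" and b: "b \<in> box A 2 s" and c: "c \<in> box A 2 (opp s)" and d: "d \<in> box A 2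
      (opp s)"
  shows "cmod (tr A 2 (opp s) (mult A 2 (opp s) (adj A 2 (opp s) (mult A 2 (opp s) c d)) (fourier A
      s (mult A 2 s a b))))
    \<le> tr_norm A 2 s a * tr_norm A 2 s b * tr_norm A 2 (opp s) c * tr_norm A 2 (opp s) d / delta A"
proof -
  let ?t = "opp s" and ?C = "adj A 2 (opp s) c" and ?D = "adj A 2 (opp s) d"
  let ?a = "fourier A (opp s) (fourier A s a)"
  let ?X = "tr A 2 ?t (mult A 2 ?t (adj A 2 ?t (mult A 2 ?t c d)) (fourier A s (mult A 2 s a b)))"
  define f :: "nat \<Rightarrow> 'a" where "f = (\<lambda>_. 0)(0 := a, 1 := b, 2 := ?C, 3 := ?D)"
  have CD: "?C \<in> box A 2 ?t" "?D \<in> box A 2 ?t" and a': "?a \<in> box A 2 s"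
    using a c d fourier_closed[OF fourier_closed[OF a]] by (simp_all add: adj_closed)
  have R: "rep s 2 [Disc 0 2 0] f a" "rep s 2 [Disc 1 2 0] f b" "rep ?t 2 [Disc 2 2 0] f ?C" "rep ?t
      2 [Disc 3 2 0] f ?D"
    using a b CD by (auto simp: f_def intro: rep_disc)
  define u where "u = act A ?t [Disc 2 2 0, Disc 1 2 3, Cap 6] f"
  have u: "rep ?t 3 [Disc 2 2 0, Disc 1 2 3, Cap 6] f u"
    using b CD by (auto simp: rep_def u_def tangle_def labelling_def f_def)
  define v where "v = act A ?t [Disc 3 2 0, Disc 0 2 1, Cap 4] (f(0 := ?a))"
  have v: "rep ?t 3 [Disc 3 2 0, Disc 0 2 1, Cap 4] (f(0 := ?a)) v"
    using a' CD by (auto simp: rep_def v_def tangle_def labelling_def f_def)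
  have "rep s 2 [Cup 0, Cup 1, Disc 0 2 2, Cap 5, Cap 4] f ?a"
    using rep_fourier[OF rep_fourier[OF R(1)]] by (simp add: numeral_2_eq_2[symmetric])
  then have "rep ?t 3 (plug 0 [Cup 0, Cup 1, Disc 0 2 2, Cap 5, Cap 4] [Disc 3 2 0, Disc 0 2 1, Cap
      4]) f v"
    by (intro rep_plug[OF v, where n = 2 and i = 1]) auto
  then have "rep ?t 3 [Disc 3 2 0, Cup 1, Cup 2, Disc 0 2 3, Cap 6, Cap 5, Cap 4] f v"
      by (simp add: numeral_2_eq_2[symmetric] numeral_3_eq_3[symmetric])
  from closed_value_tr[OF rep_mult[OF this u]]
  have 1: "closed_value ?t [Disc 3 2 0, Cup 1, Cup 2, Disc 0 2 3, Cap 6, Cap 5, Cap 4, Disc 2 2 6,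
      Disc 1 2 9, Cap 12,
      Cap 5, Cap 4, Cap 3, Cap 2, Cap 1, Cap 0] f (tr A 3 ?t (mult A 3 ?t v u))"
          by (simp add: interval3)
  have "adj A 2 ?t (mult A 2 ?t c d) = mult A 2 ?t ?D ?C" by (rule adj_mult2[OF c d])
  then have "closed_value ?t [Disc 3 2 0, Disc 2 2 4, Cap 3, Cap 2, Cup 4, Disc 0 2 5, Disc 1 2 9,
      Cap 8, Cap 7, Cap 8,
      Cap 3, Cap 2, Cap 1, Cap 0] f ?X"
    using closed_value_tr[OF rep_mult[OF rep_mult[OF R(4,3)] rep_fourier[OF rep_mult[OF R(1,2)]]]]
        by (simp add: upt_rec)
  from closed_value_isotopic[OF this 1 isotopic_pairing]
  have X: "?X = tr A 3 ?t (mult A 3 ?t (adj A 3 ?t (adj A 3 ?t v)) u)"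
      using adj_adj[OF rep_box[OF v]] by simp
  have "cmod ?X \<le> tr_norm A 3 ?t u * tr_norm A 3 ?t (adj A 3 ?t v)"
    unfolding X by (rule trace_Cauchy_Schwarz[OF rep_box[OF u] adj_closed[OF rep_box[OF v]]]) simp
  also have "tr_norm A 3 ?t u = tr_norm A 2 s b * tr_norm A 2 ?t c / sqrt (delta A)"
  proof (rule power2_eq_imp_eq)
    have "(tr_norm A 3 ?t u)\<^sup>2 = (tr_norm A 2 s b)\<^sup>2 * (tr_norm A 2 ?t ?C)\<^sup>2 / delta A"
      by (rule upper_half_norm[OF b CD(1) _ _ u]) (simp_all add: f_def)
    then show "(tr_norm A 3 ?t u)\<^sup>2 = (tr_norm A 2 s b * tr_norm A 2 ?t c / sqrt (delta A))\<^sup>2"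
      using delta_pos c by (simp add: tr_norm_adj power_mult_distrib power_divide)
  qed (use b c delta_pos rep_box[OF u] in auto)
  also have "tr_norm A 3 ?t (adj A 3 ?t v) = tr_norm A 2 s a * tr_norm A 2 ?t d / sqrt (delta A)"
  proof (rule power2_eq_imp_eq)
    have "(tr_norm A 3 ?t (adj A 3 ?t v))\<^sup>2 = (tr_norm A 2 s ?a)\<^sup>2 * (tr_norm A 2 ?t ?D)\<^sup>2 / delta A"
      by (rule lower_half_norm[OF a' CD(2) _ _ v]) (simp_all add: f_def)
    moreover have "tr_norm A 2 s ?a = tr_norm A 2 s a"
      using tr_norm_fourier[OF fourier_closed[OF a]] tr_norm_fourier[OF a] by simp
    ultimately show "(tr_norm A 3 ?t (adj A 3 ?t v))\<^sup>2
        = (tr_norm A 2 s a * tr_norm A 2 ?t d / sqrt (delta A))\<^sup>2"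
      using delta_pos d by (simp add: tr_norm_adj power_mult_distrib power_divide)
  qed (use a d delta_pos adj_closed[OF rep_box[OF v]] in auto)
  finally show ?thesis using delta_pos by (simp add: mult_ac)
qed

end

section \<open>Weighted power sums\<close>

text \<open>
  Normalize \<open>\<sigma>\<close> so that the sum with exponent \<open>p\<close> is \<open>1\<close>. As the weights are at least \<open>1\<close>, every
  normalized \<open>\<sigma> i\<close> is at most \<open>1\<close>, so raising the exponent decreases each term. Equality forces all
  of them to be \<open>1\<close>, and then there is room for a single term of weight \<open>1\<close> only.
\<close>

lemma weighted_power_sum_antimono:
  fixes \<sigma> w :: "'i \<Rightarrow> real"
  assumes S: "finite S" "\<And>i. i \<in> S \<Longrightarrow> 0 < \<sigma> i" "\<And>i. i \<in> S \<Longrightarrow> 1 \<le> w i" and pr: "0 < p" "p \<le> r"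
  shows "(\<Sum>i\<in>S. \<sigma> i powr r * w i) powr (1 / r) \<le> (\<Sum>i\<in>S. \<sigma> i powr p * w i) powr (1 / p)"
    and "p < r \<Longrightarrow> S \<noteq> {} \<Longrightarrow>
      (\<Sum>i\<in>S. \<sigma> i powr r * w i) powr (1 / r) = (\<Sum>i\<in>S. \<sigma> i powr p * w i) powr (1 / p) \<Longrightarrow>
      \<exists>i. S = {i} \<and> w i = 1"
proof -
  define X where "X = (\<Sum>i\<in>S. \<sigma> i powr p * w i)"
  define m where "m = X powr (1 / p)"
  have main: "(\<Sum>i\<in>S. \<sigma> i powr r * w i) powr (1 / r) \<le> m \<and>
     (p < r \<longrightarrow> (\<Sum>i\<in>S. \<sigma> i powr r * w i) powr (1 / r) = m \<longrightarrow> (\<exists>i. S = {i} \<and> w i = 1))" if "S \<noteq> {}"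
  proof -
    have w: "w i > 0" if "i \<in> S" for i using S(3)[OF that] by simp
    have X: "X > 0" unfolding X_def
    proof (rule sum_pos[OF S(1) that])
      show "0 < \<sigma> i powr p * w i" if "i \<in> S" for i using S(2)[OF that] w[OF that] by simp
    qed
    then have m: "m > 0" and mp: "m powr p = X" using pr by (simp_all add: m_def powr_powr)
    define y where "y i = \<sigma> i / m" for i
    have y0: "y i > 0" if "i \<in> S" for i using S(2)[OF that] m by (simp add: y_def)
    have sum1: "(\<Sum>i\<in>S. y i powr p * w i) = 1"
    proof -
      have "(\<Sum>i\<in>S. y i powr p * w i) = (\<Sum>i\<in>S. \<sigma> i powr p * w i / X)"
        by (rule sum.cong) (use S m mp in \<open>auto simp: y_def powr_divide less_imp_le\<close>)
      then show ?thesis using X by (simp add: sum_divide_distrib[symmetric] X_def[symmetric])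
    qed
    have y1: "y i powr p * w i \<le> 1" if "i \<in> S" for i
      unfolding sum1[symmetric] by (rule member_le_sum) (use that S w in \<open>auto simp: less_imp_le\<close>)
    have yle: "y i \<le> 1" if i: "i \<in> S" for i
    proof (rule ccontr)
      assume "\<not> y i \<le> 1"
      then have "1 < y i powr p" using pr by (simp add: gr_one_powr)
      then have "1 < y i powr p * w i" using S(3)[OF i] by (smt (verit) mult_le_cancel_left1)
      then show False using y1[OF i] by simp
    qed
    have decr: "y i powr r * w i \<le> y i powr p * w i" if i: "i \<in> S" for i
      using powr_mono'[OF pr(2)] y0[OF i] yle[OF i] w[OF i] by (simp add: less_imp_le)
    have sumr: "(\<Sum>i\<in>S. \<sigma> i powr r * w i) = m powr r * (\<Sum>i\<in>S. y i powr r * w i)"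
      unfolding sum_distrib_left by (rule sum.cong) (use S m in \<open>auto simp: y_def powr_divide
          less_imp_le\<close>)
    have ler: "(\<Sum>i\<in>S. y i powr r * w i) \<le> 1" unfolding sum1[symmetric] by (rule sum_mono) (rule decr)
    have posr: "0 < (\<Sum>i\<in>S. y i powr r * w i)"
    proof (rule sum_pos[OF S(1) that])
      show "0 < y i powr r * w i" if "i \<in> S" for i using y0[OF that] w[OF that] by simp
    qed
    have eq: "(\<Sum>i\<in>S. \<sigma> i powr r * w i) powr (1 / r) = m * (\<Sum>i\<in>S. y i powr r * w i) powr (1 / r)"
      unfolding sumr using m posr pr by (simp add: powr_mult powr_powr)
    have "(\<Sum>i\<in>S. y i powr r * w i) powr (1 / r) \<le> 1"
      using ler posr pr by (intro powr_le1) auto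
    then have "(\<Sum>i\<in>S. \<sigma> i powr r * w i) powr (1 / r) \<le> m" unfolding eq using m by simp
    moreover have "\<exists>i. S = {i} \<and> w i = 1" if lt: "p
        < r" and e: "(\<Sum>i\<in>S. \<sigma> i powr r * w i) powr (1 / r) = m"
    proof -
      have "(\<Sum>i\<in>S. y i powr r * w i) powr (1 / r) = 1" using e m unfolding eq by simp
      then have "((\<Sum>i\<in>S. y i powr r * w i) powr (1 / r)) powr r = 1" by simp
      then have "(\<Sum>i\<in>S. y i powr r * w i) = 1" using posr pr by (simp add: powr_powr)
      then have "(\<Sum>i\<in>S. y i powr p * w i - y i powr r * w i) = 0" by (simp add: sum_subtractf sum1)
      then have z: "y i powr p * w i - y i powr r * w i = 0" if "i \<in> S" for i
        using sum_nonneg_eq_0_iff[OF S(1), of "\<lambda>i. y i powr p * w i - y i powr r * w i"] decr that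
            by simp
      have y_eq: "y i = 1" if i: "i \<in> S" for i
      proof -
        have "y i powr p = y i powr r" using z[OF i] w[OF i] by simp
        then show ?thesis using y0[OF i] lt by (simp add: powr_def)
      qed
      have "(\<Sum>i\<in>S. w i) = 1" using sum1 y_eq by simp
      moreover have "real (card S) \<le> (\<Sum>i\<in>S. w i)" using sum_mono[of S "\<lambda>_. 1" w] S(3) by simp
      ultimately have "card S = 1" using \<open>S \<noteq> {}\<close> S(1)
          by (metis card_0_eq le_antisym less_one linorder_not_le of_nat_1 of_nat_le_iff)
      then obtain i where "S = {i}" by (auto simp: card_1_singleton_iff)
      then show ?thesis using \<open>(\<Sum>i\<in>S. w i) = 1\<close> by auto
    qed
    ultimately show ?thesis by blast
  qed
  show "(\<Sum>i\<in>S. \<sigma> i powr r * w i) powr (1 / r) \<le> (\<Sum>i\<in>S. \<sigma> i powr p * w i) powr (1 / p)"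
    using main by (cases "S = {}") (auto simp: m_def X_def)
  show "p < r \<Longrightarrow> S \<noteq> {} \<Longrightarrow>
      (\<Sum>i\<in>S. \<sigma> i powr r * w i) powr (1 / r) = (\<Sum>i\<in>S. \<sigma> i powr p * w i) powr (1 / p) \<Longrightarrow>
      \<exists>i. S = {i} \<and> w i = 1"
    using main by (auto simp: m_def X_def)
qed

text \<open>Normalize \<open>\<sigma>\<close> by its weighted quadratic mean and apply Young's inequality to each term.\<close>

lemma weighted_power_sum_Hoelder:
  fixes \<sigma> w :: "'i \<Rightarrow> real"
  assumes S: "finite S" "\<And>i. i \<in> S \<Longrightarrow> 0 < \<sigma> i" "\<And>i. i \<in> S \<Longrightarrow> 0 < w i"
    and W: "(\<Sum>i\<in>S. w i) \<le> W" and q: "0 < q" "q \<le> 2"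
  shows "(\<Sum>i\<in>S. \<sigma> i powr q * w i) powr (1 / q) \<le> W powr (1 / q - 1 / 2) * sqrt (\<Sum>i\<in>S. (\<sigma> i)\<^sup>2 * w i)"
proof (cases "S = {}")
  case False
  define X where "X = (\<Sum>i\<in>S. (\<sigma> i)\<^sup>2 * w i)"
  have X: "X > 0" unfolding X_def
  proof (rule sum_pos[OF S(1) False])
    show "0 < (\<sigma> i)\<^sup>2 * w i" if "i \<in> S" for i using S(2)[OF that] S(3)[OF that] by simp
  qed
  have W0: "W > 0" using W sum_pos[OF S(1) False, of w] S(3) by simp
  define m where "m = sqrt (X / W)"
  have m: "m > 0" "m\<^sup>2 = X / W" using X W0 by (simp_all add: m_def)
  define y where "y i = \<sigma> i / m" for i
  have y0: "y i > 0" if "i \<in> S" for i using S(2)[OF that] m by (simp add: y_def)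
  have young: "y i powr q \<le> (q / 2) * (y i)\<^sup>2 + (1 - q / 2)" if "i \<in> S" for i
  proof -
    have "((y i)\<^sup>2) powr (q / 2) * 1 powr (1 - q / 2) \<le> (q / 2) * (y i)\<^sup>2 + (1 - q / 2) * 1"
      using q y0[OF that] by (intro Youngs_inequality_0) auto
    moreover have "((y i)\<^sup>2) powr (q / 2) = y i powr q"
      using y0[OF that] by (simp add: powr_realpow[symmetric] powr_powr del: powr_numeral)
    ultimately show ?thesis by simp
  qed
  have "(\<Sum>i\<in>S. y i powr q * w i) \<le> (\<Sum>i\<in>S. (q / 2) * ((y i)\<^sup>2 * w i) + (1 - q / 2) * w i)"
  proof (rule sum_mono)
    fix i assume i: "i \<in> S"
    from mult_right_mono[OF young[OF i] less_imp_le[OF S(3)[OF i]]]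
    show "y i powr q * w i \<le> (q / 2) * ((y i)\<^sup>2 * w i) + (1 - q / 2) * w i" by (simp add: algebra_simps)
  qed
  also have "\<dots> = (q / 2) * (\<Sum>i\<in>S. (y i)\<^sup>2 * w i) + (1 - q / 2) * (\<Sum>i\<in>S. w i)"
    by (simp add: sum.distrib sum_distrib_left)
  also have "(\<Sum>i\<in>S. (y i)\<^sup>2 * w i) = W"
  proof -
    have "(\<Sum>i\<in>S. (y i)\<^sup>2 * w i) = X * (W / X)"
      unfolding X_def sum_distrib_right
      by (rule sum.cong) (use m X W0 in \<open>auto simp: y_def power_divide X_def[symmetric]\<close>)
    then show ?thesis using X by simp
  qed
  also have "(q / 2) * W + (1 - q / 2) * (\<Sum>i\<in>S. w i) \<le> (q / 2) * W + (1 - q / 2) * W"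
    using q W by (intro add_left_mono mult_left_mono) auto
  finally have le: "(\<Sum>i\<in>S. y i powr q * w i) \<le> W" by (simp add: algebra_simps)
  have "(\<Sum>i\<in>S. \<sigma> i powr q * w i) = m powr q * (\<Sum>i\<in>S. y i powr q * w i)"
    unfolding sum_distrib_left by (rule sum.cong) (use S m in \<open>auto simp: y_def powr_divide
        less_imp_le\<close>)
  also have "\<dots> \<le> m powr q * W" using le by (intro mult_left_mono) auto
  finally have "(\<Sum>i\<in>S. \<sigma> i powr q * w i) powr (1 / q) \<le> (m powr q * W) powr (1 / q)"
    using q S by (intro powr_mono2 sum_nonneg) (auto simp: less_imp_le)
  also have "\<dots> = m * W powr (1 / q)" using m W0 q by (simp add: powr_mult powr_powr)
  also have "\<dots> = W powr (1 / q - 1 / 2) * sqrt X"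
    using W0 X by (simp add: m_def real_sqrt_divide powr_diff powr_half_sqrt)
  finally show ?thesis by (simp add: X_def)
qed simp

section \<open>The three lines theorem\<close>

text \<open>
  Dividing by the exponential that interpolates the two bounds reduces the statement to \<open>A = B = 1\<close>.
  The factor \<open>exp (e (z\<^sup>2 - 1))\<close> has modulus at most \<open>1\<close> in the strip and decays for large imaginary
  part, so the maximum principle on a long rectangle applies; then \<open>e\<close> tends to \<open>0\<close>.
\<close>

lemma three_lines:
  fixes f :: "complex \<Rightarrow> complex"
  assumes hol: "f holomorphic_on UNIV"
    and bounded: "\<And>z. 0 \<le> Re z \<Longrightarrow> Re z \<le> 1 \<Longrightarrow> cmod (f z) \<le> K"
    and left: "\<And>z. Re z = 0 \<Longrightarrow> cmod (f z) \<le> A" and right: "\<And>z. Re z = 1 \<Longrightarrow> cmod (f z) \<le> B"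
    and AB: "0 < A" "0 < B" and t: "0 \<le> t" "t \<le> 1"
  shows "cmod (f (of_real t)) \<le> A powr (1 - t) * B powr t"
proof -
  define h :: "complex \<Rightarrow> complex" where "h z = f z * exp ((z - 1) * ln A - z * ln B)" for z
  have cmod_h: "cmod (h z) = cmod (f z) * exp ((Re z - 1) * ln A - Re z * ln B)" for z
    by (simp add: h_def norm_mult)
  define C where "C = exp (\<bar>ln A\<bar> + \<bar>ln B\<bar>)"
  have K0: "0 \<le> K" using bounded[of 0] norm_ge_zero[of "f 0"] by (simp del: norm_ge_zero)
  have h_bound: "cmod (h z) \<le> K * C" if "0 \<le> Re z" "Re z \<le> 1" for z
  proof -
    have "(Re z - 1) * ln A \<le> \<bar>Re z - 1\<bar> * \<bar>ln A\<bar>" "- (Re z * ln B) \<le> \<bar>Re z\<bar> * \<bar>ln B\<bar>"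
      unfolding abs_mult[symmetric] by linarith+
    moreover have "\<bar>Re z - 1\<bar> * \<bar>ln A\<bar> \<le> 1 * \<bar>ln A\<bar>" "\<bar>Re z\<bar> * \<bar>ln B\<bar> \<le> 1 * \<bar>ln B\<bar>"
      by (rule mult_right_mono; use that in simp)+
    ultimately have "(Re z - 1) * ln A \<le> \<bar>ln A\<bar>" "- (Re z * ln B) \<le> \<bar>ln B\<bar>" by linarith+
    then have "exp ((Re z - 1) * ln A - Re z * ln B) \<le> C" by (simp add: C_def)
    then show ?thesis unfolding cmod_h using bounded[OF that] K0 by (intro mult_mono) auto
  qed
  have h_left: "cmod (h z) \<le> 1" if "Re z = 0" for z
    using left[OF that] AB unfolding cmod_h that by (simp add: exp_minus divide_simps)
  have h_right: "cmod (h z) \<le> 1" if "Re z = 1" for z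
    using right[OF that] AB unfolding cmod_h that by (simp add: exp_minus divide_simps)
  have damped: "cmod (h (of_real t) * exp (of_real e * ((of_real t)\<^sup>2 - 1))) \<le> 1" if e: "e > 0" for e
  proof -
    define g where "g z = h z * exp (of_real e * (z\<^sup>2 - 1))" for z
    have cmod_g: "cmod (g z) = cmod (h z) * exp (e * ((Re z)\<^sup>2 - (Im z)\<^sup>2 - 1))" for z
      by (simp add: g_def norm_mult power2_eq_square)
    \<comment> \<open>Half the height of the rectangle, large enough for the decay to beat the bound \<open>K C\<close>.\<close>
    define R where "R = 1 + K * C / e"
    have KC: "0 \<le> K * C" using K0 by (simp add: C_def)
    then have R: "R \<ge> 1" using e by (simp add: R_def)
    have far: "K * C * exp (- (e * R\<^sup>2)) \<le> 1"
    proof -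
      have "R \<le> R\<^sup>2" using R by (simp add: power2_eq_square)
      then have "e * R \<le> e * R\<^sup>2" using e by simp
      moreover have "K * C \<le> e * R" using e by (simp add: R_def field_simps)
      ultimately have "K * C \<le> exp (e * R\<^sup>2)" using exp_ge_add_one_self[of "e * R\<^sup>2"] by linarith
      then show ?thesis by (simp add: exp_minus divide_simps)
    qed
    let ?S = "cbox (Complex 0 (- R)) (Complex 1 R)"
    have "cmod (g (of_real t)) \<le> 1"
    proof (rule maximum_modulus_frontier[of g ?S])
      have "g holomorphic_on UNIV" unfolding g_def h_def by (intro holomorphic_intros hol)
      then show "g holomorphic_on interior ?S" "continuous_on (closure ?S) g"
        by (auto intro: holomorphic_on_subset holomorphic_on_imp_continuous_on continuous_on_subset)
      show "bounded ?S" by (rule bounded_cbox)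
      show "of_real t \<in> ?S" using t R by (simp add: in_cbox_complex_iff)
      fix z assume "z \<in> frontier ?S"
      then have "z \<in> ?S" "z \<notin> Topology_Euclidean_Space.box (Complex 0 (- R)) (Complex 1 R)"
        by (auto simp: frontier_def interior_cbox)
      then have z: "0 \<le> Re z" "Re z \<le> 1" "- R \<le> Im z" "Im z \<le> R"
        and edge: "Re z = 0 \<or> Re z = 1 \<or> Im z = - R \<or> Im z = R"
        by (auto simp: in_cbox_complex_iff in_box_complex_iff)
      have sq: "(Re z)\<^sup>2 \<le> 1" using z(1,2) by (simp add: power_le_one)
      show "cmod (g z) \<le> 1"
      proof (cases "Re z = 0 \<or> Re z = 1")
        case True
        then have "cmod (h z) \<le> 1" using h_left h_right by blast
        moreover have "e * ((Re z)\<^sup>2 - (Im z)\<^sup>2 - 1) \<le> 0" using e sq zero_le_power2[of "Im z"]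
            by (intro mult_nonneg_nonpos) linarith+
        ultimately show ?thesis unfolding cmod_g by (intro mult_le_one) auto
      next
        case False
        then have "(Im z)\<^sup>2 = R\<^sup>2" using edge by auto
        then have "e * ((Re z)\<^sup>2 - (Im z)\<^sup>2 - 1) \<le> e * (- R\<^sup>2)" using e sq
            by (intro mult_left_mono) auto
        then have "cmod (g z) \<le> K * C * exp (- (e * R\<^sup>2))"
          unfolding cmod_g using h_bound[OF z(1,2)] KC by (intro mult_mono) auto
        then show ?thesis using far by linarith
      qed
    qed
    then show ?thesis by (simp add: g_def)
  qed
  have lim: "((\<lambda>e. cmod (h (of_real t) * exp (of_real e * ((of_real t)\<^sup>2 - 1)))) \<longlongrightarrow>
      cmod (h (of_real t) * exp (of_real 0 * ((of_real t)\<^sup>2 - 1)))) (at_right 0)"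
    by (intro tendsto_intros)
  have "cmod (h (of_real t)) \<le> 1"
    using tendsto_upperbound[OF lim, of 1] damped
        by (simp add: eventually_at_right_less eventually_at_filter)
  then have "cmod (f (of_real t)) * exp ((t - 1) * ln A - t * ln B) \<le> 1" unfolding cmod_h by simp
  moreover have "exp ((t - 1) * ln A - t * ln B) = inverse (A powr (1 - t) * B powr t)"
    using AB by (simp add: powr_def exp_minus[symmetric] exp_add[symmetric] algebra_simps)
  ultimately have "cmod (f (of_real t)) * inverse (A powr (1 - t) * B powr t) \<le> 1" by simp
  moreover have "0 < A powr (1 - t) * B powr t" using AB by simp
  ultimately show ?thesis by (simp only: inverse_eq_divide times_divide_eq_right mult_1_right
      pos_divide_le_eq mult_1_left)
qed

section \<open>Finite-dimensional tracial algebras\<close>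

text \<open>
  The part of the structure of a box space that functional calculus needs: a finite-dimensional
  \<open>*\<close>-algebra with a faithful positive trace.
\<close>

locale tracial_box =
  fixes A :: "('a::ab_group_add, 'm) planar_data_scheme" and n :: nat and s :: sign
  assumes scalars: "vector_space (smul A)"
    and subspace_carrier: "module.subspace (smul A) (box A n s)"
    and finite_dimensional: "\<exists>B. finite B \<and> box A n s \<subseteq> module.span (smul A) B"
    and one_in: "one A n s \<in> box A n s"
    and mult_in: "x \<in> box A n s \<Longrightarrow> y \<in> box A n s \<Longrightarrow> mult A n s x y \<in> box A n s"
    and adj_in: "x \<in> box A n s \<Longrightarrow> adj A n s x \<in> box A n s"
    and distrib_right: "x \<in> box A n s \<Longrightarrow> y \<in> box A n s \<Longrightarrow> z \<in> box A n s
      \<Longrightarrow> mult A n s (x + y) z = mult A n s x z + mult A n s y z"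
    and distrib_left: "x \<in> box A n s \<Longrightarrow> y \<in> box A n s \<Longrightarrow> z \<in> box A n s
      \<Longrightarrow> mult A n s z (x + y) = mult A n s z x + mult A n s z y"
    and smul_left: "x \<in> box A n s \<Longrightarrow> y \<in> box A n s
        \<Longrightarrow> mult A n s (smul A c x) y = smul A c (mult A n s x y)"
    and smul_right: "x \<in> box A n s \<Longrightarrow> y \<in> box A n s
        \<Longrightarrow> mult A n s x (smul A c y) = smul A c (mult A n s x y)"
    and assoc: "x \<in> box A n s \<Longrightarrow> y \<in> box A n s \<Longrightarrow> z \<in> box A n s
      \<Longrightarrow> mult A n s (mult A n s x y) z = mult A n s x (mult A n s y z)"
    and one_left: "x \<in> box A n s \<Longrightarrow> mult A n s (one A n s) x = x"
    and one_right: "x \<in> box A n s \<Longrightarrow> mult A n s x (one A n s) = x"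
    and adj_adj': "x \<in> box A n s \<Longrightarrow> adj A n s (adj A n s x) = x"
    and adj_add': "x \<in> box A n s \<Longrightarrow> y \<in> box A n s \<Longrightarrow> adj A n s (x + y) = adj A n s x + adj A n s y"
    and adj_smul': "x \<in> box A n s \<Longrightarrow> adj A n s (smul A c x) = smul A (cnj c) (adj A n s x)"
    and adj_mult: "x \<in> box A n s \<Longrightarrow> y \<in> box A n s
      \<Longrightarrow> adj A n s (mult A n s x y) = mult A n s (adj A n s y) (adj A n s x)"
    and trace_add: "x \<in> box A n s \<Longrightarrow> y \<in> box A n s \<Longrightarrow> tr A n s (x + y) = tr A n s x + tr A n s y"
    and trace_smul: "x \<in> box A n s \<Longrightarrow> tr A n s (smul A c x) = c * tr A n s x"
    and trace_comm: "x \<in> box A n s \<Longrightarrow> y \<in> box A n s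
        \<Longrightarrow> tr A n s (mult A n s x y) = tr A n s (mult A n s y x)"
    and trace_norm: "x \<in> box A n s \<Longrightarrow> tr A n s (mult A n s (adj A n s x) x)
        = of_real ((tr_norm A n s x)\<^sup>2)"
    and trace_norm_nonneg: "x \<in> box A n s \<Longrightarrow> 0 \<le> tr_norm A n s x"
    and trace_norm_pos: "x \<in> box A n s \<Longrightarrow> x \<noteq> 0 \<Longrightarrow> 0 < tr_norm A n s x"
begin

sublocale W: vector_space "smul A"
  by (rule scalars)

abbreviation carrier_box ("\<C>") where "\<C> \<equiv> box A n s"
abbreviation times_box (infixl "\<odot>" 70) where "x \<odot> y \<equiv> mult A n s x y"
abbreviation star_box ("_\<dagger>" [1000] 999) where "x\<dagger> \<equiv> adj A n s x"
abbreviation one_box ("\<one>") where "\<one> \<equiv> one A n s"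
abbreviation trace_box ("\<tau>") where "\<tau> \<equiv> tr A n s"
abbreviation smul_box (infixr "\<cdot>" 75) where "c \<cdot> x \<equiv> smul A c x"
abbreviation norm_box ("\<parallel>_\<parallel>") where "\<parallel>x\<parallel> \<equiv> tr_norm A n s x"

lemma zero_in [simp]: "0 \<in> \<C>"
  by (rule W.subspace_0[OF subspace_carrier])

lemma add_in: "x \<in> \<C> \<Longrightarrow> y \<in> \<C> \<Longrightarrow> x + y \<in> \<C>"
  by (rule W.subspace_add[OF subspace_carrier])

lemma diff_in: "x \<in> \<C> \<Longrightarrow> y \<in> \<C> \<Longrightarrow> x - y \<in> \<C>"
  by (rule W.subspace_diff[OF subspace_carrier])

lemma smul_in: "x \<in> \<C> \<Longrightarrow> c \<cdot> x \<in> \<C>"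
  by (rule W.subspace_scale[OF subspace_carrier])

lemma sum_in: "(\<And>i. i \<in> I \<Longrightarrow> x i \<in> \<C>) \<Longrightarrow> (\<Sum>i\<in>I. x i) \<in> \<C>"
  by (rule W.subspace_sum[OF subspace_carrier])

lemmas in_carrier = one_in mult_in adj_in add_in diff_in smul_in sum_in

lemma mult_zero [simp]: "x \<in> \<C> \<Longrightarrow> 0 \<odot> x = 0" "x \<in> \<C> \<Longrightarrow> x \<odot> 0 = 0"
  using smul_left[of 0 x 0] smul_right[of x 0 0] by simp_all

lemma adj_zero [simp]: "0\<dagger> = 0"
  using adj_smul'[of 0 0] by simp

lemma trace_zero [simp]: "\<tau> 0 = 0"
  using trace_smul[of 0 0] by simp

lemma diff_eq: "x - y = x + (- 1) \<cdot> y"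
  by simp

lemma mult_diff_left: "x \<in> \<C> \<Longrightarrow> y \<in> \<C> \<Longrightarrow> z \<in> \<C> \<Longrightarrow> (x - y) \<odot> z = x \<odot> z - y \<odot> z"
  unfolding diff_eq by (simp only: distrib_right smul_left in_carrier)

lemma mult_diff_right: "x \<in> \<C> \<Longrightarrow> y \<in> \<C> \<Longrightarrow> z \<in> \<C> \<Longrightarrow> z \<odot> (x - y) = z \<odot> x - z \<odot> y"
  unfolding diff_eq by (simp only: distrib_left smul_right in_carrier)

lemma adj_diff: "x \<in> \<C> \<Longrightarrow> y \<in> \<C> \<Longrightarrow> (x - y)\<dagger> = x\<dagger> - y\<dagger>"
  unfolding diff_eq by (simp add: adj_add' adj_smul' in_carrier del: W.scale_minus_left)

lemma trace_diff: "x \<in> \<C> \<Longrightarrow> y \<in> \<C> \<Longrightarrow> \<tau> (x - y) = \<tau> x - \<tau> y"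
  unfolding diff_eq by (simp add: trace_add trace_smul in_carrier del: W.scale_minus_left)

lemma mult_sum_left: "y \<in> \<C> \<Longrightarrow> (\<And>i. i \<in> I \<Longrightarrow> x i \<in> \<C>) \<Longrightarrow> (\<Sum>i\<in>I. x i) \<odot> y = (\<Sum>i\<in>I. x i \<odot> y)"
  by (induction I rule: infinite_finite_induct) (simp_all add: distrib_right in_carrier)

lemma mult_sum_right: "y \<in> \<C> \<Longrightarrow> (\<And>i. i \<in> I \<Longrightarrow> x i \<in> \<C>) \<Longrightarrow> y \<odot> (\<Sum>i\<in>I. x i) = (\<Sum>i\<in>I. y \<odot> x i)"
  by (induction I rule: infinite_finite_induct) (simp_all add: distrib_left in_carrier)

lemma adj_sum: "(\<And>i. i \<in> I \<Longrightarrow> x i \<in> \<C>) \<Longrightarrow> (\<Sum>i\<in>I. x i)\<dagger> = (\<Sum>i\<in>I. (x i)\<dagger>)"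
  by (induction I rule: infinite_finite_induct) (simp_all add: adj_add' in_carrier)

lemma trace_sum: "(\<And>i. i \<in> I \<Longrightarrow> x i \<in> \<C>) \<Longrightarrow> \<tau> (\<Sum>i\<in>I. x i) = (\<Sum>i\<in>I. \<tau> (x i))"
  by (induction I rule: infinite_finite_induct) (simp_all add: trace_add in_carrier)

lemma adj_one [simp]: "\<one>\<dagger> = \<one>"
  using adj_mult[of \<one> "\<one>\<dagger>"] one_left[of "\<one>\<dagger>"] one_right[of "\<one>\<dagger>"] by (simp add: adj_adj' in_carrier)

lemma norm_eq_zero_iff: "x \<in> \<C> \<Longrightarrow> \<parallel>x\<parallel> = 0 \<longleftrightarrow> x = 0"
  using trace_norm_pos[of x] trace_norm[of 0] by (cases "x = 0") auto

lemma adj_mult_self_zero: "x \<in> \<C> \<Longrightarrow> x\<dagger> \<odot> x = 0 \<Longrightarrow> x = 0"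
  using trace_norm[of x] norm_eq_zero_iff[of x] by simp

lemma norm_smul: "x \<in> \<C> \<Longrightarrow> \<parallel>c \<cdot> x\<parallel> = cmod c * \<parallel>x\<parallel>"
proof -
  assume x: "x \<in> \<C>"
  have "of_real (\<parallel>c \<cdot> x\<parallel>\<^sup>2) = (of_real ((cmod c * \<parallel>x\<parallel>)\<^sup>2) :: complex)"
    using trace_norm[OF smul_in[OF x], of c] trace_norm[OF x] complex_norm_square[of c] x
    by (simp add: adj_smul' smul_left smul_right trace_smul in_carrier power_mult_distrib mult_ac)
  then have "\<parallel>c \<cdot> x\<parallel>\<^sup>2 = (cmod c * \<parallel>x\<parallel>)\<^sup>2" by (simp only: of_real_eq_iff)
  then show ?thesis by (rule power2_eq_imp_eq) (use x in \<open>auto simp: trace_norm_nonneg in_carrier\<close>)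
qed

subsection \<open>Polynomial calculus and the spectral theorem\<close>

definition poly_value :: "'a \<Rightarrow> complex poly \<Rightarrow> 'a" where
  "poly_value a p = fold_coeffs (\<lambda>c v. c \<cdot> \<one> + a \<odot> v) p 0"

lemma poly_value_0 [simp]: "poly_value a 0 = 0"
  by (simp add: poly_value_def)

lemma poly_value_pCons: "a \<in> \<C> \<Longrightarrow> poly_value a (pCons c p) = c \<cdot> \<one> + a \<odot> poly_value a p"
  by (cases "c = 0 \<and> p = 0") (auto simp: poly_value_def)

lemma poly_value_in: "a \<in> \<C> \<Longrightarrow> poly_value a p \<in> \<C>"
  by (induction p) (simp_all add: poly_value_pCons in_carrier)

lemma poly_value_add: "a \<in> \<C> \<Longrightarrow> poly_value a (p + q) = poly_value a p + poly_value a q"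
  by (induction p q rule: poly_induct2)
    (simp_all add: poly_value_pCons distrib_left W.scale_left_distrib poly_value_in algebra_simps)

lemma poly_value_smult: "a \<in> \<C> \<Longrightarrow> poly_value a (smult c p) = c \<cdot> poly_value a p"
  by (induction p) (simp_all add: poly_value_pCons smul_right W.scale_right_distrib poly_value_in
      in_carrier)

lemma poly_value_diff: "a \<in> \<C> \<Longrightarrow> poly_value a (p - q) = poly_value a p - poly_value a q"
  using poly_value_add[of a "p - q" q] by (simp add: algebra_simps)

lemma poly_value_mult: "a \<in> \<C> \<Longrightarrow> poly_value a (p * q) = poly_value a p \<odot> poly_value a q"
  by (induction p)
    (simp_all add: poly_value_pCons poly_value_add poly_value_smult distrib_right smul_left assoc
        one_left
      poly_value_in in_carrier)

lemma poly_value_sum: "a \<in> \<C> \<Longrightarrow> poly_value a (\<Sum>i\<in>I. p i) = (\<Sum>i\<in>I. poly_value a (p i))"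
  by (induction I rule: infinite_finite_induct) (simp_all add: poly_value_add)

lemma poly_value_1 [simp]: "a \<in> \<C> \<Longrightarrow> poly_value a 1 = \<one>"
  unfolding one_pCons by (simp add: poly_value_pCons)

lemma poly_value_linear: "a \<in> \<C> \<Longrightarrow> poly_value a [:- r, 1:] = a - r \<cdot> \<one>"
  by (simp add: poly_value_pCons one_right)

lemma ex_annihilating_poly:
  assumes a: "a \<in> \<C>"
  shows "\<exists>p. p \<noteq> 0 \<and> poly_value a p = 0"
proof -
  obtain B where B: "finite B" "\<C> \<subseteq> W.span B" using finite_dimensional by blast
  define x where "x i = poly_value a (monom 1 i)" for i
  let ?I = "{..card B}"
  show ?thesis
  proof (cases "inj_on x ?I")
    case False
    then obtain i j where "i \<noteq> j" "x i = x j" by (auto simp: inj_on_def)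
    then have "poly_value a (monom 1 i - monom 1 j) = 0" using a by (simp add: poly_value_diff x_def)
    moreover have "monom 1 i - monom 1 j \<noteq> (0 :: complex poly)" using \<open>i \<noteq> j\<close>
        by (simp add: monom_eq_iff')
    ultimately show ?thesis by blast
  next
    case True
    have "x ` ?I \<subseteq> W.span B" using poly_value_in[OF a] B(2) by (auto simp: x_def)
    then have "W.dependent (x ` ?I)"
      using W.independent_span_bound[OF B(1), of "x ` ?I"] True by (auto simp: card_image)
    then obtain u where u: "\<exists>v\<in>x ` ?I. u v \<noteq> 0" "(\<Sum>v\<in>x ` ?I. u v \<cdot> v) = 0"
      using W.dependent_finite[of "x ` ?I"] by auto
    define p where "p = (\<Sum>i\<in>?I. smult (u (x i)) (monom 1 i))"
    have "poly_value a p = (\<Sum>i\<in>?I. u (x i) \<cdot> x i)"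
      using a by (simp add: p_def poly_value_sum poly_value_smult x_def)
    also have "\<dots> = 0" using u(2) True by (simp add: sum.reindex)
    finally have "poly_value a p = 0" .
    moreover obtain i where i: "i \<in> ?I" "u (x i) \<noteq> 0" using u(1) by auto
    have "coeff p i = (\<Sum>j\<in>?I. if j = i then u (x j) else 0)"
      unfolding p_def coeff_sum by (rule sum.cong) auto
    then have "coeff p i = u (x i)" using i(1) by simp
    then have "p \<noteq> 0" using i(2) by auto
    ultimately show ?thesis by blast
  qed
qed

text \<open>
  The roots of the minimal polynomial of a self-adjoint element are eigenvalues, hence real because
  the trace form is positive definite. A double root \<open>z\<close> would give a nonzero element
  \<open>w = (a - z) v\<close> with \<open>w\<^sup>* w = v\<^sup>* (a - z)\<^sup>2 v = 0\<close>.
\<close>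

lemma ex_real_annihilating_roots:
  assumes a: "a \<in> \<C>" and self_adjoint: "a\<dagger> = a"
  shows "\<exists>R :: real set. finite R \<and> poly_value a (\<Prod>t\<in>R. [:- of_real t, 1:]) = 0"
proof -
  obtain p where p: "p \<noteq> 0" "poly_value a p = 0"
    and min: "\<And>q. q \<noteq> 0 \<Longrightarrow> poly_value a q = 0 \<Longrightarrow> degree p \<le> degree q"
  proof -
    obtain p where "p \<noteq> 0 \<and> poly_value a p = 0" using ex_annihilating_poly[OF a] by blast
    from ex_has_least_nat[of "\<lambda>p. p \<noteq> 0 \<and> poly_value a p = 0", OF this, of degree] that show thesis
        by auto
  qed
  have factor: "q \<noteq> 0 \<and> poly_value a q \<noteq> 0" if "p = [:- z, 1:] * q" for z q
  proof -
    have q: "q \<noteq> 0" using p(1) that by auto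
    then have "degree p = Suc (degree q)" using that degree_mult_eq[of "[:- z, 1:]" q] by simp
    then show ?thesis using min[OF q] q by auto
  qed
  have eigen: "a \<odot> poly_value a q = z \<cdot> poly_value a q" if "p = [:- z, 1:] * q" for z q
  proof -
    have "(a - z \<cdot> \<one>) \<odot> poly_value a q = 0"
      using p(2) a that by (metis poly_value_linear poly_value_mult)
    then show ?thesis
      using a by (simp add: mult_diff_left smul_left one_left poly_value_in in_carrier)
  qed
  have real: "z = of_real (Re z)" if root: "poly p z = 0" for z
  proof -
    obtain q where q: "p = [:- z, 1:] * q" using root unfolding poly_eq_0_iff_dvd by (rule dvdE)
    define w where "w = poly_value a q"
    have w: "w \<in> \<C>" "w \<noteq> 0" "a \<odot> w = z \<cdot> w"
      using factor[OF q] eigen[OF q] poly_value_in[OF a] by (simp_all add: w_def)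
    have "w\<dagger> \<odot> a = (a \<odot> w)\<dagger>" using adj_mult[OF a w(1)] self_adjoint by simp
    then have "w\<dagger> \<odot> a = cnj z \<cdot> w\<dagger>" using w by (simp add: adj_smul')
    then have "(cnj z) \<cdot> (w\<dagger> \<odot> w) = w\<dagger> \<odot> a \<odot> w" using w by (simp add: smul_left in_carrier)
    also have "\<dots> = z \<cdot> (w\<dagger> \<odot> w)" using w a by (simp add: assoc smul_right in_carrier)
    finally have "w\<dagger> \<odot> w = 0 \<or> cnj z = z" by auto
    then have "cnj z = z" using adj_mult_self_zero w by blast
    then show ?thesis by (simp add: complex_eq_iff)
  qed
  have simple: "order z p = 1" if "poly p z = 0" for z
  proof (rule ccontr)
    assume "order z p \<noteq> 1"
    moreover have "order z p \<noteq> 0" using that p(1) by (simp add: order_root)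
    ultimately have "2 \<le> order z p" by simp
    then have "[:- z, 1:] ^ 2 dvd p" by (meson order_1 dvd_trans le_imp_power_dvd)
    then obtain q where "p = [:- z, 1:] ^ 2 * q" by (auto elim: dvdE)
    then have q: "p = [:- z, 1:] * ([:- z, 1:] * q)" by (simp only: power2_eq_square mult.assoc)
    define w where "w = poly_value a ([:- z, 1:] * q)"
    have w: "w \<in> \<C>" "w \<noteq> 0" "a \<odot> w = z \<cdot> w"
      using factor[OF q] eigen[OF q] poly_value_in[OF a] by (simp_all add: w_def)
    define v where "v = poly_value a q"
    have v: "v \<in> \<C>" using poly_value_in[OF a] by (simp add: v_def)
    have wv: "w = (a - z \<cdot> \<one>) \<odot> v" using a by (simp only: w_def v_def poly_value_mult poly_value_linear)
    have "(a - z \<cdot> \<one>)\<dagger> = a - z \<cdot> \<one>"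
      using a self_adjoint real[OF that] by (metis adj_diff adj_one adj_smul'
          complex_cnj_complex_of_real one_in smul_in)
    then have "w\<dagger> \<odot> w = v\<dagger> \<odot> ((a - z \<cdot> \<one>) \<odot> w)"
      using a v w by (simp add: wv adj_mult assoc in_carrier)
    also have "(a - z \<cdot> \<one>) \<odot> w = 0" using a w
        by (simp add: mult_diff_left smul_left one_left in_carrier)
    finally have "w\<dagger> \<odot> w = 0" using v by (simp add: in_carrier)
    then show False using adj_mult_self_zero w by blast
  qed
  let ?Z = "{z. poly p z = 0}"
  have Z: "finite ?Z" by (rule poly_roots_finite[OF p(1)])
  have "poly_value a (smult (lead_coeff p) (\<Prod>z\<in>?Z. [:- z, 1:])) = 0"
  proof -
    have "(\<Prod>z\<in>?Z. [:- z, 1:]) = (\<Prod>z\<in>?Z. [:- z, 1:] ^ order z p)"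
      by (rule prod.cong) (auto simp: simple)
    then show ?thesis using complex_poly_decompose[of p] p(2) by simp
  qed
  then have "poly_value a (\<Prod>z\<in>?Z. [:- z, 1:]) = 0" using p(1) a by (simp add: poly_value_smult)
  moreover have "(\<Prod>z\<in>?Z. [:- z, 1:]) = (\<Prod>t\<in>Re ` ?Z. [:- of_real t, 1:])"
  proof -
    have "inj_on Re ?Z" by (rule inj_onI) (metis (mono_tags) mem_Collect_eq real)
    then have "(\<Prod>t\<in>Re ` ?Z. [:- complex_of_real t, 1:]) = (\<Prod>z\<in>?Z. [:- complex_of_real (Re z), 1:])"
      by (simp add: prod.reindex)
    also have "\<dots> = (\<Prod>z\<in>?Z. [:- z, 1:])" by (rule prod.cong) (use real in auto)
    finally show ?thesis by simp
  qed
  ultimately show ?thesis using Z by (intro exI[of _ "Re ` ?Z"]) simp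
qed

text \<open>
  The spectral projections are the Lagrange polynomials of the roots, evaluated at \<open>a\<close>. They are
  eigenvectors for distinct real eigenvalues, which makes them orthogonal, and with their sum being
  \<open>1\<close> this also gives idempotence and self-adjointness.
\<close>

lemma ex_spectral_decomp:
  assumes a: "a \<in> \<C>" and self_adjoint: "a\<dagger> = a"
  shows "\<exists>L e. spectral_decomp A n s a L e"
proof -
  obtain R :: "real set" where R: "finite R" "poly_value a (\<Prod>t\<in>R. [:- of_real t, 1:]) = 0"
    using ex_real_annihilating_roots[OF assms] by blast
  define l :: "real \<Rightarrow> complex poly" where "l t
      = (\<Prod>u\<in>R - {t}. smult (inverse (of_real t - of_real u)) [:- of_real u, 1:])" for t
  define e where "e t = poly_value a (l t)" for t
  have e: "e t \<in> \<C>" for t using poly_value_in[OF a] by (simp add: e_def)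
  have eigen: "a \<odot> e t = of_real t \<cdot> e t" if t: "t \<in> R" for t
  proof -
    have "l t = smult (\<Prod>u\<in>R - {t}. inverse (of_real t - of_real u)) (\<Prod>u\<in>R - {t}. [:- of_real u, 1:])"
      unfolding l_def by (rule prod_smult)
    moreover have "(\<Prod>u\<in>R. [:- complex_of_real u, 1:])
        = [:- of_real t, 1:] * (\<Prod>u\<in>R - {t}. [:- of_real u, 1:])"
      using R(1) t by (simp add: prod.remove)
    ultimately have "[:- of_real t, 1:] * l t
        = smult (\<Prod>u\<in>R - {t}. inverse (of_real t - of_real u)) (\<Prod>u\<in>R. [:- of_real u, 1:])"
      by (simp add: mult_smult_right)
    then have "poly_value a ([:- of_real t, 1:] * l t) = 0"
      using R(2) a by (simp add: poly_value_smult del: mult_pCons_left)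
    then have "(a - of_real t \<cdot> \<one>) \<odot> e t = 0"
      using a by (simp only: poly_value_mult poly_value_linear e_def)
    then show ?thesis using a e by (simp add: mult_diff_left smul_left one_left in_carrier)
  qed
  have sum: "(\<Sum>t\<in>R. e t) = \<one>"
  proof (cases "R = {}")
    case True
    then show ?thesis using R(2) a by simp
  next
    case False
    have deg: "degree (l t) < card R" if "t \<in> R" for t
    proof -
      have "degree (l t) \<le> (\<Sum>u\<in>R - {t}. degree (smult (inverse (complex_of_real t - of_real u)) [:-
          of_real u, 1:]))"
        unfolding l_def by (rule degree_prod_sum_le[unfolded o_def]) (use R(1) in simp)
      also have "\<dots> \<le> (\<Sum>u\<in>R - {t}. 1)" by (rule sum_mono) simp
      also have "\<dots> < card R" using card_Diff1_less[OF R(1) that] by simp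
      finally show ?thesis .
    qed
    have "(\<Sum>t\<in>R. l t) = 1"
    proof (rule poly_eqI_degree[where A = "complex_of_real ` R"])
      fix x assume "x \<in> complex_of_real ` R"
      then obtain v where v: "v \<in> R" "x = of_real v" by auto
      have "poly (l t) x = (if t = v then 1 else 0)" if t: "t \<in> R" for t
      proof (cases "t = v")
        case True
        have "poly (smult (inverse (of_real v - of_real u)) [:- of_real u, 1:]) (complex_of_real v) = 1"
          if "u \<noteq> v" for u
        proof -
          have "complex_of_real v - of_real u \<noteq> 0" using that by simp
          moreover have "poly (smult (inverse (of_real v - of_real u)) [:- of_real u, 1:])
              (complex_of_real v)
              = inverse (of_real v - of_real u) * (of_real v - of_real u)" by (simp add: algebra_simps)
          ultimately show ?thesis by simp
        qed
        then show ?thesis using True unfolding l_def poly_prod v by (auto intro!: prod.neutral)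
      next
        case False
        then have "v \<in> R - {t}" using v by simp
        then show ?thesis using False R(1) by (auto simp: l_def poly_prod v intro!: prod_zero)
      qed
      then have "poly (\<Sum>t\<in>R. l t) x = (\<Sum>t\<in>R. if t = v then 1 else 0)" by (simp add: poly_sum)
      then show "poly (\<Sum>t\<in>R. l t) x = poly 1 x" using v R(1) by simp
    next
      have card: "card (complex_of_real ` R) = card R" by (simp add: card_image inj_on_def)
      show "degree (\<Sum>t\<in>R. l t) < card (complex_of_real ` R)"
        unfolding card by (rule degree_sum_less) (use deg False R(1) in \<open>auto simp: card_gt_0_iff\<close>)
      show "degree (1 :: complex poly) < card (complex_of_real ` R)"
        unfolding card using False R(1) by (simp add: card_gt_0_iff)
    qed
    then show ?thesis using a by (simp add: e_def poly_value_sum[symmetric])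
  qed
  have commute: "e t \<odot> a = a \<odot> e t" for t
    using a poly_value_mult[of a "l t" "[:0, 1:]"] poly_value_mult[of a "[:0, 1:]" "l t"]
    by (simp add: e_def mult.commute poly_value_pCons one_right del: mult_pCons_left mult_pCons_right)
  \<comment> \<open>A left eigenvector and a right eigenvector for different eigenvalues are orthogonal.\<close>
  have eigen_orth: "e t \<odot> x = 0" if "t \<in> R" "u \<noteq> t" "x \<in> \<C>" "a \<odot> x = of_real u \<cdot> x" for t u x
  proof -
    have "of_real t \<cdot> (e t \<odot> x) = e t \<odot> a \<odot> x" using that e a by (simp add: commute eigen smul_left)
    also have "\<dots> = of_real u \<cdot> (e t \<odot> x)" using that e a by (simp add: assoc smul_right)
    finally show ?thesis using that(2) by simp
  qed
  have orth: "e t \<odot> e u = 0" if "t \<in> R" "u \<in> R" "t \<noteq> u" for t u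
    using eigen_orth[of t u "e u"] that e eigen by simp
  have idem: "e t \<odot> e t = e t" if "t \<in> R" for t
  proof -
    have "e t = (\<Sum>u\<in>R. e u) \<odot> e t" using e by (simp add: sum one_left)
    also have "\<dots> = (\<Sum>u\<in>R. if u = t then e t \<odot> e t else 0)"
      using e by (subst mult_sum_left) (auto intro!: sum.cong simp: orth that)
    finally show ?thesis using that R(1) by simp
  qed
  have sa: "(e t)\<dagger> = e t" if t: "t \<in> R" for t
  proof -
    have "(a \<odot> e t)\<dagger> = (e t)\<dagger> \<odot> a" "(e t \<odot> a)\<dagger> = a \<odot> (e t)\<dagger>" using e a self_adjoint
        by (simp_all add: adj_mult)
    then have "a \<odot> (e t)\<dagger> = (of_real t \<cdot> e t)\<dagger>" using eigen[OF t] commute by metis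
    then have "a \<odot> (e t)\<dagger> = of_real t \<cdot> (e t)\<dagger>" using e by (simp add: adj_smul')
    then have o: "e u \<odot> (e t)\<dagger> = 0" if "u \<in> R" "u \<noteq> t" for u
      using eigen_orth[of u t "(e t)\<dagger>"] that e by (auto simp: in_carrier)
    have "(e t)\<dagger> = (\<Sum>u\<in>R. e u) \<odot> (e t)\<dagger>" using e by (simp add: sum one_left in_carrier)
    also have "\<dots> = (\<Sum>u\<in>R. if u = t then e t \<odot> (e t)\<dagger> else 0)"
      using e by (subst mult_sum_left) (auto intro!: sum.cong simp: o in_carrier)
    finally have *: "(e t)\<dagger> = e t \<odot> (e t)\<dagger>" using t R(1) by simp
    then have "((e t)\<dagger>)\<dagger> = (e t)\<dagger>" using e by (metis adj_adj' adj_in adj_mult)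
    then show ?thesis using e by (simp add: adj_adj')
  qed
  have "a = a \<odot> (\<Sum>t\<in>R. e t)" using a by (simp add: sum one_right)
  also have "\<dots> = (\<Sum>t\<in>R. of_real t \<cdot> e t)" using a e by (simp add: mult_sum_right eigen)
  finally have "spectral_decomp A n s a R e"
    unfolding spectral_decomp_def is_projection_def using R(1) e sa idem orth sum by auto
  then show ?thesis by blast
qed

end

context tracial_box
begin

subsection \<open>Functional calculus and p-norms\<close>

lemma projectionD:
  assumes "is_projection A n s f"
  shows "f \<in> \<C>" "f\<dagger> = f" "f \<odot> f = f" "\<tau> f = of_real (\<parallel>f\<parallel>\<^sup>2)"
  using assms trace_norm[of f] by (simp_all add: is_projection_def)

lemma norm_trace_one_projection:
  assumes "is_projection A n s f" "\<tau> f = 1"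
  shows "\<parallel>f\<parallel> = 1"
proof -
  have "complex_of_real (\<parallel>f\<parallel>\<^sup>2) = of_real 1" using projectionD(4)[OF assms(1)] assms(2) by simp
  then have "\<parallel>f\<parallel>\<^sup>2 = 1" by (simp only: of_real_eq_iff)
  then show ?thesis using trace_norm_nonneg[OF projectionD(1)[OF assms(1)]]
      by (simp add: power2_eq_1_iff)
qed

lemma spectral_decompD:
  assumes "spectral_decomp A n s a L e"
  shows "finite L" "\<And>t. t \<in> L \<Longrightarrow> is_projection A n s (e t)" "\<And>t. t \<in> L \<Longrightarrow> e t \<in> \<C>"
    "\<And>t u. t \<in> L \<Longrightarrow> u \<in> L \<Longrightarrow> e t \<odot> e u = (if t = u then e t else 0)"
    "(\<Sum>t\<in>L. e t) = \<one>" "a = (\<Sum>t\<in>L. of_real t \<cdot> e t)"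
  using assms by (auto simp: spectral_decomp_def is_projection_def)

lemma spectral_comb_mult:
  assumes "spectral_decomp A n s a L e" "u \<in> L"
  shows "(\<Sum>t\<in>L. c t \<cdot> e t) \<odot> e u = c u \<cdot> e u" "e u \<odot> (\<Sum>t\<in>L. c t \<cdot> e t) = c u \<cdot> e u"
proof -
  note D = spectral_decompD[OF assms(1)]
  have "(\<Sum>t\<in>L. c t \<cdot> e t) \<odot> e u = (\<Sum>t\<in>L. if t = u then c u \<cdot> e u else 0)"
    using D(3) assms(2) by (subst mult_sum_left) (auto intro!: sum.cong simp: smul_left D(4) in_carrier)
  then show "(\<Sum>t\<in>L. c t \<cdot> e t) \<odot> e u = c u \<cdot> e u" using D(1) assms(2) by simp
  have "e u \<odot> (\<Sum>t\<in>L. c t \<cdot> e t) = (\<Sum>t\<in>L. if t = u then c u \<cdot> e u else 0)"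
    using D(3) assms(2) by (subst mult_sum_right) (auto intro!: sum.cong simp: smul_right D(4)
        in_carrier)
  then show "e u \<odot> (\<Sum>t\<in>L. c t \<cdot> e t) = c u \<cdot> e u" using D(1) assms(2) by simp
qed

lemma spectral_mult:
  assumes "spectral_decomp A n s a L e" "t \<in> L"
  shows "a \<odot> e t = of_real t \<cdot> e t" "e t \<odot> a = of_real t \<cdot> e t"
  using spectral_comb_mult[OF assms, of of_real] spectral_decompD(6)[OF assms(1)] by simp_all

text \<open>
  Two spectral decompositions of the same element satisfy \<open>e t \<odot> f u = 0\<close> for \<open>t \<noteq> u\<close>, so both sums
  equal the double sum over \<open>e t \<odot> f u\<close>. Hence functional calculus may be computed from any
  decomposition.
\<close>

lemma spectral_comb_unique:
  assumes E: "spectral_decomp A n s a L e" and F: "spectral_decomp A n s a K f"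
  shows "(\<Sum>t\<in>L. of_real (h t) \<cdot> e t) = (\<Sum>u\<in>K. of_real (h u) \<cdot> f u)"
proof -
  note D = spectral_decompD[OF E] and D' = spectral_decompD[OF F]
  have a: "a \<in> \<C>" unfolding D(6) using D(3) by (intro sum_in smul_in)
  have zero: "e t \<odot> f u = 0" if "t \<in> L" "u \<in> K" "t \<noteq> u" for t u
  proof -
    have "of_real t \<cdot> (e t \<odot> f u) = e t \<odot> a \<odot> f u"
      using spectral_mult(2)[OF E that(1)] D(3) D'(3) that by (simp add: smul_left)
    also have "\<dots> = of_real u \<cdot> (e t \<odot> f u)"
      using spectral_mult(1)[OF F that(2)] D(3) D'(3) that a by (simp add: smul_right assoc)
    finally show ?thesis using that(3) by simp
  qed
  have "(\<Sum>t\<in>L. of_real (h t) \<cdot> e t) = (\<Sum>t\<in>L. \<Sum>u\<in>K. of_real (h t) \<cdot> (e t \<odot> f u))"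
  proof (rule sum.cong[OF HOL.refl])
    fix t assume t: "t \<in> L"
    have "e t = e t \<odot> (\<Sum>u\<in>K. f u)" using D(3)[OF t] by (simp add: D'(5) one_right)
    also have "\<dots> = (\<Sum>u\<in>K. e t \<odot> f u)" using D(3)[OF t] D'(3) by (rule mult_sum_right)
    finally show "of_real (h t) \<cdot> e t = (\<Sum>u\<in>K. of_real (h t) \<cdot> (e t \<odot> f u))"
      by (metis W.scale_sum_right)
  qed
  also have "\<dots> = (\<Sum>t\<in>L. \<Sum>u\<in>K. of_real (h u) \<cdot> (e t \<odot> f u))"
    by (intro sum.cong HOL.refl) (metis W.scale_zero_right zero)
  also have "\<dots> = (\<Sum>u\<in>K. \<Sum>t\<in>L. of_real (h u) \<cdot> (e t \<odot> f u))" by (rule sum.swap)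
  also have "\<dots> = (\<Sum>u\<in>K. of_real (h u) \<cdot> f u)"
  proof (rule sum.cong[OF HOL.refl])
    fix u assume u: "u \<in> K"
    have "f u = (\<Sum>t\<in>L. e t) \<odot> f u" using D'(3)[OF u] by (simp add: D(5) one_left)
    also have "\<dots> = (\<Sum>t\<in>L. e t \<odot> f u)" using D'(3)[OF u] D(3) by (rule mult_sum_left)
    finally show "(\<Sum>t\<in>L. of_real (h u) \<cdot> (e t \<odot> f u)) = of_real (h u) \<cdot> f u"
      by (metis W.scale_sum_right)
  qed
  finally show ?thesis .
qed

lemma func_calc_eq:
  assumes "spectral_decomp A n s a L e"
  shows "func_calc A n s h a = (\<Sum>t\<in>L. of_real (h t) \<cdot> e t)"
  unfolding func_calc_def
proof (rule the_equality)
  show "\<exists>L' e'. spectral_decomp A n s a L' e' \<and>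
      (\<Sum>t\<in>L. of_real (h t) \<cdot> e t) = (\<Sum>t\<in>L'. of_real (h t) \<cdot> e' t)"
    using assms by blast
  fix b assume "\<exists>L' e'. spectral_decomp A n s a L' e' \<and> b = (\<Sum>t\<in>L'. of_real (h t) \<cdot> e' t)"
  then show "b = (\<Sum>t\<in>L. of_real (h t) \<cdot> e t)" using spectral_comb_unique[OF assms] by auto
qed

lemma pnorm_eq:
  assumes "spectral_decomp A n s (x\<dagger> \<odot> x) L e"
  shows "pnorm A n s (ereal p) x = (\<Sum>t\<in>L. sqrt t powr p * Re (\<tau> (e t))) powr (1 / p)"
proof -
  note D = spectral_decompD[OF assms]
  have inj: "inj_on sqrt L" by (auto intro: inj_onI)
  define e' where "e' u = e (inv_into L sqrt u)" for u
  have e': "e' (sqrt t) = e t" if "t \<in> L" for t using inj that by (simp add: e'_def)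
  have abs: "abs_val A n s x = (\<Sum>t\<in>L. of_real (sqrt t) \<cdot> e t)"
    unfolding abs_val_def by (rule func_calc_eq[OF assms])
  have "spectral_decomp A n s (abs_val A n s x) (sqrt ` L) e'"
    unfolding spectral_decomp_def
  proof (intro conjI ballI impI)
    show "(\<Sum>t\<in>sqrt ` L. e' t) = \<one>" using inj by (simp add: sum.reindex e' D(5) cong: sum.cong)
    show "abs_val A n s x = (\<Sum>t\<in>sqrt ` L. of_real t \<cdot> e' t)"
      using inj by (simp add: sum.reindex e' abs cong: sum.cong)
  qed (use D e' in auto)
  then have "func_calc A n s (\<lambda>t. t powr p) (abs_val A n s x)
      = (\<Sum>t\<in>sqrt ` L. of_real (t powr p) \<cdot> e' t)"
    by (rule func_calc_eq)
  also have "\<dots> = (\<Sum>t\<in>L. of_real (sqrt t powr p) \<cdot> e t)" using inj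
      by (simp add: sum.reindex e' cong: sum.cong)
  finally have "Re (\<tau> (func_calc A n s (\<lambda>t. t powr p) (abs_val A n s x)))
      = (\<Sum>t\<in>L. sqrt t powr p * Re (\<tau> (e t)))"
    using D(3) by (simp add: trace_sum trace_smul smul_in)
  then show ?thesis by (simp add: pnorm_def)
qed

lemma norm_orthogonal_sum:
  assumes T: "finite T" and y: "\<And>t. t \<in> T \<Longrightarrow> y t \<in> \<C>"
    and orth: "\<And>t u. t \<in> T \<Longrightarrow> u \<in> T \<Longrightarrow> (y t)\<dagger> \<odot> y u = (if t = u then e t else 0)"
    and e: "\<And>t. t \<in> T \<Longrightarrow> is_projection A n s (e t)"
  shows "\<parallel>\<Sum>t\<in>T. c t \<cdot> y t\<parallel>\<^sup>2 = (\<Sum>t\<in>T. (cmod (c t))\<^sup>2 * \<parallel>e t\<parallel>\<^sup>2)"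
proof -
  let ?x = "\<Sum>t\<in>T. c t \<cdot> y t"
  have x: "?x \<in> \<C>" using y by (intro sum_in smul_in)
  have "?x\<dagger> \<odot> ?x = (\<Sum>u\<in>T. \<Sum>t\<in>T. (cnj (c t) * c u) \<cdot> ((y t)\<dagger> \<odot> y u))"
  proof -
    have "?x\<dagger> \<odot> (c u \<cdot> y u) = (\<Sum>t\<in>T. (cnj (c t) * c u) \<cdot> ((y t)\<dagger> \<odot> y u))" if "u \<in> T" for u
      using y that by (subst adj_sum, simp add: in_carrier, subst mult_sum_left)
        (auto intro!: sum.cong simp: adj_smul' smul_left smul_right in_carrier mult.commute)
    then show ?thesis using y x by (subst mult_sum_right) (auto intro!: sum.cong simp: in_carrier)
  qed
  also have "\<dots> = (\<Sum>u\<in>T. \<Sum>t\<in>T. if t = u then (cnj (c u) * c u) \<cdot> e u else 0)"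
    by (intro sum.cong HOL.refl) (auto simp: orth)
  also have "\<dots> = (\<Sum>t\<in>T. (cnj (c t) * c t) \<cdot> e t)" using T by simp
  finally have "\<tau> (?x\<dagger> \<odot> ?x) = (\<Sum>t\<in>T. (cnj (c t) * c t) * of_real (\<parallel>e t\<parallel>\<^sup>2))"
    using projectionD(1,4)[OF e] by (simp add: trace_sum trace_smul in_carrier cong: sum.cong)
  also have "\<dots> = of_real (\<Sum>t\<in>T. (cmod (c t))\<^sup>2 * \<parallel>e t\<parallel>\<^sup>2)"
    unfolding of_real_sum of_real_mult complex_norm_square by (simp add: mult.commute)
  finally have "complex_of_real (\<parallel>?x\<parallel>\<^sup>2) = of_real (\<Sum>t\<in>T. (cmod (c t))\<^sup>2 * \<parallel>e t\<parallel>\<^sup>2)"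
    unfolding trace_norm[OF x] .
  then show ?thesis by (simp only: of_real_eq_iff)
qed

subsection \<open>The polar decomposition\<close>

text \<open>
  The singular value decomposition \<open>x = \<Sum> \<sigma> v\<close> into partial isometries \<open>v t\<close> with orthogonal initial
  projections \<open>e t\<close>. The index \<open>t\<close> is an eigenvalue of \<open>x\<^sup>* x\<close>. Only nonzero singular values are
  kept, so the projections need not add up to \<open>1\<close>, but all \<open>p\<close>-norms can be read off.
\<close>

definition polar :: "'a \<Rightarrow> real set \<Rightarrow> (real \<Rightarrow> real) \<Rightarrow> (real \<Rightarrow> 'a) \<Rightarrow> (real \<Rightarrow> 'a) \<Rightarrow> bool" where
  "polar x T \<sigma> v e \<longleftrightarrow> finite T \<and>
     (\<forall>t\<in>T. 0 < \<sigma> t \<and> v t \<in> \<C> \<and> is_projection A n s (e t) \<and> e t \<noteq> 0) \<and>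
     (\<forall>t\<in>T. \<forall>u\<in>T. (v t)\<dagger> \<odot> v u = (if t = u then e t else 0) \<and>
        v t \<odot> e u = (if t = u then v t else 0) \<and> e t \<odot> e u = (if t = u then e t else 0)) \<and>
     x = (\<Sum>t\<in>T. of_real (\<sigma> t) \<cdot> v t) \<and>
     (\<Sum>t\<in>T. \<parallel>e t\<parallel>\<^sup>2) \<le> Re (\<tau> \<one>) \<and>
     (\<forall>p>0. pnorm A n s (ereal p) x = (\<Sum>t\<in>T. \<sigma> t powr p * \<parallel>e t\<parallel>\<^sup>2) powr (1 / p))"

lemma polarD:
  assumes "polar x T \<sigma> v e"
  shows "finite T" "\<And>t. t \<in> T \<Longrightarrow> 0 < \<sigma> t" "\<And>t. t \<in> T \<Longrightarrow> v t \<in> \<C>" "\<And>t. t \<in> T \<Longrightarrow> e t \<in> \<C>"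
    "\<And>t. t \<in> T \<Longrightarrow> is_projection A n s (e t)" "\<And>t. t \<in> T \<Longrightarrow> 0 < \<parallel>e t\<parallel>\<^sup>2"
    "\<And>t u. t \<in> T \<Longrightarrow> u \<in> T \<Longrightarrow> (v t)\<dagger> \<odot> v u = (if t = u then e t else 0)"
    "\<And>t u. t \<in> T \<Longrightarrow> u \<in> T \<Longrightarrow> v t \<odot> e u = (if t = u then v t else 0)"
    "\<And>t u. t \<in> T \<Longrightarrow> u \<in> T \<Longrightarrow> e t \<odot> e u = (if t = u then e t else 0)"
    "x = (\<Sum>t\<in>T. of_real (\<sigma> t) \<cdot> v t)" "(\<Sum>t\<in>T. \<parallel>e t\<parallel>\<^sup>2) \<le> Re (\<tau> \<one>)"
    "\<And>p. 0 < p \<Longrightarrow> pnorm A n s (ereal p) x = (\<Sum>t\<in>T. \<sigma> t powr p * \<parallel>e t\<parallel>\<^sup>2) powr (1 / p)"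
  using assms unfolding polar_def by (auto simp: is_projection_def norm_eq_zero_iff)

lemma ex_polar:
  assumes x: "x \<in> \<C>"
  shows "\<exists>T \<sigma> v e. polar x T \<sigma> v e"
proof -
  define a where "a = x\<dagger> \<odot> x"
  have a: "a \<in> \<C>" "a\<dagger> = a" using x by (simp_all add: a_def adj_mult adj_adj' in_carrier)
  obtain L e where E: "spectral_decomp A n s a L e" using ex_spectral_decomp[OF a] by blast
  note D = spectral_decompD[OF E]
  have sa: "(e t)\<dagger> = e t" if "t \<in> L" for t using projectionD(2)[OF D(2)[OF that]] .
  have xe: "(x \<odot> e t)\<dagger> \<odot> (x \<odot> e u) = (if t = u then of_real t \<cdot> e t else 0)" if "t \<in> L" "u \<in> L" for t u
  proof -
    have "(x \<odot> e t)\<dagger> \<odot> (x \<odot> e u) = e t \<odot> (a \<odot> e u)"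
      using x D(3) that sa by (simp add: adj_mult assoc a_def in_carrier)
    then show ?thesis using spectral_mult(1)[OF E that(2)] D(3,4) that by (simp add: smul_right)
  qed
  \<comment> \<open>Shows both that the eigenvalues of \<open>a\<close> are nonnegative and that \<open>x\<close> vanishes on the null space
      of \<open>a\<close>.\<close>
  have norm_xe: "\<parallel>x \<odot> e t\<parallel>\<^sup>2 = t * \<parallel>e t\<parallel>\<^sup>2" if t: "t \<in> L" for t
  proof -
    have "of_real (\<parallel>x \<odot> e t\<parallel>\<^sup>2) = (of_real (t * \<parallel>e t\<parallel>\<^sup>2) :: complex)"
      using trace_norm[of "x \<odot> e t"] xe[OF t t] projectionD(4)[OF D(2)[OF t]] D(3)[OF t] x
      by (simp add: trace_smul in_carrier)
    then show ?thesis by (simp only: of_real_eq_iff)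
  qed
  have nonneg: "0 \<le> t" if "t \<in> L" "e t \<noteq> 0" for t
  proof -
    have "0 \<le> t * \<parallel>e t\<parallel>\<^sup>2" unfolding norm_xe[OF that(1), symmetric] by simp
    moreover have "0 < \<parallel>e t\<parallel>\<^sup>2" using trace_norm_pos[OF D(3)[OF that(1)] that(2)] by simp
    ultimately show ?thesis by (simp add: zero_le_mult_iff)
  qed
  have null: "x \<odot> e 0 = 0" if "0 \<in> L"
    using norm_xe[OF that] x D(3)[OF that] norm_eq_zero_iff[of "x \<odot> e 0"] by (simp add: in_carrier)
  define T where "T = {t \<in> L. e t \<noteq> 0 \<and> t \<noteq> 0}"
  define v where "v t = of_real (1 / sqrt t) \<cdot> (x \<odot> e t)" for t
  have T: "T \<subseteq> L" "\<And>t. t \<in> T \<Longrightarrow> 0 < t" using nonneg by (force simp: T_def)+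
  have "polar x T sqrt v e"
    unfolding polar_def
  proof (intro conjI ballI allI impI)
    show "finite T" using D(1) T(1) by (rule finite_subset[rotated])
    fix t assume t: "t \<in> T"
    then have tL: "t \<in> L" using T by blast
    show "0 < sqrt t" using T(2)[OF t] by simp
    show "v t \<in> \<C>" using x D(3)[OF tL] by (simp add: v_def in_carrier)
    show "is_projection A n s (e t)" by (rule D(2)[OF tL])
    show "e t \<noteq> 0" using t by (simp add: T_def)
    fix u assume u: "u \<in> T"
    then have uL: "u \<in> L" using T by blast
    show "e t \<odot> e u = (if t = u then e t else 0)" by (rule D(4)[OF tL uL])
    have "v t \<odot> e u = of_real (1 / sqrt t) \<cdot> (x \<odot> (e t \<odot> e u))"
      using x D(3) tL uL by (simp add: v_def smul_left assoc in_carrier)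
    then show "v t \<odot> e u = (if t = u then v t else 0)" using D(4)[OF tL uL] x by (simp add: v_def)
    have "(v t)\<dagger> \<odot> v u = (of_real (1 / sqrt t) * of_real (1 / sqrt u)) \<cdot> ((x \<odot> e t)\<dagger> \<odot> (x \<odot> e u))"
      using x D(3) tL uL by (simp add: v_def smul_left smul_right adj_smul' in_carrier)
    moreover have "complex_of_real (1 / sqrt t) * of_real (1 / sqrt t) * of_real t = 1"
      using T(2)[OF t] by (simp add: of_real_mult[symmetric] real_divide_square_eq del: of_real_mult
          of_real_divide)
    ultimately show "(v t)\<dagger> \<odot> v u = (if t = u then e t else 0)"
      unfolding xe[OF tL uL] by (auto simp del: of_real_divide)
  next
    have zero: "x \<odot> e t = 0" if "t \<in> L - T" for t
      using that null x by (auto simp: T_def)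
    have "x = x \<odot> (\<Sum>t\<in>L. e t)" using x by (simp add: D(5) one_right)
    also have "\<dots> = (\<Sum>t\<in>L. x \<odot> e t)" using x D(3) by (rule mult_sum_right)
    also have "\<dots> = (\<Sum>t\<in>T. x \<odot> e t)" using D(1) T(1) zero by (intro sum.mono_neutral_right) auto
    also have "\<dots> = (\<Sum>t\<in>T. of_real (sqrt t) \<cdot> v t)"
      by (intro sum.cong HOL.refl) (use T(2) in \<open>force simp: v_def of_real_mult[symmetric] simp del:
          of_real_mult of_real_divide\<close>)
    finally show "x = (\<Sum>t\<in>T. of_real (sqrt t) \<cdot> v t)" .
    have "(\<Sum>t\<in>T. \<parallel>e t\<parallel>\<^sup>2) \<le> (\<Sum>t\<in>L. \<parallel>e t\<parallel>\<^sup>2)"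
      using D(1) T(1) by (rule sum_mono2) simp
    also have "\<dots> = Re (\<tau> (\<Sum>t\<in>L. e t))"
      using D(3) projectionD(4)[OF D(2)] by (simp add: trace_sum cong: sum.cong)
    finally show "(\<Sum>t\<in>T. \<parallel>e t\<parallel>\<^sup>2) \<le> Re (\<tau> \<one>)" by (simp add: D(5))
    fix p :: real assume p: "0 < p"
    have "pnorm A n s (ereal p) x = (\<Sum>t\<in>L. sqrt t powr p * Re (\<tau> (e t))) powr (1 / p)"
      using pnorm_eq E unfolding a_def .
    also have "(\<Sum>t\<in>L. sqrt t powr p * Re (\<tau> (e t))) = (\<Sum>t\<in>T. sqrt t powr p * Re (\<tau> (e t)))"
      using D(1) T(1) p by (intro sum.mono_neutral_right) (auto simp: T_def)
    also have "\<dots> = (\<Sum>t\<in>T. sqrt t powr p * \<parallel>e t\<parallel>\<^sup>2)"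
      by (intro sum.cong HOL.refl) (use projectionD(4)[OF D(2)] T(1) in \<open>auto simp: subset_iff\<close>)
    finally show "pnorm A n s (ereal p) x = (\<Sum>t\<in>T. sqrt t powr p * \<parallel>e t\<parallel>\<^sup>2) powr (1 / p)" .
  qed
  then show ?thesis by blast
qed

lemma polar_norms:
  assumes "polar x T \<sigma> v e"
  shows "\<parallel>\<Sum>t\<in>T. c t \<cdot> v t\<parallel>\<^sup>2 = (\<Sum>t\<in>T. (cmod (c t))\<^sup>2 * \<parallel>e t\<parallel>\<^sup>2)"
    and "\<parallel>\<Sum>t\<in>T. c t \<cdot> e t\<parallel>\<^sup>2 = (\<Sum>t\<in>T. (cmod (c t))\<^sup>2 * \<parallel>e t\<parallel>\<^sup>2)"
proof -
  note D = polarD[OF assms]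
  show "\<parallel>\<Sum>t\<in>T. c t \<cdot> v t\<parallel>\<^sup>2 = (\<Sum>t\<in>T. (cmod (c t))\<^sup>2 * \<parallel>e t\<parallel>\<^sup>2)"
    by (rule norm_orthogonal_sum[OF D(1,3,7,5)])
  show "\<parallel>\<Sum>t\<in>T. c t \<cdot> e t\<parallel>\<^sup>2 = (\<Sum>t\<in>T. (cmod (c t))\<^sup>2 * \<parallel>e t\<parallel>\<^sup>2)"
  proof (rule norm_orthogonal_sum[OF D(1,4) _ D(5)])
    show "(e t)\<dagger> \<odot> e u = (if t = u then e t else 0)" if "t \<in> T" "u \<in> T" for t u
      using D(9)[OF that] projectionD(2)[OF D(5)[OF that(1)]] by simp
  qed
qed

lemma polar_product:
  assumes "polar x T \<sigma> v e"
  shows "(\<Sum>t\<in>T. c t \<cdot> v t) \<odot> (\<Sum>t\<in>T. d t \<cdot> e t) = (\<Sum>t\<in>T. (c t * d t) \<cdot> v t)"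
proof -
  note D = polarD[OF assms]
  have "(\<Sum>t\<in>T. c t \<cdot> v t) \<odot> (\<Sum>t\<in>T. d t \<cdot> e t) = (\<Sum>u\<in>T. \<Sum>t\<in>T. (c t * d u) \<cdot> (v t \<odot> e u))"
  proof -
    have "(\<Sum>t\<in>T. c t \<cdot> v t) \<odot> (d u \<cdot> e u) = (\<Sum>t\<in>T. (c t * d u) \<cdot> (v t \<odot> e u))" if "u \<in> T" for u
      using D(3,4) that by (subst mult_sum_left) (auto intro!: sum.cong simp: smul_left smul_right
          in_carrier mult.commute)
    then show ?thesis using D(3,4) by (subst mult_sum_right) (auto intro!: sum.cong simp: in_carrier)
  qed
  also have "\<dots> = (\<Sum>u\<in>T. \<Sum>t\<in>T. if t = u then (c u * d u) \<cdot> v u else 0)"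
    by (intro sum.cong HOL.refl) (auto simp: D(8))
  finally show ?thesis using D(1) by simp
qed

lemma pnorm_two: "x \<in> \<C> \<Longrightarrow> pnorm A n s (ereal 2) x = \<parallel>x\<parallel>"
proof -
  assume x: "x \<in> \<C>"
  obtain T \<sigma> v e where P: "polar x T \<sigma> v e" using ex_polar[OF x] by blast
  note D = polarD[OF P]
  have "\<parallel>x\<parallel>\<^sup>2 = (\<Sum>t\<in>T. \<sigma> t powr 2 * \<parallel>e t\<parallel>\<^sup>2)"
    using polar_norms(1)[OF P, of "\<lambda>t. of_real (\<sigma> t)"] D(2,10) by (simp add: less_imp_le cong: sum.cong)
  then have "pnorm A n s (ereal 2) x = (\<parallel>x\<parallel>\<^sup>2) powr (1 / 2)" using D(12)[of 2] by simp
  also have "\<dots> = \<parallel>x\<parallel>" using trace_norm_nonneg[OF x]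
      by (simp only: powr_half_sqrt zero_le_power2 real_sqrt_abs abs_of_nonneg)
  finally show ?thesis .
qed

text \<open>
  The eigenvalues are nonnegative, and their sum weighted by the positive traces of the spectral
  projections vanishes.
\<close>

lemma positive_trace_zero:
  assumes h: "h \<in> \<C>" "h\<dagger> = h" and pos: "\<And>y. y \<in> \<C> \<Longrightarrow> 0 \<le> Re (\<tau> (y\<dagger> \<odot> h \<odot> y))" and tr: "\<tau> h = 0"
  shows "h = 0"
proof -
  obtain L e where E: "spectral_decomp A n s h L e" using ex_spectral_decomp[OF h] by blast
  note D = spectral_decompD[OF E]
  have nonneg: "0 \<le> t * \<parallel>e t\<parallel>\<^sup>2" if t: "t \<in> L" for t
  proof -
    have "(e t)\<dagger> \<odot> h \<odot> e t = of_real t \<cdot> e t"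
      using projectionD[OF D(2)[OF t]] spectral_mult(2)[OF E t] by (simp add: smul_left)
    then show ?thesis using pos[OF D(3)[OF t]] projectionD[OF D(2)[OF t]] by (simp add: trace_smul)
  qed
  have "\<tau> h = (\<Sum>t\<in>L. of_real t * \<tau> (e t))"
    using D(3) by (subst D(6)) (simp add: trace_sum trace_smul in_carrier)
  also have "\<dots> = of_real (\<Sum>t\<in>L. t * \<parallel>e t\<parallel>\<^sup>2)"
    using projectionD(4)[OF D(2)] by (simp cong: sum.cong)
  finally have "(\<Sum>t\<in>L. t * \<parallel>e t\<parallel>\<^sup>2) = 0" using tr by (metis of_real_eq_0_iff)
  then have "t * \<parallel>e t\<parallel>\<^sup>2 = 0" if "t \<in> L" for t
    using sum_nonneg_eq_0_iff[OF D(1), of "\<lambda>t. t * \<parallel>e t\<parallel>\<^sup>2"] nonneg that by simp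
  then have "of_real t \<cdot> e t = 0" if "t \<in> L" for t
    using that D(3)[OF that] norm_eq_zero_iff by fastforce
  then show ?thesis by (subst D(6)) (rule sum.neutral, blast)
qed

end

context tracial_box
begin

lemma polar_pairing:
  assumes "polar x T \<sigma> v e"
  shows "\<tau> ((\<Sum>t\<in>T. c t \<cdot> v t)\<dagger> \<odot> (\<Sum>t\<in>T. d t \<cdot> v t)) = (\<Sum>t\<in>T. cnj (c t) * d t * of_real (\<parallel>e t\<parallel>\<^sup>2))"
proof -
  note D = polarD[OF assms]
  have v: "(\<Sum>t\<in>T. c t \<cdot> v t)\<dagger> = (\<Sum>t\<in>T. cnj (c t) \<cdot> (v t)\<dagger>)"
    using D(3) by (subst adj_sum) (auto intro!: sum.cong simp: adj_smul' in_carrier)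
  have "(\<Sum>t\<in>T. c t \<cdot> v t)\<dagger> \<odot> (d u \<cdot> v u) = (cnj (c u) * d u) \<cdot> e u" if u: "u \<in> T" for u
  proof -
    have "(\<Sum>t\<in>T. c t \<cdot> v t)\<dagger> \<odot> (d u \<cdot> v u) = (\<Sum>t\<in>T. if t = u then (cnj (c u) * d u) \<cdot> e u else 0)"
      unfolding v using D(3) u
      by (subst mult_sum_left) (auto intro!: sum.cong simp: smul_left smul_right D(7) in_carrier)
    then show ?thesis using D(1) u by simp
  qed
  then have "(\<Sum>t\<in>T. c t \<cdot> v t)\<dagger> \<odot> (\<Sum>t\<in>T. d t \<cdot> v t) = (\<Sum>t\<in>T. (cnj (c t) * d t) \<cdot> e t)"
    using D(3) by (subst mult_sum_right) (auto intro!: sum.cong simp: in_carrier)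
  then show ?thesis
    using D(4) projectionD(4)[OF D(5)] by (simp add: trace_sum trace_smul in_carrier cong: sum.cong)
qed

lemma pnorm_infinity: "pnorm A n s \<infinity> x = op_norm A n s x"
  by (simp add: pnorm_def)

lemma op_norm_le:
  assumes "\<And>y. y \<in> \<C> \<Longrightarrow> \<parallel>x \<odot> y\<parallel> \<le> K * \<parallel>y\<parallel>" "0 \<le> K"
  shows "op_norm A n s x \<le> K"
  unfolding op_norm_def
proof (rule cSUP_least)
  have "0 \<in> {y \<in> \<C>. \<parallel>y\<parallel> \<le> 1}" using norm_eq_zero_iff[of 0] by simp
  then show "{y \<in> \<C>. \<parallel>y\<parallel> \<le> 1} \<noteq> {}" by blast
  show "\<parallel>x \<odot> y\<parallel> \<le> K" if "y \<in> {y \<in> \<C>. \<parallel>y\<parallel> \<le> 1}" for y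
    using assms(1)[of y] that mult_left_le[of "\<parallel>y\<parallel>" K] assms(2) by simp
qed

lemma norm_mult_of_scalar_square:
  assumes "x \<in> \<C>" "y \<in> \<C>" "x\<dagger> \<odot> x = of_real (k\<^sup>2) \<cdot> \<one>" "0 \<le> k"
  shows "\<parallel>x \<odot> y\<parallel> = k * \<parallel>y\<parallel>"
proof (rule power2_eq_imp_eq)
  have "(x \<odot> y)\<dagger> \<odot> (x \<odot> y) = y\<dagger> \<odot> ((x\<dagger> \<odot> x) \<odot> y)"
    using assms(1,2) by (simp add: adj_mult assoc in_carrier)
  also have "\<dots> = of_real (k\<^sup>2) \<cdot> (y\<dagger> \<odot> y)"
    unfolding assms(3) using assms(2) by (simp add: smul_left smul_right one_left in_carrier)
  finally have "complex_of_real (\<parallel>x \<odot> y\<parallel>\<^sup>2) = of_real ((k * \<parallel>y\<parallel>)\<^sup>2)"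
    using trace_norm[of "x \<odot> y"] trace_norm[OF assms(2)] assms(1,2)
    by (simp add: trace_smul in_carrier power_mult_distrib)
  then show "\<parallel>x \<odot> y\<parallel>\<^sup>2 = (k * \<parallel>y\<parallel>)\<^sup>2" by (simp only: of_real_eq_iff)
qed (use assms in \<open>simp_all add: trace_norm_nonneg in_carrier\<close>)

text \<open>
  Such an element is \<open>k\<close> times an isometry, so \<open>k\<close> is its only singular value and its weight is
  \<open>\<tau> \<one> = \<parallel>\<one>\<parallel>\<^sup>2\<close>.
\<close>

lemma pnorm_of_scalar_square:
  assumes x: "x \<in> \<C>" "x\<dagger> \<odot> x = of_real (k\<^sup>2) \<cdot> \<one>" and k: "0 \<le> k" and one: "\<one> \<noteq> 0"
  shows "0 < q \<Longrightarrow> pnorm A n s (ereal q) x = k * \<parallel>\<one>\<parallel> powr (2 / q)" and "pnorm A n s \<infinity> x = k"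
proof -
  have pos: "0 < \<parallel>\<one>\<parallel>" using trace_norm_pos[OF one_in one] .
  have "spectral_decomp A n s (x\<dagger> \<odot> x) {k\<^sup>2} (\<lambda>_. \<one>)"
    unfolding spectral_decomp_def is_projection_def x(2) by (simp add: one_in one_left)
  from pnorm_eq[OF this] have "pnorm A n s (ereal q) x = (k powr q * \<parallel>\<one>\<parallel>\<^sup>2) powr (1 / q)" for q
    using trace_norm[OF one_in] k by (simp add: one_left in_carrier)
  moreover have "(k powr q * \<parallel>\<one>\<parallel>\<^sup>2) powr (1 / q) = k * \<parallel>\<one>\<parallel> powr (2 / q)" if "0 < q" for q
  proof -
    have "\<parallel>\<one>\<parallel>\<^sup>2 = \<parallel>\<one>\<parallel> powr 2" using pos by simp
    then have "\<parallel>\<one>\<parallel>\<^sup>2 powr (1 / q) = \<parallel>\<one>\<parallel> powr (2 / q)" by (simp only: powr_powr) simp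
    then show ?thesis using that k by (simp add: powr_mult powr_powr)
  qed
  ultimately show "0 < q \<Longrightarrow> pnorm A n s (ereal q) x = k * \<parallel>\<one>\<parallel> powr (2 / q)" by simp
  have "op_norm A n s x = k"
    unfolding op_norm_def
  proof (rule cSup_eq_maximum)
    let ?y = "of_real (1 / \<parallel>\<one>\<parallel>) \<cdot> \<one>"
    have y: "?y \<in> \<C>" "\<parallel>?y\<parallel> = 1" using pos by (simp_all add: norm_smul norm_divide in_carrier)
    then have "k = \<parallel>x \<odot> ?y\<parallel>" using norm_mult_of_scalar_square[OF x(1) y(1) x(2) k] by simp
    then show "k \<in> (\<lambda>y. \<parallel>x \<odot> y\<parallel>) ` {y \<in> \<C>. \<parallel>y\<parallel> \<le> 1}" using y by (intro image_eqI[of _ _ ?y]) auto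
    show "z \<le> k" if "z \<in> (\<lambda>y. \<parallel>x \<odot> y\<parallel>) ` {y \<in> \<C>. \<parallel>y\<parallel> \<le> 1}" for z
      using that norm_mult_of_scalar_square[OF x(1) _ x(2) k] k by (auto simp: mult_left_le)
  qed
  then show "pnorm A n s \<infinity> x = k" by (simp add: pnorm_infinity)
qed

lemma pnorm_multiple_projection:
  assumes f: "is_projection A n s f" "\<tau> f = 1" and p: "0 < p"
  shows "pnorm A n s (ereal p) (c \<cdot> f) = cmod c"
proof -
  note P = projectionD[OF f(1)]
  define L where "L = {(cmod c)\<^sup>2, 0}"
  define e where "e t = (if c = 0 then \<one> else if t = 0 then \<one> - f else f)" for t :: real
  have sq: "(c \<cdot> f)\<dagger> \<odot> (c \<cdot> f) = of_real ((cmod c)\<^sup>2) \<cdot> f"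
    unfolding complex_norm_square using P by (simp add: adj_smul' smul_left smul_right in_carrier
        mult.commute)
  have g: "is_projection A n s (\<one> - f)" "f \<odot> (\<one> - f) = 0" "(\<one> - f) \<odot> f = 0"
    using P by (simp_all add: is_projection_def adj_diff mult_diff_left mult_diff_right one_left
        one_right in_carrier)
  have one: "is_projection A n s \<one>" by (simp add: is_projection_def one_left in_carrier)
  have "spectral_decomp A n s ((c \<cdot> f)\<dagger> \<odot> (c \<cdot> f)) L e"
    unfolding sq spectral_decomp_def L_def e_def using f g one by (auto simp: insert_commute)
  from pnorm_eq[OF this, of p] show ?thesis
    using f(2) p by (cases "c = 0") (simp_all add: L_def e_def powr_powr)
qed

text \<open>
  A multiple \<open>P\<close> of \<open>g \<odot> g\<dagger>\<close> is a projection, and it has the same trace as \<open>\<one>\<close> because the trace is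
  tracial; so \<open>\<one> - P\<close> is a projection of trace zero.
\<close>

lemma left_unitary_imp_right_unitary:
  assumes g: "g \<in> \<C>" "g\<dagger> \<odot> g = of_real k \<cdot> \<one>" and k: "k \<noteq> 0"
  shows "g \<odot> g\<dagger> = of_real k \<cdot> \<one>"
proof -
  define P where "P = of_real (1 / k) \<cdot> (g \<odot> g\<dagger>)"
  have P: "P \<in> \<C>" "P\<dagger> = P" using g(1) by (simp_all add: P_def adj_smul' adj_mult adj_adj' in_carrier)
  have "g \<odot> g\<dagger> \<odot> (g \<odot> g\<dagger>) = g \<odot> ((g\<dagger> \<odot> g) \<odot> g\<dagger>)" using g(1) by (simp add: assoc in_carrier)
  also have "\<dots> = of_real k \<cdot> (g \<odot> g\<dagger>)"
    unfolding g(2) using g(1) by (simp add: smul_left smul_right one_left in_carrier)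
  finally have PP: "P \<odot> P = P" using g(1) k by (simp add: P_def smul_left smul_right in_carrier)
  have "\<tau> P = of_real (1 / k) * \<tau> (g\<dagger> \<odot> g)"
    using g(1) trace_comm[of g "g\<dagger>"] by (simp add: P_def trace_smul in_carrier)
  then have tr: "\<tau> P = \<tau> \<one>" unfolding g(2) using k by (simp add: trace_smul in_carrier)
  let ?Q = "\<one> - P"
  have Q: "?Q \<in> \<C>" "?Q\<dagger> \<odot> ?Q = ?Q"
    using P PP by (simp_all add: adj_diff mult_diff_left mult_diff_right one_left one_right in_carrier)
  have "\<tau> ?Q = 0" using P tr by (simp add: trace_diff in_carrier)
  then have "?Q = 0" using trace_norm[OF Q(1)] Q norm_eq_zero_iff[OF Q(1)] by simp
  then have "of_real k \<cdot> P = of_real k \<cdot> \<one>" by simp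
  then show ?thesis using k by (simp add: P_def)
qed

text \<open>For \<open>z = x - x \<odot> f\<close> one finds \<open>z\<dagger> \<odot> z = 0\<close>.\<close>

lemma mult_support:
  assumes x: "x \<in> \<C>" and f: "is_projection A n s f" and sq: "x\<dagger> \<odot> x = c \<cdot> f"
  shows "x \<odot> f = x"
proof -
  note P = projectionD[OF f]
  let ?z = "x - x \<odot> f"
  have z: "?z \<in> \<C>" using x P(1) by (simp add: in_carrier)
  have "?z\<dagger> \<odot> x = x\<dagger> \<odot> x - f \<odot> (x\<dagger> \<odot> x)"
    using x P by (simp add: adj_diff mult_diff_left adj_mult assoc in_carrier)
  then have zx: "?z\<dagger> \<odot> x = 0" using P by (simp add: sq smul_right)
  have "?z\<dagger> \<odot> ?z = ?z\<dagger> \<odot> x - ?z\<dagger> \<odot> x \<odot> f"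
    using x z P by (simp only: mult_diff_right assoc in_carrier)
  then have "?z\<dagger> \<odot> ?z = 0" unfolding zx using P(1) by simp
  then have "?z = 0" by (rule adj_mult_self_zero[OF z])
  then show ?thesis by simp
qed

text \<open>
  If every nonzero projection has trace at least one, a projection \<open>f\<close> of trace one is minimal: a
  nonzero spectral projection \<open>e\<close> below \<open>f\<close> leaves trace \<open>0\<close> for \<open>f - e\<close>.
\<close>

lemma corner_self_adjoint:
  assumes large: "\<And>e. is_projection A n s e \<Longrightarrow> e \<noteq> 0 \<Longrightarrow> 1 \<le> \<parallel>e\<parallel>\<^sup>2"
    and f: "is_projection A n s f" "\<tau> f = 1"
    and h: "h \<in> \<C>" "h\<dagger> = h" "h \<odot> f = h"
  shows "\<exists>c::real. h = of_real c \<cdot> f"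
proof -
  note P = projectionD[OF f(1)]
  obtain L e where E: "spectral_decomp A n s h L e" using ex_spectral_decomp[OF h(1,2)] by blast
  note D = spectral_decompD[OF E]
  show ?thesis
  proof (cases "\<exists>t\<in>L. t \<noteq> 0 \<and> e t \<noteq> 0")
    case True
    then obtain t where t: "t \<in> L" "t \<noteq> 0" "e t \<noteq> 0" by blast
    note Pe = projectionD[OF D(2)[OF t(1)]]
    have "of_real t \<cdot> (e t \<odot> f) = of_real t \<cdot> e t"
      using spectral_mult(2)[OF E t(1)] assoc[OF Pe(1) h(1) P(1)] h(3) P Pe by (simp add: smul_left)
    then have ef: "e t \<odot> f = e t" using t(2) by simp
    then have fe: "f \<odot> e t = e t" using adj_mult[OF Pe(1) P(1)] P(2) Pe(2) by simp
    have Q: "is_projection A n s (f - e t)"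
      using P Pe ef fe by (simp add: is_projection_def adj_diff mult_diff_left mult_diff_right
          in_carrier)
    have "of_real (\<parallel>f - e t\<parallel>\<^sup>2) = (of_real (1 - \<parallel>e t\<parallel>\<^sup>2) :: complex)"
      using projectionD(4)[OF Q] P Pe f(2) by (simp add: trace_diff)
    then have "\<parallel>f - e t\<parallel>\<^sup>2 = 1 - \<parallel>e t\<parallel>\<^sup>2" by (simp only: of_real_eq_iff)
    then have "f = e t" using large[OF Q] large[OF D(2)[OF t(1)] t(3)] by fastforce
    then have "h = of_real t \<cdot> f" using h(3) spectral_mult(1)[OF E t(1)] by simp
    then show ?thesis by blast
  next
    case False
    then have "h = 0" by (subst D(6)) (intro sum.neutral, auto)
    then show ?thesis by (intro exI[of _ 0]) simp
  qed
qed

end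

section \<open>Norm inequalities for the string Fourier transform\<close>

context irreducible_subfactor_planar_algebra
begin

lemma tr_norm_pos: "x \<in> box A n s \<Longrightarrow> x \<noteq> 0 \<Longrightarrow> 0 < tr_norm A n s x"
  unfolding tr_norm_def using positive[of x n s] by simp

lemma tracial_box2: "tracial_box A 2 s"
  by unfold_locales
    (fact vector_space subspace_box finite_dim one_closed mult_closed adj_closed mult_add_left
        mult_add_right
      mult_smul_left mult_smul_right mult_assoc mult_one_left2 mult_one_right2 adj_adj adj_add
          adj_smul adj_mult2
      tr_add tr_smul tr_comm tr_form_self tr_norm_nonneg tr_norm_pos | rule mult_smul_right;
          assumption)+

sublocale box2: tracial_box A 2 s for s
  by (rule tracial_box2)

lemma norm_one2: "tr_norm A 2 s (one A 2 s) = delta A"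
proof -
  have "complex_of_real ((tr_norm A 2 s (one A 2 s))\<^sup>2) = of_real ((delta A)\<^sup>2)"
    using tr_form_self[OF one_closed, of 2 s] mult_one_left2[OF one_closed] tr_one2 by simp
  then have "(tr_norm A 2 s (one A 2 s))\<^sup>2 = (delta A)\<^sup>2" by (simp only: of_real_eq_iff)
  then show ?thesis by (rule power2_eq_imp_eq) (use delta_pos one_closed in auto)
qed

lemma one2_nonzero: "one A 2 s \<noteq> 0"
  using norm_one2[of s] delta_pos box2.norm_eq_zero_iff[of 0 s] zero_closed by auto

text \<open>
  For \<open>z = \<FF>(a b) y\<close> the number \<open>\<parallel>z\<parallel>\<^sup>2\<close> is the pairing of \<open>\<FF>(a b)\<close> with \<open>z y\<^sup>*\<close>, to which the
  diagrammatic bound applies. The factor \<open>\<parallel>z\<parallel>\<close> cancels.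
\<close>

lemma fourier_product_mult_bound:
  assumes a: "a \<in> box A 2 s" and b: "b \<in> box A 2 s" and y: "y \<in> box A 2 (opp s)"
  shows "tr_norm A 2 (opp s) (mult A 2 (opp s) (fourier A s (mult A 2 s a b)) y)
    \<le> tr_norm A 2 s a * tr_norm A 2 s b / delta A * tr_norm A 2 (opp s) y"
proof -
  let ?t = "opp s" and ?g = "fourier A s (mult A 2 s a b)"
  let ?z = "mult A 2 ?t ?g y" and ?K = "tr_norm A 2 s a * tr_norm A 2 s b / delta A"
  have g: "?g \<in> box A 2 ?t" using a b by (intro fourier_closed mult_closed)
  have z: "?z \<in> box A 2 ?t" using g y by (rule mult_closed)
  note closed = g y z adj_closed[OF z] adj_closed[OF y] mult_closed[OF adj_closed[OF z] g]
  have "tr A 2 ?t (mult A 2 ?t (adj A 2 ?t ?z) ?z)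
      = tr A 2 ?t (mult A 2 ?t (mult A 2 ?t (adj A 2 ?t ?z) ?g) y)"
    using closed by (simp add: mult_assoc)
  also have "\<dots> = tr A 2 ?t (mult A 2 ?t y (mult A 2 ?t (adj A 2 ?t ?z) ?g))"
    by (rule tr_comm[OF closed(6,2)])
  also have "mult A 2 ?t y (mult A 2 ?t (adj A 2 ?t ?z) ?g)
      = mult A 2 ?t (mult A 2 ?t y (adj A 2 ?t ?z)) ?g"
    by (rule mult_assoc[symmetric, OF closed(2,4,1)])
  also have "mult A 2 ?t y (adj A 2 ?t ?z) = adj A 2 ?t (mult A 2 ?t ?z (adj A 2 ?t y))"
    using closed by (simp add: adj_mult2 adj_adj)
  finally have "of_real ((tr_norm A 2 ?t ?z)\<^sup>2)
      = tr A 2 ?t (mult A 2 ?t (adj A 2 ?t (mult A 2 ?t ?z (adj A 2 ?t y))) ?g)"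
    using tr_form_self[OF z] by simp
  then have "(tr_norm A 2 ?t ?z)\<^sup>2 = cmod (tr A 2 ?t (mult A 2 ?t (adj A 2 ?t (mult A 2 ?t ?z (adj A
      2 ?t y))) ?g))"
    by (metis norm_of_real abs_power2)
  also have "\<dots> \<le> tr_norm A 2 s a * tr_norm A 2 s b * tr_norm A 2 ?t ?z * tr_norm A 2 ?t (adj A 2 ?t
      y) / delta A"
    by (rule fourier_product_bound[OF a b z adj_closed[OF y]])
  finally have sq: "tr_norm A 2 ?t ?z * tr_norm A 2 ?t ?z \<le> (?K * tr_norm A 2 ?t y) * tr_norm A 2 ?t ?z"
    using tr_norm_adj[OF y] by (simp add: power2_eq_square mult_ac)
  show ?thesis
  proof (cases "tr_norm A 2 ?t ?z = 0")
    case True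
    then show ?thesis using a b y delta_pos by simp
  next
    case False
    then have "0 < tr_norm A 2 ?t ?z" using tr_norm_nonneg[OF z] by simp
    then show ?thesis by (rule mult_right_le_imp_le[OF sq])
  qed
qed

text \<open>
  The point where irreducibility limits how small a projection can be. Apply the bound to \<open>f = f f\<close>
  and \<open>y = 1\<close>, and use \<open>\<parallel>\<FF>(f)\<parallel> = \<parallel>f\<parallel>\<close>: this gives \<open>\<parallel>f\<parallel> \<le> \<parallel>f\<parallel>\<^sup>2\<close>.
\<close>

lemma projection_norm_ge_one:
  assumes f: "is_projection A 2 s f" "f \<noteq> 0"
  shows "1 \<le> (tr_norm A 2 s f)\<^sup>2"
proof -
  note P = box2.projectionD[OF f(1)]
  have pos: "0 < tr_norm A 2 s f" by (rule tr_norm_pos[OF P(1) f(2)])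
  have "tr_norm A 2 s f = tr_norm A 2 (opp s) (mult A 2 (opp s) (fourier A s (mult A 2 s f f)) (one
      A 2 (opp s)))"
    using P tr_norm_fourier[OF P(1)] mult_one_right2[OF fourier_closed[OF P(1)]] by simp
  also have "\<dots> \<le> tr_norm A 2 s f * tr_norm A 2 s f / delta A * delta A"
    using fourier_product_mult_bound[OF P(1) P(1) one_closed] by (simp add: norm_one2)
  finally have "1 \<le> tr_norm A 2 s f" using pos delta_pos by simp
  then show ?thesis by simp
qed

text \<open>
  The singular values are weighted by traces of nonzero projections, and these are at least \<open>1\<close>.
  Thus \<open>p\<close>-norms behave like those of sequences and not like those of a probability space.
\<close>

lemma pnorm_antimono:
  assumes x: "x \<in> box A 2 s" and pr: "0 < p" "p \<le> r"
  shows "pnorm A 2 s (ereal r) x \<le> pnorm A 2 s (ereal p) x"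
    and "p < r \<Longrightarrow> x \<noteq> 0 \<Longrightarrow> pnorm A 2 s (ereal r) x = pnorm A 2 s (ereal p) x \<Longrightarrow>
      \<exists>c f. is_projection A 2 s f \<and> tr A 2 s f = 1 \<and> mult A 2 s (adj A 2 s x) x = smul A (of_real c) f"
proof -
  obtain T \<sigma> v e where P: "box2.polar s x T \<sigma> v e" using box2.ex_polar[OF x] by blast
  note D = box2.polarD[OF P]
  have w: "1 \<le> (tr_norm A 2 s (e t))\<^sup>2" if "t \<in> T" for t
    using projection_norm_ge_one[OF D(5)[OF that]] D(6)[OF that] box2.norm_eq_zero_iff[OF D(4)[OF
        that]] by fastforce
  have pn: "pnorm A 2 s (ereal r) x = (\<Sum>t\<in>T. \<sigma> t powr r * (tr_norm A 2 s (e t))\<^sup>2) powr (1 / r)"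
    "pnorm A 2 s (ereal p) x = (\<Sum>t\<in>T. \<sigma> t powr p * (tr_norm A 2 s (e t))\<^sup>2) powr (1 / p)"
    using D(12) pr by auto
  show "pnorm A 2 s (ereal r) x \<le> pnorm A 2 s (ereal p) x" unfolding pn
    by (rule weighted_power_sum_antimono(1)[OF D(1,2) w pr])
  assume lt: "p < r" and x0: "x \<noteq> 0" and eq: "pnorm A 2 s (ereal r) x = pnorm A 2 s (ereal p) x"
  have "T \<noteq> {}" using D(10) x0 by auto
  have "\<exists>i. T = {i} \<and> (tr_norm A 2 s (e i))\<^sup>2 = 1"
    by (rule weighted_power_sum_antimono(2)[OF D(1,2) w pr lt \<open>T \<noteq> {}\<close> eq[unfolded pn]])
  then obtain i where i: "T = {i}" "(tr_norm A 2 s (e i))\<^sup>2 = 1" by blast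
  have xi: "x = smul A (of_real (\<sigma> i)) (v i)" using D(10) i by simp
  have "mult A 2 s (adj A 2 s x) x = smul A (of_real ((\<sigma> i)\<^sup>2)) (e i)"
    using D(3)[of i] D(7)[of i i] i(1) unfolding xi
    by (simp add: adj_smul mult_smul_left mult_smul_right adj_closed V.subspace_scale[OF
        subspace_box] power2_eq_square)
  moreover have "tr A 2 s (e i) = 1" using box2.projectionD(4)[OF D(5)] i by simp
  ultimately show "\<exists>c f. is_projection A 2 s f \<and> tr A 2 s f = 1
      \<and> mult A 2 s (adj A 2 s x) x = smul A (of_real c) f"
    using D(5) i(1) by blast
qed

lemma pnorm_zero: "pnorm A 2 s (ereal p) 0 = 0" if "0 < p"
proof -
  obtain T \<sigma> v e where P: "box2.polar s 0 T \<sigma> v e" using box2.ex_polar[OF zero_closed] by blast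
  note D = box2.polarD[OF P]
  have "T = {}"
  proof (rule ccontr)
    assume "T \<noteq> {}"
    then obtain t where t: "t \<in> T" by blast
    have "(tr_norm A 2 s 0)\<^sup>2 = (\<Sum>t\<in>T. (cmod (of_real (\<sigma> t)))\<^sup>2 * (tr_norm A 2 s (e t))\<^sup>2)"
      using box2.polar_norms(1)[OF P, of "\<lambda>t. of_real (\<sigma> t)"] D(10) by simp
    moreover have "0 < (\<Sum>t\<in>T. (cmod (of_real (\<sigma> t)))\<^sup>2 * (tr_norm A 2 s (e t))\<^sup>2)"
      using D(2,6) by (intro sum_pos D(1) \<open>T \<noteq> {}\<close> mult_pos_pos) force+
    ultimately show False using box2.norm_eq_zero_iff[of 0 s] zero_closed by simp
  qed
  then show ?thesis using D(12)[OF that] that by simp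
qed

text \<open>Factorize \<open>x = a b\<close> by distributing each singular value evenly, so that \<open>\<parallel>a\<parallel>\<^sup>2 = \<parallel>b\<parallel>\<^sup>2 = \<parallel>x\<parallel>\<^sub>1\<close>.\<close>

lemma fourier_op_norm_le:
  assumes x: "x \<in> box A 2 s"
  shows "pnorm A 2 (opp s) \<infinity> (fourier A s x) \<le> pnorm A 2 s (ereal 1) x / delta A"
proof -
  obtain T \<sigma> v e where P: "box2.polar s x T \<sigma> v e" using box2.ex_polar[OF x] by blast
  note D = box2.polarD[OF P]
  define a where "a = (\<Sum>t\<in>T. smul A (of_real (sqrt (\<sigma> t))) (v t))"
  define b where "b = (\<Sum>t\<in>T. smul A (of_real (sqrt (\<sigma> t))) (e t))"
  have ab: "a \<in> box A 2 s" "b \<in> box A 2 s"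
    unfolding a_def b_def using D(3,4) by (intro box2.sum_in box2.smul_in; blast)+
  have "mult A 2 s a b = (\<Sum>t\<in>T. smul A (of_real (sqrt (\<sigma> t)) * of_real (sqrt (\<sigma> t))) (v t))"
    unfolding a_def b_def by (rule box2.polar_product[OF P])
  also have "\<dots> = (\<Sum>t\<in>T. smul A (of_real (\<sigma> t)) (v t))"
    by (intro sum.cong HOL.refl) (use D(2) in \<open>simp add: of_real_mult[symmetric] less_imp_le del:
        of_real_mult\<close>)
  also have "\<dots> = x" by (rule D(10)[symmetric])
  finally have xab: "x = mult A 2 s a b" by simp
  have one: "pnorm A 2 s (ereal 1) x = (\<Sum>t\<in>T. \<sigma> t * (tr_norm A 2 s (e t))\<^sup>2)"
  proof -
    have "0 \<le> (\<Sum>t\<in>T. \<sigma> t * (tr_norm A 2 s (e t))\<^sup>2)" using D(2)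
        by (intro sum_nonneg) (simp add: less_imp_le)
    then show ?thesis using D(12)[of 1] D(2) by (simp add: less_imp_le cong: sum.cong)
  qed
  have sq: "(tr_norm A 2 s a)\<^sup>2 = pnorm A 2 s (ereal 1) x" "(tr_norm A 2 s b)\<^sup>2
      = pnorm A 2 s (ereal 1) x"
    unfolding a_def b_def box2.polar_norms[OF P] one
    by (intro sum.cong HOL.refl; use D(2) in \<open>simp add: less_imp_le\<close>)+
  then have "tr_norm A 2 s a = tr_norm A 2 s b" using ab by (metis power2_eq_imp_eq tr_norm_nonneg)
  then have "tr_norm A 2 s a * tr_norm A 2 s b = pnorm A 2 s (ereal 1) x" using sq(1)
      by (simp add: power2_eq_square)
  then have "tr_norm A 2 (opp s) (mult A 2 (opp s) (fourier A s x) y)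
      \<le> pnorm A 2 s (ereal 1) x / delta A * tr_norm A 2 (opp s) y"
    if "y \<in> box A 2 (opp s)" for y
    using fourier_product_mult_bound[OF ab that] unfolding xab by simp
  moreover have "0 \<le> pnorm A 2 s (ereal 1) x" unfolding sq(1)[symmetric] by simp
  ultimately show ?thesis unfolding box2.pnorm_infinity using delta_pos by (intro box2.op_norm_le) auto
qed

text \<open>Plancherel's theorem, and the Hoelder inequality for the total weight \<open>\<delta>\<^sup>2\<close>.\<close>

lemma fourier_pnorm_le_two:
  assumes x: "x \<in> box A 2 s" and q: "0 < q" "q \<le> 2"
  shows "pnorm A 2 (opp s) (ereal q) (fourier A s x)
      \<le> delta A powr (2 / q - 1) * pnorm A 2 s (ereal 2) x"
proof -
  let ?y = "fourier A s x" and ?t = "opp s"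
  have y: "?y \<in> box A 2 ?t" by (rule fourier_closed[OF x])
  obtain T \<sigma> v e where P: "box2.polar ?t ?y T \<sigma> v e" using box2.ex_polar[OF y] by blast
  note D = box2.polarD[OF P]
  have W: "(\<Sum>t\<in>T. (tr_norm A 2 ?t (e t))\<^sup>2) \<le> (delta A)\<^sup>2" using D(11) tr_one2[of ?t] by simp
  have "pnorm A 2 ?t (ereal q) ?y = (\<Sum>t\<in>T. \<sigma> t powr q * (tr_norm A 2 ?t (e t))\<^sup>2) powr (1 / q)"
    by (rule D(12)[OF q(1)])
  also have "\<dots> \<le> ((delta A)\<^sup>2) powr (1 / q - 1 / 2) * sqrt (\<Sum>t\<in>T. (\<sigma> t)\<^sup>2 * (tr_norm A 2 ?t (e t))\<^sup>2)"
    by (rule weighted_power_sum_Hoelder[OF D(1) D(2) D(6) W q])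
  also have "(\<Sum>t\<in>T. (\<sigma> t)\<^sup>2 * (tr_norm A 2 ?t (e t))\<^sup>2) = (tr_norm A 2 ?t ?y)\<^sup>2"
    using box2.polar_norms(1)[OF P, of "\<lambda>t. of_real (\<sigma> t)"] D(10) by simp
  also have "((delta A)\<^sup>2) powr (1 / q - 1 / 2) = delta A powr (2 / q - 1)"
  proof -
    have "(delta A)\<^sup>2 = delta A powr 2" using delta_pos by simp
    then show ?thesis using q by (simp only: powr_powr) (simp add: algebra_simps)
  qed
  also have "sqrt ((tr_norm A 2 ?t ?y)\<^sup>2) = pnorm A 2 s (ereal 2) x"
    using box2.pnorm_two[OF x] tr_norm_fourier[OF x] tr_norm_nonneg[OF y] by simp
  finally show ?thesis .
qed

text \<open>
  Riesz-Thorin interpolation between \<open>(1, \<infinity>)\<close> and \<open>(2, 2)\<close>, written out. Let \<open>\<sigma>\<close> and \<open>\<rho>\<close> be the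
  singular values of \<open>x\<close> and \<open>y = \<FF>(x)\<close>, and let \<open>X\<close> and \<open>Y\<close> be the powers \<open>\<parallel>x\<parallel>\<^sub>p\<^sup>p\<close> and \<open>\<parallel>y\<parallel>\<^sub>q\<^sup>q\<close>.
  Replacing \<open>\<sigma>\<close> by \<open>\<sigma>\<close> to the power \<open>\<alpha>(z) = p (1 - z / 2)\<close>, and \<open>\<rho>\<close> by \<open>\<rho>\<close> to the power
  \<open>\<beta>(z) = q (1 - z / 2)\<close> in the element that is paired with it, gives an entire function \<open>G\<close>, a
  finite sum of exponentials. On the line \<open>Re z = 0\<close> both elements factorize into products of
  elements of norm \<open>\<surd>X\<close> and \<open>\<surd>Y\<close>, so the diagrammatic bound gives \<open>X Y / \<delta>\<close>; on the line \<open>Re z = 1\<close>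
  Plancherel's theorem gives \<open>\<surd>(X Y)\<close>. At \<open>z = 2 / q\<close> the exponents are \<open>1\<close> and \<open>q - 1\<close>, and
  \<open>G = Y\<close>.
\<close>

lemma Hausdorff_Young:
  assumes x: "x \<in> box A 2 s" and q: "2 < q"
  shows "pnorm A 2 (opp s) (ereal q) (fourier A s x)
      \<le> delta A powr (2 / q - 1) * pnorm A 2 s (ereal (q / (q - 1))) x"
proof -
  let ?t = "opp s" and ?F = "fourier A s"
  let ?y = "?F x" and ?d = "delta A"
  define p where "p = q / (q - 1)"
  have p: "1 < p" "1 / p = 1 - 1 / q" "0 < p" using q by (simp_all add: p_def field_simps)
  have y: "?y \<in> box A 2 ?t" by (rule fourier_closed[OF x])
  obtain T \<sigma> v e where P: "box2.polar s x T \<sigma> v e" using box2.ex_polar[OF x] by blast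
  obtain T' \<rho> v' e' where P': "box2.polar ?t ?y T' \<rho> v' e'" using box2.ex_polar[OF y] by blast
  note D = box2.polarD[OF P] and D' = box2.polarD[OF P']
  define w w' where "w t = (tr_norm A 2 s (e t))\<^sup>2" and "w' u = (tr_norm A 2 ?t (e' u))\<^sup>2" for t u
  define X where "X = (\<Sum>t\<in>T. \<sigma> t powr p * w t)"
  define Y where "Y = (\<Sum>u\<in>T'. \<rho> u powr q * w' u)"
  have px: "pnorm A 2 s (ereal p) x = X powr (1 / p)" unfolding X_def w_def by (rule D(12)[OF p(3)])
  have py: "pnorm A 2 ?t (ereal q) ?y = Y powr (1 / q)" unfolding Y_def w'_def
      by (rule D'(12)) (use q in simp)
  show ?thesis
  proof (cases "T' = {}")
    case True
    then show ?thesis unfolding py p_def[symmetric] px by (simp add: Y_def)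
  next
    case False
    have Y: "0 < Y" unfolding Y_def w'_def using D'(2,6)
        by (intro sum_pos D'(1) False mult_pos_pos) force+
    have "T \<noteq> {}"
    proof
      assume "T = {}"
      then have "x = 0" using D(10) by simp
      then have "?y = 0" using fourier_smul[OF zero_closed, of s 0] by simp
      then show False using py pnorm_zero[of q ?t] q Y by simp
    qed
    then have X: "0 < X" unfolding X_def w_def using D(2,6) by (intro sum_pos D(1) mult_pos_pos) force+
    define \<alpha> \<beta> :: "complex \<Rightarrow> complex" where "\<alpha> z = of_real p * (1 - z / 2)" and "\<beta> z
        = of_real q * (1 - z / 2)" for z
    \<comment> \<open>The power with complex exponent \<open>c\<close> of the positive number \<open>l t\<close>.\<close>
    define m where "m c l t = exp (c * of_real (ln (l t)))"
        for c :: complex and l :: "real \<Rightarrow> real" and t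
    have norm_m: "(cmod (m c l t))\<^sup>2 = l t powr (2 * Re c)" if "0 < l t" for c l t
      using that by (simp add: m_def powr_def power2_eq_square exp_add[symmetric])
    have m_real: "m (of_real c) l t = of_real (l t powr c)" if "0 < l t" for c l t
      using that by (simp add: m_def powr_def exp_of_real[symmetric] of_real_mult[symmetric] del:
          of_real_mult)
    have m_mult: "m c l t * m c' l t = m (c + c') l t" for c c' l t
      by (simp add: m_def exp_add[symmetric] algebra_simps)
    have m_cnj: "cnj (m c l t) = m (cnj c) l t" for c l t
      by (simp add: m_def exp_cnj)
    define comb where "comb c = (\<Sum>t\<in>T. smul A (m c \<sigma> t) (v t))" for c
    define comb' where "comb' c = (\<Sum>u\<in>T'. smul A (m c \<rho> u) (v' u))" for c
    have comb_in: "comb c \<in> box A 2 s" "comb' c \<in> box A 2 ?t" for c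
      unfolding comb_def comb'_def using D(3) D'(3) by (intro box2.sum_in box2.smul_in; blast)+
    have norm_comb: "(tr_norm A 2 s (comb c))\<^sup>2 = X" if "2 * Re c = p" for c
      unfolding comb_def box2.polar_norms(1)[OF P] X_def
      by (intro sum.cong HOL.refl) (use that D(2) in \<open>simp add: norm_m w_def\<close>)
    have norm_comb': "(tr_norm A 2 ?t (comb' c))\<^sup>2 = Y" if "2 * Re c = q" for c
      unfolding comb'_def box2.polar_norms(1)[OF P'] Y_def
      by (intro sum.cong HOL.refl) (use that D'(2) in \<open>simp add: norm_m w'_def\<close>)
    define b where "b = (\<Sum>t\<in>T. smul A (m (of_real (p / 2)) \<sigma> t) (e t))"
    define b' where "b' = (\<Sum>u\<in>T'. smul A (m (of_real (q / 2)) \<rho> u) (e' u))"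
    have b_in: "b \<in> box A 2 s" "b' \<in> box A 2 ?t"
      unfolding b_def b'_def using D(4) D'(4) by (intro box2.sum_in box2.smul_in; blast)+
    have norm_b: "(tr_norm A 2 s b)\<^sup>2 = X" "(tr_norm A 2 ?t b')\<^sup>2 = Y"
      unfolding b_def b'_def box2.polar_norms(2)[OF P] box2.polar_norms(2)[OF P'] X_def Y_def
      by (intro sum.cong HOL.refl; use D(2) D'(2) in \<open>simp add: norm_m w_def w'_def\<close>)+
    have split: "comb (c + of_real (p / 2)) = mult A 2 s (comb c) b"
      "comb' (c + of_real (q / 2)) = mult A 2 ?t (comb' c) b'" for c
      unfolding comb_def comb'_def b_def b'_def box2.polar_product[OF P] box2.polar_product[OF P']
          m_mult by simp_all
    \<comment> \<open>The conjugate makes \<open>G\<close> holomorphic, since the adjoint conjugates coefficients.\<close>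
    define G where "G z = tr A 2 ?t (mult A 2 ?t (adj A 2 ?t (comb' (cnj (\<beta> z)))) (?F (comb (\<alpha>
        z))))" for z
    define \<kappa> where "\<kappa> t u = tr A 2 ?t (mult A 2 ?t (adj A 2 ?t (v' u)) (?F (v t)))" for t u
    have G: "G z = (\<Sum>t\<in>T. \<Sum>u\<in>T'. m (\<alpha> z) \<sigma> t * m (\<beta> z) \<rho> u * \<kappa> t u)" for z
    proof -
      have F_sum: "?F (\<Sum>t\<in>S. smul A (c t) (v t)) = (\<Sum>t\<in>S. smul A (c t) (?F (v t)))"
          if "finite S" "S \<subseteq> T" for c S
        using that
      proof (induction S)
        case empty
        then show ?case using fourier_smul[OF zero_closed, of s 0] by simp
      next
        case (insert t S)
        then have "v t \<in> box A 2 s" "(\<Sum>t\<in>S. smul A (c t) (v t)) \<in> box A 2 s"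
          using D(3) by (auto intro!: box2.sum_in box2.smul_in)
        then show ?case using insert by (simp add: fourier_add fourier_smul box2.smul_in)
      qed
      have adj_sum: "adj A 2 ?t (comb' (cnj (\<beta> z))) = (\<Sum>u\<in>T'. smul A (m (\<beta> z) \<rho> u) (adj A 2 ?t (v' u)))"
        unfolding comb'_def using D'(3) by (subst box2.adj_sum) (auto intro!: sum.cong simp:
            adj_smul box2.smul_in m_cnj)
      have summand: "tr A 2 ?t (mult A 2 ?t (adj A 2 ?t (comb' (cnj (\<beta> z)))) (smul A c (?F (v t))))
          = (\<Sum>u\<in>T'. c * m (\<beta> z) \<rho> u * \<kappa> t u)" if t: "t \<in> T" for c t
        unfolding adj_sum \<kappa>_def using D'(3) fourier_closed[OF D(3)[OF t]]
        by (subst box2.mult_sum_left)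
          (auto intro!: sum.cong simp: box2.trace_sum box2.in_carrier mult_smul_left mult_smul_right
              tr_smul)
      show ?thesis
        unfolding G_def using F_sum[OF D(1) order_refl] fourier_closed[OF D(3)] adj_closed[OF
            comb_in(2)]
        by (subst comb_def) (simp add: box2.mult_sum_right box2.trace_sum box2.in_carrier summand
            cong: sum.cong)
    qed
    have hol: "G holomorphic_on UNIV"
      unfolding G m_def \<alpha>_def \<beta>_def by (intro holomorphic_intros) auto
    have left: "cmod (G z) \<le> X * Y / ?d" if "Re z = 0" for z
    proof -
      define a a' where "a = comb (\<alpha> z - of_real (p / 2))" and "a'
          = comb' (cnj (\<beta> z) - of_real (q / 2))"
      have "comb (\<alpha> z) = mult A 2 s a b" "comb' (cnj (\<beta> z)) = mult A 2 ?t a' b'"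
        using split(1)[of "\<alpha> z - of_real (p / 2)"] split(2)[of "cnj (\<beta> z) - of_real (q / 2)"]
            by (simp_all add: a_def a'_def)
      then have "cmod (G z) \<le> tr_norm A 2 s a * tr_norm A 2 s b * tr_norm A 2 ?t a' * tr_norm A 2 ?t
          b' / ?d"
        unfolding G_def using fourier_product_bound[OF _ b_in(1) _ b_in(2)] comb_in
            by (simp add: a_def a'_def)
      moreover have "tr_norm A 2 s a = sqrt X" "tr_norm A 2 ?t a' = sqrt Y"
        unfolding a_def a'_def using that comb_in
        by (simp_all add: norm_comb norm_comb' \<alpha>_def \<beta>_def real_sqrt_unique[symmetric]
            tr_norm_nonneg algebra_simps)
      moreover have "tr_norm A 2 s b = sqrt X" "tr_norm A 2 ?t b' = sqrt Y"
        using norm_b b_in by (simp_all add: real_sqrt_unique[symmetric] tr_norm_nonneg)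
      ultimately show ?thesis using X Y by (simp add: mult_ac)
    qed
    have right: "cmod (G z) \<le> sqrt (X * Y)" if "Re z = 1" for z
    proof -
      have "cmod (G z) \<le> tr_norm A 2 ?t (?F (comb (\<alpha> z))) * tr_norm A 2 ?t (comb' (cnj (\<beta> z)))"
        unfolding G_def using comb_in fourier_closed by (intro trace_Cauchy_Schwarz) auto
      moreover have "tr_norm A 2 s (comb (\<alpha> z)) = sqrt X" "tr_norm A 2 ?t (comb' (cnj (\<beta> z))) = sqrt Y"
        using that comb_in by (simp_all add: norm_comb norm_comb' \<alpha>_def \<beta>_def
            real_sqrt_unique[symmetric] tr_norm_nonneg)
      ultimately show ?thesis using tr_norm_fourier[OF comb_in(1)] by (simp add: real_sqrt_mult)
    qed
    have bounded: "cmod (G z) \<le> (\<Sum>t\<in>T. \<Sum>u\<in>T'. exp (p * \<bar>ln (\<sigma> t)\<bar>) * exp (q * \<bar>ln (\<rho> u)\<bar>) * cmod (\<kappa>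
        t u))"
      if z: "0 \<le> Re z" "Re z \<le> 1" for z
    proof -
      have bd: "cmod (m (of_real c * (1 - z / 2)) l t) \<le> exp (c * \<bar>ln (l t)\<bar>)" if c: "0 \<le> c" for c l t
      proof -
        have "(1 - Re z / 2) * ln (l t) \<le> (1 - Re z / 2) * \<bar>ln (l t)\<bar>" using z
            by (intro mult_left_mono) auto
        also have "\<dots> \<le> 1 * \<bar>ln (l t)\<bar>" using z by (intro mult_right_mono) auto
        finally have "(1 - Re z / 2) * ln (l t) \<le> \<bar>ln (l t)\<bar>" by simp
        then show ?thesis using mult_left_mono[OF _ c] by (simp add: m_def mult.assoc)
      qed
      show ?thesis
        unfolding G \<alpha>_def \<beta>_def using p q
        by (intro order_trans[OF norm_sum] sum_mono) (auto simp: norm_mult intro!: mult_mono bd)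
    qed
    define \<theta> where "\<theta> = 2 / q"
    have \<theta>: "0 \<le> \<theta>" "\<theta> \<le> 1" using q by (simp_all add: \<theta>_def)
    have "\<alpha> (of_real \<theta>) = of_real 1" "\<beta> (of_real \<theta>) = of_real (q - 1)"
    proof -
      have "p * (1 - \<theta> / 2) = 1" "q * (1 - \<theta> / 2) = q - 1" using p q
          by (simp_all add: \<theta>_def p_def field_simps)
      then show "\<alpha> (of_real \<theta>) = of_real 1" "\<beta> (of_real \<theta>) = of_real (q - 1)"
        unfolding \<alpha>_def \<beta>_def by (metis of_real_1 of_real_diff of_real_divide of_real_mult
            of_real_numeral)+
    qed
    moreover have "comb (of_real 1) = (\<Sum>t\<in>T. smul A (of_real (\<sigma> t)) (v t))"
      unfolding comb_def by (intro sum.cong HOL.refl) (use D(2) in \<open>simp add: m_real less_imp_le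
          del: of_real_1\<close>)
    then have "comb (of_real 1) = x" unfolding D(10)[symmetric] .
    ultimately have "G (of_real \<theta>) = tr A 2 ?t (mult A 2 ?t (adj A 2 ?t (comb' (of_real (q - 1))))
        (\<Sum>u\<in>T'. smul A (of_real (\<rho> u)) (v' u)))"
      unfolding G_def using D'(10) by simp
    also have "\<dots> = (\<Sum>u\<in>T'. cnj (m (of_real (q - 1)) \<rho> u) * of_real (\<rho> u) * of_real (w' u))"
      unfolding comb'_def w'_def by (rule box2.polar_pairing[OF P'])
    also have "\<dots> = of_real Y"
      unfolding Y_def of_real_sum
    proof (intro sum.cong HOL.refl)
      fix u assume "u \<in> T'"
      then have \<rho>: "0 < \<rho> u" by (rule D'(2))
      have "\<rho> u powr (q - 1) * \<rho> u = \<rho> u powr q" using \<rho> powr_add[of "\<rho> u" "q - 1" 1] by simp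
      then show "cnj (m (of_real (q - 1)) \<rho> u) * of_real (\<rho> u) * of_real (w' u)
          = of_real (\<rho> u powr q * w' u)"
        unfolding m_real[where l = \<rho> and t = u, OF \<rho>] by (simp flip: of_real_mult)
    qed
    finally have "Y = cmod (G (of_real \<theta>))" using Y by simp
    also have "\<dots> \<le> (X * Y / ?d) powr (1 - \<theta>) * sqrt (X * Y) powr \<theta>"
      by (rule three_lines[OF hol bounded left right _ _ \<theta>]) (use X Y delta_pos in auto)
    also have "\<dots> = ?d powr (\<theta> - 1) * (X powr (1 / p) * Y powr (1 / p))"
    proof -
      let ?Z = "X * Y"
      have Z: "0 < ?Z" using X Y by simp
      have "1 - \<theta> + \<theta> / 2 = 1 / p" using p by (simp add: \<theta>_def)
      then have "?Z powr (1 - \<theta>) * ?Z powr (\<theta> / 2) = ?Z powr (1 / p)"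
          by (simp only: powr_add[symmetric])
      moreover have "sqrt ?Z powr \<theta> = ?Z powr (\<theta> / 2)"
      proof -
        have "sqrt ?Z = ?Z powr (1 / 2)" by (rule powr_half_sqrt[symmetric]) (use Z in simp)
        then have "sqrt ?Z powr \<theta> = ?Z powr (1 / 2 * \<theta>)" by (simp only: powr_powr)
        then show ?thesis by simp
      qed
      moreover have "(?Z / ?d) powr (1 - \<theta>) = ?d powr (\<theta> - 1) * ?Z powr (1 - \<theta>)"
      proof -
        have "(?Z / ?d) powr (1 - \<theta>) = ?Z powr (1 - \<theta>) / ?d powr (1 - \<theta>)"
          by (rule powr_divide)
        also have "\<dots> = ?Z powr (1 - \<theta>) * ?d powr (- (1 - \<theta>))" by (simp only: powr_minus divide_inverse)
        finally show ?thesis by (simp only: minus_diff_eq mult.commute)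
      qed
      ultimately have "(?Z / ?d) powr (1 - \<theta>) * sqrt ?Z powr \<theta> = ?d powr (\<theta> - 1) * ?Z powr (1 / p)"
        by (simp only: mult.assoc)
      then show ?thesis using X Y by (simp add: powr_mult)
    qed
    finally have "Y powr (1 / q) * Y powr (1 / p) \<le> ?d powr (\<theta> - 1) * X powr (1 / p) * Y powr (1 / p)"
      using Y p(2) by (simp add: powr_add[symmetric] mult.assoc)
    then show ?thesis unfolding py p_def[symmetric] px using Y by (simp add: \<theta>_def)
  qed
qed

end

section \<open>Extremal elements\<close>

context irreducible_subfactor_planar_algebra
begin

text \<open>
  Since \<open>x = x f\<close> and \<open>\<parallel>f\<parallel> = 1\<close>, the operator norm of \<open>\<FF>(x)\<close> is at most \<open>\<surd>c / \<delta>\<close>. On the other hand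
  the trace of \<open>\<FF>(x)\<^sup>* \<FF>(x)\<close> is \<open>\<parallel>x\<parallel>\<^sup>2 = c\<close>, the largest value compatible with this bound, because
  \<open>1\<close> has trace \<open>\<delta>\<^sup>2\<close>.
\<close>

lemma fourier_square_of_rank_one:
  assumes x: "x \<in> box A 2 s" and f: "is_projection A 2 s f" "tr A 2 s f = 1"
    and sq: "mult A 2 s (adj A 2 s x) x = smul A (of_real c) f"
  shows "mult A 2 (opp s) (adj A 2 (opp s) (fourier A s x)) (fourier A s x)
      = smul A (of_real (c / (delta A)\<^sup>2)) (one A 2 (opp s))"
    and "c = (tr_norm A 2 s x)\<^sup>2"
proof -
  let ?t = "opp s" and ?g = "fourier A s x"
  note P = box2.projectionD[OF f(1)]
  have g: "?g \<in> box A 2 ?t" by (rule fourier_closed[OF x])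
  have "of_real ((tr_norm A 2 s x)\<^sup>2) = complex_of_real c"
    using tr_form_self[OF x] f(2) tr_smul[OF P(1)] by (simp add: sq)
  then show c: "c = (tr_norm A 2 s x)\<^sup>2" by (simp only: of_real_eq_iff)
  have norm_f: "tr_norm A 2 s f = 1" by (rule box2.norm_trace_one_projection[OF f])
  have xf: "mult A 2 s x f = x" by (rule box2.mult_support[OF x f(1) sq])
  have bound: "(tr_norm A 2 ?t (mult A 2 ?t ?g y))\<^sup>2 \<le> c / (delta A)\<^sup>2 * (tr_norm A 2 ?t y)\<^sup>2"
      if y: "y \<in> box A 2 ?t" for y
  proof -
    have "tr_norm A 2 ?t (mult A 2 ?t ?g y) \<le> tr_norm A 2 s x / delta A * tr_norm A 2 ?t y"
      using fourier_product_mult_bound[OF x P(1) y] by (simp add: xf norm_f)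
    then have "(tr_norm A 2 ?t (mult A 2 ?t ?g y))\<^sup>2 \<le> (tr_norm A 2 s x / delta A * tr_norm A 2 ?t y)\<^sup>2"
      using g y mult_closed by (intro power_mono) auto
    then show ?thesis by (simp add: c power_mult_distrib power_divide)
  qed
  let ?n = "mult A 2 ?t (adj A 2 ?t ?g) ?g"
  have n: "?n \<in> box A 2 ?t" using g by (simp add: mult_closed adj_closed)
  define h where "h = smul A (of_real (c / (delta A)\<^sup>2)) (one A 2 ?t) - ?n"
  have one: "smul A a (one A 2 ?t) \<in> box A 2 ?t" for a by (intro box2.smul_in one_closed)
  have "h = 0"
  proof (rule box2.positive_trace_zero)
    show "h \<in> box A 2 ?t" unfolding h_def using one n by (rule box2.diff_in)
    show "adj A 2 ?t h = h"
      unfolding h_def using one n g by (simp add: box2.adj_diff adj_smul one_closed adj_mult2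
          adj_adj adj_closed)
    show "tr A 2 ?t h = 0"
      unfolding h_def using one n tr_form_self[OF g] tr_norm_fourier[OF x] delta_pos
      by (simp add: box2.trace_diff tr_smul one_closed tr_one2 c)
    fix y assume y: "y \<in> box A 2 ?t"
    have "mult A 2 ?t (mult A 2 ?t (adj A 2 ?t y) h) y
        = smul A (of_real (c / (delta A)\<^sup>2)) (mult A 2 ?t (adj A 2 ?t y) y)
          - mult A 2 ?t (adj A 2 ?t (mult A 2 ?t ?g y)) (mult A 2 ?t ?g y)"
      unfolding h_def using one n y g
      by (simp add: box2.mult_diff_left box2.mult_diff_right mult_smul_left mult_smul_right
          mult_one_right2 mult_assoc
          adj_mult2 one_closed adj_closed mult_closed box2.smul_in)
    then have "tr A 2 ?t (mult A 2 ?t (mult A 2 ?t (adj A 2 ?t y) h) y)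
        = of_real (c / (delta A)\<^sup>2 * (tr_norm A 2 ?t y)\<^sup>2 - (tr_norm A 2 ?t (mult A 2 ?t ?g y))\<^sup>2)"
      using tr_form_self[OF y] tr_form_self[OF mult_closed[OF g y]] y g
      by (simp add: box2.trace_diff tr_smul mult_closed adj_closed box2.smul_in)
    then show "0 \<le> Re (tr A 2 ?t (mult A 2 ?t (mult A 2 ?t (adj A 2 ?t y) h) y))" using bound[OF y]
        by simp
  qed
  then show "?n = smul A (of_real (c / (delta A)\<^sup>2)) (one A 2 ?t)" by (simp add: h_def)
qed

text \<open>
  Every \<open>w\<close> with \<open>w f = w\<close> has \<open>w\<^sup>* w\<close> in the corner of \<open>f\<close>, so \<open>\<FF>(w)\<close> is a multiple of a unitary.
  Polarization turns this into \<open>\<FF>(f)\<^sup>* \<FF>(z) = 0\<close> for the component \<open>z\<close> of \<open>x\<close> orthogonal to \<open>f\<close>. As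
  \<open>\<FF>(f)\<close> is invertible, \<open>\<FF>(z) = 0\<close>. In terms of bimodules: if \<open>X\<close> is irreducible, an invertible
  bimodule occurs in the tensor product of \<open>X\<close> and its dual at most once.
\<close>

lemma trace_one_left_ideal:
  assumes x: "x \<in> box A 2 s" and f: "is_projection A 2 s f" "tr A 2 s f = 1" and xf: "mult A 2 s x f
      = x"
  shows "\<exists>c. x = smul A c f"
proof -
  let ?t = "opp s" and ?m = "mult A 2 s" and ?F = "fourier A s" and ?d = "delta A"
  let ?m' = "mult A 2 (opp s)" and ?adj = "adj A 2 (opp s)" and ?one = "one A 2 (opp s)"
  note P = box2.projectionD[OF f(1)]
  have square: "?m' (?adj (?F w)) (?F w) = smul A (of_real ((tr_norm A 2 s w)\<^sup>2 / ?d\<^sup>2)) ?one"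
    if w: "w \<in> box A 2 s" "?m w f = w" for w
  proof -
    have "\<exists>c::real. ?m (adj A 2 s w) w = smul A (of_real c) f"
    proof (rule box2.corner_self_adjoint[OF projection_norm_ge_one f])
      show "?m (adj A 2 s w) w \<in> box A 2 s" using w by (simp add: mult_closed adj_closed)
      show "adj A 2 s (?m (adj A 2 s w) w) = ?m (adj A 2 s w) w" using w
          by (simp add: adj_mult2 adj_adj adj_closed)
      show "?m (?m (adj A 2 s w) w) f = ?m (adj A 2 s w) w" using w P
          by (simp add: mult_assoc adj_closed)
    qed
    then obtain c :: real where "?m (adj A 2 s w) w = smul A (of_real c) f" ..
    from fourier_square_of_rank_one[OF w(1) f this] show ?thesis by simp
  qed
  define l where "l = tr A 2 s (?m f x)"
  define z where "z = x - smul A l f"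
  have lf: "smul A l f \<in> box A 2 s" using P(1) by (rule box2.smul_in)
  have z: "z \<in> box A 2 s" "?m z f = z"
    using x lf P xf by (simp_all add: z_def box2.diff_in box2.mult_diff_left mult_smul_left)
  have fz: "tr A 2 s (?m f z) = 0"
    using x lf P f(2) by (simp add: z_def box2.mult_diff_right mult_smul_right box2.trace_diff
        mult_closed tr_smul l_def)
  have zf: "tr A 2 s (?m (adj A 2 s z) f) = 0"
    using trace_form_conj[OF P(1) z(1)] fz P by (simp add: P(2))
  have norm_f: "(tr_norm A 2 s f)\<^sup>2 = 1" using box2.norm_trace_one_projection[OF f] by simp
  have norm: "(tr_norm A 2 s (z + smul A \<omega> f))\<^sup>2 = (tr_norm A 2 s z)\<^sup>2 + (cmod \<omega>)\<^sup>2" for \<omega>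
  proof -
    have wf: "smul A \<omega> f \<in> box A 2 s" using P(1) by (rule box2.smul_in)
    have "?m (adj A 2 s (z + smul A \<omega> f)) (z + smul A \<omega> f)
        = ?m (adj A 2 s z) z + smul A \<omega> (?m (adj A 2 s z) f)
        + (smul A (cnj \<omega>) (?m f z) + smul A (\<omega> * cnj \<omega>) f)"
      using z wf P
      by (simp add: adj_add adj_smul mult_add_left mult_add_right mult_smul_left mult_smul_right
          adj_closed
          box2.smul_in box2.add_in mult_closed V.scale_right_distrib)
    then have "complex_of_real ((tr_norm A 2 s (z + smul A \<omega> f))\<^sup>2)
        = of_real ((tr_norm A 2 s z)\<^sup>2) + \<omega> * cnj \<omega>"
      using tr_form_self[OF box2.add_in[OF z(1) wf]] tr_form_self[OF z(1)] z wf P f(2) fz zf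
      by (simp add: tr_add tr_smul box2.smul_in box2.add_in mult_closed adj_closed)
    also have "\<dots> = of_real ((tr_norm A 2 s z)\<^sup>2 + (cmod \<omega>)\<^sup>2)"
        unfolding of_real_add complex_norm_square by simp
    finally show ?thesis by (simp only: of_real_eq_iff)
  qed
  define g k where "g = ?F f" and "k = ?F z"
  have gk: "g \<in> box A 2 ?t" "k \<in> box A 2 ?t" using P(1) z(1)
      by (simp_all add: g_def k_def fourier_closed)
  have gg: "?m' (?adj g) g = smul A (of_real (1 / ?d\<^sup>2)) ?one" using square[OF P(1,3)] norm_f
      by (simp add: g_def)
  have kk: "?m' (?adj k) k = smul A (of_real ((tr_norm A 2 s z)\<^sup>2 / ?d\<^sup>2)) ?one" using square[OF z]
      by (simp add: k_def)
  have cross: "smul A \<omega> (?m' (?adj k) g) + smul A (cnj \<omega>) (?m' (?adj g) k) = 0" for \<omega>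
  proof -
    have wf: "smul A \<omega> f \<in> box A 2 s" using P(1) by (rule box2.smul_in)
    have wg: "smul A \<omega> g \<in> box A 2 ?t" using gk(1) by (rule box2.smul_in)
    have w: "z + smul A \<omega> f \<in> box A 2 s" "?m (z + smul A \<omega> f) f = z + smul A \<omega> f"
      using z wf P by (simp_all add: box2.add_in mult_add_left mult_smul_left)
    have F: "?F (z + smul A \<omega> f) = k + smul A \<omega> g"
      using z(1) wf P(1) by (simp add: fourier_add fourier_smul g_def k_def)
    have "?m' (?adj (k + smul A \<omega> g)) (k + smul A \<omega> g) = ?m' (?adj k) k + smul A \<omega> (?m' (?adj k) g)
        + (smul A (cnj \<omega>) (?m' (?adj g) k) + smul A (\<omega> * cnj \<omega>) (?m' (?adj g) g))"
      using gk wg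
      by (simp add: adj_add adj_smul mult_add_left mult_add_right mult_smul_left mult_smul_right
          adj_closed
          box2.smul_in box2.add_in mult_closed V.scale_right_distrib)
    moreover have "?m' (?adj (k + smul A \<omega> g)) (k + smul A \<omega> g)
        = ?m' (?adj k) k + smul A (\<omega> * cnj \<omega>) (?m' (?adj g) g)"
    proof -
      have "complex_of_real (((tr_norm A 2 s z)\<^sup>2 + (cmod \<omega>)\<^sup>2) / ?d\<^sup>2)
          = of_real ((tr_norm A 2 s z)\<^sup>2 / ?d\<^sup>2) + (\<omega> * cnj \<omega>) * of_real (1 / ?d\<^sup>2)"
        unfolding complex_norm_square[symmetric] by (simp add: add_divide_distrib)
      then show ?thesis using square[OF w] unfolding F norm kk gg by (simp add: V.scale_left_distrib)
    qed
    ultimately show ?thesis by (simp add: algebra_simps)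
  qed
  have "?m' (?adj g) k = 0"
  proof -
    let ?u = "?m' (?adj k) g" and ?v = "?m' (?adj g) k"
    \<comment> \<open>The values \<open>1\<close> and \<open>\<i>\<close> of \<open>\<omega>\<close> separate the two cross terms.\<close>
    have uv: "?u = - ?v" using cross[of 1] by (simp add: eq_neg_iff_add_eq_0)
    have "smul A \<i> ?u = smul A \<i> ?v" using cross[of \<i>] by simp
    then have "?u = ?v" by simp
    then have "?v = - ?v" using uv by metis
    then have "?v + ?v = 0" by (metis add.right_inverse)
    then have "smul A 2 ?v = 0" using V.scale_left_distrib[of 1 1 ?v] by simp
    then show ?thesis by simp
  qed
  moreover have "?m' g (?adj g) = smul A (of_real (1 / ?d\<^sup>2)) ?one"
    using delta_pos by (intro box2.left_unitary_imp_right_unitary gk(1) gg) simp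
  then have "?m' g (?m' (?adj g) k) = smul A (of_real (1 / ?d\<^sup>2)) k"
    using gk by (simp add: mult_assoc[symmetric] adj_closed mult_smul_left mult_one_left2 one_closed)
  ultimately have "k = 0" using gk(1) delta_pos by simp
  then have "tr_norm A 2 s z = 0"
    using tr_norm_fourier[OF z(1)] box2.norm_eq_zero_iff[OF zero_closed] by (simp add: k_def)
  then have "z = 0" using box2.norm_eq_zero_iff[OF z(1)] by simp
  then show ?thesis by (auto simp: z_def)
qed

text \<open>This excludes partial isometries between different trace-one projections.\<close>

lemma rank_one_imp_multiple:
  assumes x: "x \<in> box A 2 s" and f: "is_projection A 2 s f" "tr A 2 s f = 1"
    and sq: "mult A 2 s (adj A 2 s x) x = smul A (of_real c) f"
  shows "\<exists>c. x = smul A c f"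
  by (rule trace_one_left_ideal[OF x f box2.mult_support[OF x f(1) sq]])

lemma pnorm_fourier_of_multiple:
  assumes f: "is_projection A 2 s f" "tr A 2 s f = 1" and x: "x = smul A c f"
  shows "0 < q \<Longrightarrow> pnorm A 2 (opp s) (ereal q) (fourier A s x) = cmod c * delta A powr (2 / q - 1)"
    and "pnorm A 2 (opp s) \<infinity> (fourier A s x) = cmod c / delta A"
proof -
  note P = box2.projectionD[OF f(1)]
  have xb: "x \<in> box A 2 s" unfolding x using P(1) by (rule box2.smul_in)
  have "mult A 2 s (adj A 2 s x) x = smul A (of_real ((cmod c)\<^sup>2)) f"
    unfolding x complex_norm_square using P
    by (simp add: adj_smul mult_smul_left mult_smul_right box2.smul_in mult.commute)
  from fourier_square_of_rank_one(1)[OF xb f this]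
  have sq: "mult A 2 (opp s) (adj A 2 (opp s) (fourier A s x)) (fourier A s x)
      = smul A (of_real ((cmod c / delta A)\<^sup>2)) (one A 2 (opp s))" by (simp add: power_divide)
  have k: "0 \<le> cmod c / delta A" using delta_pos by simp
  note norms = box2.pnorm_of_scalar_square[OF fourier_closed[OF xb] sq k one2_nonzero]
  show "pnorm A 2 (opp s) \<infinity> (fourier A s x) = cmod c / delta A" by (rule norms(2))
  show "pnorm A 2 (opp s) (ereal q) (fourier A s x) = cmod c * delta A powr (2 / q - 1)" if "0 < q"
    using norms(1)[OF that] delta_pos by (simp add: norm_one2 powr_diff)
qed

text \<open>
  For each \<open>q\<close> the admissible exponents \<open>p\<close> form an interval \<open>(0, r]\<close>; the inequality at the
  endpoint \<open>r\<close> is Plancherel followed by the Hoelder inequality if \<open>q \<le> 2\<close>, the Hausdorff-Young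
  inequality if \<open>2 < q < \<infinity>\<close>, and the bound on the operator norm if \<open>q = \<infinity>\<close>.
\<close>

lemma ex_endpoint_exponent:
  assumes "0 < q"
  shows "\<exists>r>0. (\<forall>s. \<forall>x\<in>box A 2 s. pnorm A 2 (opp s) q (fourier A s x)
        \<le> delta A powr real_of_ereal (2 / q - 1) * pnorm A 2 s (ereal r) x) \<and>
     (\<forall>p>0. 1 / ereal p + 1 / q \<ge> 1 \<longrightarrow> 1 / ereal p \<ge> 1 / 2 \<longrightarrow> p \<le> r) \<and>
     (\<forall>p>0. 1 / ereal p + 1 / q > 1 \<longrightarrow> 1 / ereal p > 1 / 2 \<longrightarrow> p < r)"
proof (cases q)
  case (real q')
  then have q': "0 < q'" using assms by simp
  have expo: "real_of_ereal (2 / q - 1) = 2 / q' - 1" using real q' by (simp add: one_ereal_def)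
  have half: "(1 / ereal p \<ge> 1 / 2) = (1 / p \<ge> 1 / 2)" "(1 / ereal p > 1 / 2) = (1 / p > 1 / 2)"
      if "0 < p" for p
    using that by (simp_all add: one_ereal_def)
  have sum: "(1 / ereal p + 1 / q \<ge> 1) = (1 / p + 1 / q' \<ge> 1)" "(1 / ereal p + 1 / q > 1)
      = (1 / p + 1 / q' > 1)" if "0 < p" for p
    using that q' real by (simp_all add: one_ereal_def)
  show ?thesis
  proof (cases "q' \<le> 2")
    case True
    have "p \<le> 2" if "0 < p" "1 / ereal p \<ge> 1 / 2" for p
      using half(1)[OF that(1)] that by (simp add: field_simps)
    moreover have "p < 2" if "0 < p" "1 / ereal p > 1 / 2" for p
      using half(2)[OF that(1)] that by (simp add: field_simps)
    moreover have "pnorm A 2 (opp s) q (fourier A s x)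
        \<le> delta A powr (2 / q' - 1) * pnorm A 2 s (ereal 2) x"
      if "x \<in> box A 2 s" for s x
      unfolding real by (rule fourier_pnorm_le_two[OF that q' True])
    ultimately show ?thesis
      unfolding expo by (intro exI[of _ "2 :: real"] conjI allI ballI impI) (assumption | simp)+
  next
    case False
    then have q2: "2 < q'" by simp
    have "p \<le> q' / (q' - 1)" if "0 < p" "1 / ereal p + 1 / q \<ge> 1" for p
      using sum(1)[OF that(1)] that q2 by (simp add: field_simps)
    moreover have "p < q' / (q' - 1)" if "0 < p" "1 / ereal p + 1 / q > 1" for p
      using sum(2)[OF that(1)] that q2 by (simp add: field_simps)
    moreover have "0 < q' / (q' - 1)" using q2 by simp
    moreover have "pnorm A 2 (opp s) q (fourier A s x)
        \<le> delta A powr (2 / q' - 1) * pnorm A 2 s (ereal (q' / (q' - 1))) x"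
      if "x \<in> box A 2 s" for s x
      unfolding real by (rule Hausdorff_Young[OF that q2])
    ultimately show ?thesis
      unfolding expo by (intro exI[of _ "q' / (q' - 1)"] conjI allI ballI impI) assumption+
  qed
next
  case PInf
  have "delta A powr real_of_ereal (2 / q - 1) = 1 / delta A"
    using delta_pos PInf by (simp add: one_ereal_def powr_minus_divide)
  then show ?thesis
    using fourier_op_norm_le PInf by (intro exI[of _ 1]) (auto simp: one_ereal_def divide_simps)
next
  case MInf
  then show ?thesis using assms by simp
qed

lemma real_exponent:
  fixes p :: ereal
  assumes "0 < p" "1 / p \<ge> 1 / 2"
  obtains p' where "p = ereal p'" "0 < p'"
  using assms by (cases p) (auto simp: one_ereal_def)

lemma fourier_extremal_of_multiple:
  assumes "multiple_of_trace_one_projection A s x" and "0 < p" "0 < q" "1 / p \<ge> 1 / 2"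
  shows "fourier_extremal A s p q x"
proof -
  obtain c f where f: "is_projection A 2 s f" "tr A 2 s f = 1" "x = smul A c f"
    using assms(1) unfolding multiple_of_trace_one_projection_def by blast
  obtain p' where p: "p = ereal p'" "0 < p'" using real_exponent[OF assms(2,4)] .
  have px: "pnorm A 2 s p x = cmod c" unfolding p(1) f(3)
      by (rule box2.pnorm_multiple_projection[OF f(1,2) p(2)])
  show ?thesis
  proof (cases q)
    case (real q')
    then show ?thesis
      using pnorm_fourier_of_multiple(1)[OF f, of q'] assms(3) px
      by (simp add: fourier_extremal_def one_ereal_def)
  next
    case PInf
    then show ?thesis
      using pnorm_fourier_of_multiple(2)[OF f] px delta_pos
      by (simp add: fourier_extremal_def one_ereal_def powr_minus_divide)
  qed (use assms in simp)
qed

lemma multiple_of_fourier_extremal: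
  assumes x: "x \<in> box A 2 s" and pq: "0 < p" "0 < q" "1 / p + 1 / q > 1" "1 / p > 1 / 2"
    and extremal: "fourier_extremal A s p q x"
  shows "multiple_of_trace_one_projection A s x"
proof (cases "x = 0")
  case True
  obtain e where "is_projection A 2 s e" "tr A 2 s e = 1" using ex_trace_one_projection by blast
  then show ?thesis unfolding multiple_of_trace_one_projection_def using True
      by (intro exI[of _ 0] exI[of _ e]) simp
next
  case False
  obtain p' where p: "p = ereal p'" "0 < p'" using real_exponent[OF pq(1) less_imp_le[OF pq(4)]] .
  obtain r where r: "0 < r" "p' < r"
    and le: "pnorm A 2 (opp s) q (fourier A s x)
        \<le> delta A powr real_of_ereal (2 / q - 1) * pnorm A 2 s (ereal r) x"
    using ex_endpoint_exponent[OF pq(2)] p pq(3,4) x by blast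
  have "delta A powr real_of_ereal (2 / q - 1) * pnorm A 2 s (ereal p') x
      \<le> delta A powr real_of_ereal (2 / q - 1) * pnorm A 2 s (ereal r) x"
    using le extremal unfolding fourier_extremal_def p(1) by simp
  then have "pnorm A 2 s (ereal p') x \<le> pnorm A 2 s (ereal r) x" using delta_pos by simp
  then have "pnorm A 2 s (ereal r) x = pnorm A 2 s (ereal p') x"
    using pnorm_antimono(1)[OF x p(2) less_imp_le[OF r(2)]] by simp
  then obtain c f where f: "is_projection A 2 s f" "tr A 2 s f = 1" "mult A 2 s (adj A 2 s x) x
      = smul A (of_real c) f"
    using pnorm_antimono(2)[OF x p(2) less_imp_le[OF r(2)] r(2) False] by blast
  then obtain d where "x = smul A d f" using rank_one_imp_multiple[OF x f] by blast
  then show ?thesis unfolding multiple_of_trace_one_projection_def using f by blast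
qed

lemma fourier_const_eq:
  assumes pq: "0 < p" "0 < q" "1 / p + 1 / q \<ge> 1" "1 / p \<ge> 1 / 2"
  shows "fourier_const A s p q = ereal (delta A powr real_of_ereal (2 / q - 1))"
  unfolding fourier_const_def
proof (rule antisym)
  obtain p' where p: "p = ereal p'" "0 < p'" using real_exponent[OF pq(1,4)] .
  show "(SUP x\<in>{x \<in> box A 2 s. pnorm A 2 s p x = 1}. ereal (pnorm A 2 (opp s) q (fourier A s x)))
      \<le> ereal (delta A powr real_of_ereal (2 / q - 1))"
  proof (rule SUP_least)
    fix x assume "x \<in> {x \<in> box A 2 s. pnorm A 2 s p x = 1}"
    then have x: "x \<in> box A 2 s" "pnorm A 2 s (ereal p') x = 1" using p by auto
    obtain r where r: "p' \<le> r"
      and le: "pnorm A 2 (opp s) q (fourier A s x)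
          \<le> delta A powr real_of_ereal (2 / q - 1) * pnorm A 2 s (ereal r) x"
      using ex_endpoint_exponent[OF pq(2)] p pq(3,4) x(1) by blast
    have "pnorm A 2 s (ereal r) x \<le> 1" using pnorm_antimono(1)[OF x(1) p(2) r] x(2) by simp
    then have "delta A powr real_of_ereal (2 / q - 1) * pnorm A 2 s (ereal r) x
        \<le> delta A powr real_of_ereal (2 / q - 1) * 1"
      by (intro mult_left_mono) auto
    then show "ereal (pnorm A 2 (opp s) q (fourier A s x))
        \<le> ereal (delta A powr real_of_ereal (2 / q - 1))"
      using le by simp
  qed
  obtain e where e: "is_projection A 2 s e" "tr A 2 s e = 1" using ex_trace_one_projection by blast
  have one: "pnorm A 2 s p e = 1"
    unfolding p(1) using box2.pnorm_multiple_projection[OF e p(2), of 1] by simp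
  have "multiple_of_trace_one_projection A s e"
    unfolding multiple_of_trace_one_projection_def using e by (intro exI[of _ 1] exI[of _ e]) simp
  from fourier_extremal_of_multiple[OF this pq(1,2,4)]
  have "pnorm A 2 (opp s) q (fourier A s e) = delta A powr real_of_ereal (2 / q - 1)"
    by (simp add: fourier_extremal_def one)
  moreover have "e \<in> {x \<in> box A 2 s. pnorm A 2 s p x = 1}" using one box2.projectionD(1)[OF e(1)]
      by simp
  ultimately show "ereal (delta A powr real_of_ereal (2 / q - 1))
      \<le> (SUP x\<in>{x \<in> box A 2 s. pnorm A 2 s p x = 1}. ereal (pnorm A 2 (opp s) q (fourier A s x)))"
    by (metis (no_types, lifting) SUP_upper)
qed

end

theorem proposition3p10:
  fixes A :: "'a::ab_group_add planar_data"
  assumes "irreducible_subfactor_planar_algebra A"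
  shows "(\<forall>p q s. 0 < p \<and> 0 < q \<and> 1 / p + 1 / q \<ge> 1 \<and> 1 / p \<ge> 1 / 2 \<longrightarrow>
            fourier_const A s p q = ereal (delta A powr real_of_ereal (2 / q - 1)))
       \<and> (\<forall>s. \<forall>x\<in>box A 2 s.
            ((\<exists>p q. 0 < p \<and> 0 < q \<and> 1 / p + 1 / q > 1 \<and> 1 / p > 1 / 2 \<and> fourier_extremal A s p q x)
              \<longleftrightarrow> (\<forall>p q. 0 < p \<and> 0 < q \<and> 1 / p + 1 / q \<ge> 1 \<and> 1 / p \<ge> 1 / 2
                      \<longrightarrow> fourier_extremal A s p q x))
          \<and> ((\<forall>p q. 0 < p \<and> 0 < q \<and> 1 / p + 1 / q \<ge> 1 \<and> 1 / p \<ge> 1 / 2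
                      \<longrightarrow> fourier_extremal A s p q x)
              \<longleftrightarrow> multiple_of_trace_one_projection A s x))"
proof -
  interpret irreducible_subfactor_planar_algebra A by (rule assms)
  have interior: "\<exists>p q :: ereal. 0 < p \<and> 0 < q \<and> 1 / p + 1 / q > 1 \<and> 1 / p > 1 / 2"
    by (intro exI[of _ 1]) (simp add: one_ereal_def)
  have const: "\<forall>p q s. 0 < p \<and> 0 < q \<and> 1 / p + 1 / q \<ge> 1 \<and> 1 / p \<ge> 1 / 2 \<longrightarrow>
      fourier_const A s p q = ereal (delta A powr real_of_ereal (2 / q - 1))"
    using fourier_const_eq by blast
  have some_imp_multiple: "multiple_of_trace_one_projection A s x"
    if "x \<in> box A 2 s" "\<exists>p q. 0 < p \<and> 0 < q \<and> 1 / p + 1 / q > 1 \<and> 1 / p > 1 / 2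
        \<and> fourier_extremal A s p q x" for s x
    using multiple_of_fourier_extremal that by blast
  have multiple_imp_all: "\<forall>p q. 0 < p \<and> 0 < q \<and> 1 / p + 1 / q \<ge> 1 \<and> 1 / p \<ge> 1 / 2
      \<longrightarrow> fourier_extremal A s p q x"
    if "multiple_of_trace_one_projection A s x" for s x
    using fourier_extremal_of_multiple that by blast
  have all_imp_some: "\<exists>p q. 0 < p \<and> 0 < q \<and> 1 / p + 1 / q > 1 \<and> 1 / p > 1 / 2
      \<and> fourier_extremal A s p q x"
    if "\<forall>p q. 0 < p \<and> 0 < q \<and> 1 / p + 1 / q \<ge> 1 \<and> 1 / p \<ge> 1 / 2 \<longrightarrow> fourier_extremal A s p q x" for s x
    using interior that less_imp_le by metis
  have cycle: "(P \<longrightarrow> R) \<Longrightarrow> (R \<longrightarrow> Q) \<Longrightarrow> (Q \<longrightarrow> P) \<Longrightarrow> (P \<longleftrightarrow> Q) \<and> (Q \<longleftrightarrow> R)" for P Q R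
    by blast
  show ?thesis
  proof (rule conjI[OF const], intro allI ballI, rule cycle)
    fix s x assume x: "x \<in> box A 2 s"
    show "(\<exists>p q. 0 < p \<and> 0 < q \<and> 1 / p + 1 / q > 1 \<and> 1 / p > 1 / 2 \<and> fourier_extremal A s p q x)
        \<longrightarrow> multiple_of_trace_one_projection A s x"
      by (rule impI, rule some_imp_multiple[OF x])
    show "multiple_of_trace_one_projection A s x \<longrightarrow>
        (\<forall>p q. 0 < p \<and> 0 < q \<and> 1 / p + 1 / q \<ge> 1 \<and> 1 / p \<ge> 1 / 2 \<longrightarrow> fourier_extremal A s p q x)"
      by (rule impI, rule multiple_imp_all)
    show "(\<forall>p q. 0 < p \<and> 0 < q \<and> 1 / p + 1 / q \<ge> 1 \<and> 1 / p \<ge> 1 / 2 \<longrightarrow> fourier_extremal A s p q x)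
        \<longrightarrow> (\<exists>p q. 0 < p \<and> 0 < q \<and> 1 / p + 1 / q > 1 \<and> 1 / p > 1 / 2 \<and> fourier_extremal A s p q x)"
      by (rule impI, rule all_imp_some)
  qed
qed

end
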